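(* Let $R$ be a weakly small associative ring and let $\Gamma=\mathrm{acl}(A)$ for some finite subset $A$ of $R$. Then the ring $\Gamma/J(\Gamma)$ is isomorphic to a finite Cartesian product of matrix rings over division rings.
   Context: Rings are associative, not necessarily unitary nor commutative, and may carry extra first-order structure. A first-order structure $M$ is weakly small if for every finite subset $A$ of $M$ there are only countably many complete $1$-types over $A$. $\mathrm{acl}$ denotes model-theoretic algebraic closure; $\Gamma$ is a subring of $R$. $J(\Gamma)$ is the Jacobson radical of the ring $\Gamma$: the unique maximal right ideal of $\Gamma$ all of whose elements $r$ are right quasi-regular (there is $s\in\Gamma$ with $r+s+rs=0$). Finite products may be empty (giving the zero ring). *)

theory Defs
  imports "HOL-Algebra.Algebra"
begin

section \<open>First-order languages and structures\<close>

record ('f, 'r) language =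
  funs :: "'f set"
  rels :: "'r set"
  fun_arity :: "'f \<Rightarrow> nat"
  rel_arity :: "'r \<Rightarrow> nat"

record ('f, 'r, 'a) fo_structure =
  univ :: "'a set"
  fun_interp :: "'f \<Rightarrow> 'a list \<Rightarrow> 'a"
  rel_interp :: "'r \<Rightarrow> 'a list \<Rightarrow> bool"

definition is_structure :: "('f, 'r) language \<Rightarrow> ('f, 'r, 'a) fo_structure \<Rightarrow> bool" where
  "is_structure L M \<longleftrightarrow>
     univ M \<noteq> {} \<and>
     (\<forall>f\<in>funs L. \<forall>xs\<in>lists (univ M). length xs = fun_arity L f \<longrightarrow> fun_interp M f xs \<in> univ M)"

text \<open>
  Formulas with parameters: the constructor \<open>Param\<close> turns an element of a structure into a
  constant symbol for itself, so that the well-formed formulas below, with parameters from a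
  set \<open>A\<close>, are the formulas of the language \<open>L(A)\<close>.
\<close>

datatype ('f, 'a) fo_term = Var nat | Param 'a | Fn 'f "('f, 'a) fo_term list"

datatype ('f, 'r, 'a) fo_formula =
    Equal "('f, 'a) fo_term" "('f, 'a) fo_term"
  | Rel 'r "('f, 'a) fo_term list"
  | Neg "('f, 'r, 'a) fo_formula"
  | Conj "('f, 'r, 'a) fo_formula" "('f, 'r, 'a) fo_formula"
  | Exists nat "('f, 'r, 'a) fo_formula"

fun wf_term :: "('f, 'r) language \<Rightarrow> 'a set \<Rightarrow> ('f, 'a) fo_term \<Rightarrow> bool" where
  "wf_term L A (Var n) \<longleftrightarrow> True"
| "wf_term L A (Param a) \<longleftrightarrow> a \<in> A"
| "wf_term L A (Fn f ts) \<longleftrightarrow>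
     f \<in> funs L \<and> length ts = fun_arity L f \<and> (\<forall>t\<in>set ts. wf_term L A t)"

fun wf_formula :: "('f, 'r) language \<Rightarrow> 'a set \<Rightarrow> ('f, 'r, 'a) fo_formula \<Rightarrow> bool" where
  "wf_formula L A (Equal s t) \<longleftrightarrow> wf_term L A s \<and> wf_term L A t"
| "wf_formula L A (Rel r ts) \<longleftrightarrow>
     r \<in> rels L \<and> length ts = rel_arity L r \<and> (\<forall>t\<in>set ts. wf_term L A t)"
| "wf_formula L A (Neg \<phi>) \<longleftrightarrow> wf_formula L A \<phi>"
| "wf_formula L A (Conj \<phi> \<psi>) \<longleftrightarrow> wf_formula L A \<phi> \<and> wf_formula L A \<psi>"
| "wf_formula L A (Exists n \<phi>) \<longleftrightarrow> wf_formula L A \<phi>"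

fun term_vars :: "('f, 'a) fo_term \<Rightarrow> nat set" where
  "term_vars (Var n) = {n}"
| "term_vars (Param a) = {}"
| "term_vars (Fn f ts) = (\<Union>t\<in>set ts. term_vars t)"

fun free_vars :: "('f, 'r, 'a) fo_formula \<Rightarrow> nat set" where
  "free_vars (Equal s t) = term_vars s \<union> term_vars t"
| "free_vars (Rel r ts) = (\<Union>t\<in>set ts. term_vars t)"
| "free_vars (Neg \<phi>) = free_vars \<phi>"
| "free_vars (Conj \<phi> \<psi>) = free_vars \<phi> \<union> free_vars \<psi>"
| "free_vars (Exists n \<phi>) = free_vars \<phi> - {n}"

fun eval :: "('f, 'r, 'a) fo_structure \<Rightarrow> (nat \<Rightarrow> 'a) \<Rightarrow> ('f, 'a) fo_term \<Rightarrow> 'a" where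
  "eval M e (Var n) = e n"
| "eval M e (Param a) = a"
| "eval M e (Fn f ts) = fun_interp M f (map (eval M e) ts)"

fun sat :: "('f, 'r, 'a) fo_structure \<Rightarrow> (nat \<Rightarrow> 'a) \<Rightarrow> ('f, 'r, 'a) fo_formula \<Rightarrow> bool" where
  "sat M e (Equal s t) \<longleftrightarrow> eval M e s = eval M e t"
| "sat M e (Rel r ts) \<longleftrightarrow> rel_interp M r (map (eval M e) ts)"
| "sat M e (Neg \<phi>) \<longleftrightarrow> \<not> sat M e \<phi>"
| "sat M e (Conj \<phi> \<psi>) \<longleftrightarrow> sat M e \<phi> \<and> sat M e \<psi>"
| "sat M e (Exists n \<phi>) \<longleftrightarrow> (\<exists>a\<in>univ M. sat M (e(n := a)) \<phi>)"


section \<open>Types, weak smallness and algebraic closure\<close>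

text \<open>Formulas over \<open>A\<close> in the single free variable \<open>Var 0\<close>.\<close>

definition unary_formulas :: "('f, 'r) language \<Rightarrow> 'a set \<Rightarrow> ('f, 'r, 'a) fo_formula set" where
  "unary_formulas L A = {\<phi>. wf_formula L A \<phi> \<and> free_vars \<phi> \<subseteq> {0}}"

text \<open>Satisfaction of a unary formula by an element; only the value of \<open>Var 0\<close> is relevant.\<close>

definition sat1 :: "('f, 'r, 'a) fo_structure \<Rightarrow> 'a \<Rightarrow> ('f, 'r, 'a) fo_formula \<Rightarrow> bool" where
  "sat1 M a \<phi> \<longleftrightarrow> sat M (\<lambda>_. a) \<phi>"

text \<open>
  Types need not be realised in \<open>M\<close>. Being finitely satisfiable in \<open>M\<close> is the same as being
  consistent with the \<open>L(A)\<close>-theory of \<open>M\<close>.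
\<close>

definition complete_1_types ::
  "('f, 'r) language \<Rightarrow> ('f, 'r, 'a) fo_structure \<Rightarrow> 'a set \<Rightarrow> ('f, 'r, 'a) fo_formula set set" where
  "complete_1_types L M A =
     {p. p \<subseteq> unary_formulas L A \<and>
         (\<forall>\<Phi>\<subseteq>p. finite \<Phi> \<longrightarrow> (\<exists>a\<in>univ M. \<forall>\<phi>\<in>\<Phi>. sat1 M a \<phi>)) \<and>
         (\<forall>\<phi>\<in>unary_formulas L A. \<phi> \<in> p \<or> Neg \<phi> \<in> p)}"

definition weakly_small :: "('f, 'r) language \<Rightarrow> ('f, 'r, 'a) fo_structure \<Rightarrow> bool" where
  "weakly_small L M \<longleftrightarrow> (\<forall>A. finite A \<and> A \<subseteq> univ M \<longrightarrow> countable (complete_1_types L M A))"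

definition acl :: "('f, 'r) language \<Rightarrow> ('f, 'r, 'a) fo_structure \<Rightarrow> 'a set \<Rightarrow> 'a set" where
  "acl L M A =
     {b \<in> univ M. \<exists>\<phi>\<in>unary_formulas L A. finite {c \<in> univ M. sat1 M c \<phi>} \<and> sat1 M b \<phi>}"


section \<open>Rings without unit\<close>

text \<open>
  Associative rings, not necessarily unitary or commutative. They are carried by the library's
  ring records, whose field \<open>one\<close> is left unconstrained; isomorphisms ignore that field.
\<close>

locale rng = abelian_group R for R (structure) +
  assumes rng_m_closed: "\<lbrakk>x \<in> carrier R; y \<in> carrier R\<rbrakk> \<Longrightarrow> x \<otimes> y \<in> carrier R"
    and rng_m_assoc: "\<lbrakk>x \<in> carrier R; y \<in> carrier R; z \<in> carrier R\<rbrakk> \<Longrightarrow>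
      (x \<otimes> y) \<otimes> z = x \<otimes> (y \<otimes> z)"
    and rng_l_distr: "\<lbrakk>x \<in> carrier R; y \<in> carrier R; z \<in> carrier R\<rbrakk> \<Longrightarrow>
      (x \<oplus> y) \<otimes> z = x \<otimes> z \<oplus> y \<otimes> z"
    and rng_r_distr: "\<lbrakk>x \<in> carrier R; y \<in> carrier R; z \<in> carrier R\<rbrakk> \<Longrightarrow>
      z \<otimes> (x \<oplus> y) = z \<otimes> x \<oplus> z \<otimes> y"

definition rng_isomorphic :: "('a, 'm) ring_scheme \<Rightarrow> ('b, 'n) ring_scheme \<Rightarrow> bool" where
  "rng_isomorphic R S \<longleftrightarrow>
     (\<exists>h. bij_betw h (carrier R) (carrier S) \<and>
          (\<forall>x\<in>carrier R. \<forall>y\<in>carrier R.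
             h (x \<oplus>\<^bsub>R\<^esub> y) = h x \<oplus>\<^bsub>S\<^esub> h y \<and> h (x \<otimes>\<^bsub>R\<^esub> y) = h x \<otimes>\<^bsub>S\<^esub> h y))"

text \<open>
  \<open>M\<close> is the ring \<open>R\<close>, possibly with extra structure: the language contains symbols for
  zero, addition, negation and multiplication, interpreted by the operations of \<open>R\<close>.
\<close>

definition expands_rng ::
  "('f, 'r) language \<Rightarrow> ('f, 'r, 'a) fo_structure \<Rightarrow> ('a, 'm) ring_scheme \<Rightarrow> bool" where
  "expands_rng L M R \<longleftrightarrow>
     univ M = carrier R \<and>
     (\<exists>z\<in>funs L. fun_arity L z = 0 \<and> fun_interp M z [] = \<zero>\<^bsub>R\<^esub>) \<and>
     (\<exists>p\<in>funs L. fun_arity L p = 2 \<and>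
        (\<forall>x\<in>carrier R. \<forall>y\<in>carrier R. fun_interp M p [x, y] = x \<oplus>\<^bsub>R\<^esub> y)) \<and>
     (\<exists>n\<in>funs L. fun_arity L n = 1 \<and>
        (\<forall>x\<in>carrier R. fun_interp M n [x] = \<ominus>\<^bsub>R\<^esub> x)) \<and>
     (\<exists>t\<in>funs L. fun_arity L t = 2 \<and>
        (\<forall>x\<in>carrier R. \<forall>y\<in>carrier R. fun_interp M t [x, y] = x \<otimes>\<^bsub>R\<^esub> y))"


section \<open>The Jacobson radical\<close>

definition right_ideal :: "'a set \<Rightarrow> ('a, 'm) ring_scheme \<Rightarrow> bool" where
  "right_ideal I G \<longleftrightarrow>
     additive_subgroup I G \<and> (\<forall>x\<in>I. \<forall>r\<in>carrier G. x \<otimes>\<^bsub>G\<^esub> r \<in> I)"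

definition right_quasi_regular :: "('a, 'm) ring_scheme \<Rightarrow> 'a \<Rightarrow> bool" where
  "right_quasi_regular G r \<longleftrightarrow>
     (\<exists>s\<in>carrier G. r \<oplus>\<^bsub>G\<^esub> s \<oplus>\<^bsub>G\<^esub> r \<otimes>\<^bsub>G\<^esub> s = \<zero>\<^bsub>G\<^esub>)"

definition quasi_regular_right_ideal :: "'a set \<Rightarrow> ('a, 'm) ring_scheme \<Rightarrow> bool" where
  "quasi_regular_right_ideal I G \<longleftrightarrow> right_ideal I G \<and> (\<forall>r\<in>I. right_quasi_regular G r)"

definition jacobson_radical :: "('a, 'm) ring_scheme \<Rightarrow> 'a set" where
  "jacobson_radical G =
     (THE J. quasi_regular_right_ideal J G \<and>
             (\<forall>K. quasi_regular_right_ideal K G \<and> J \<subseteq> K \<longrightarrow> K = J))"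

text \<open>The radical is well defined: there is exactly one maximal quasi-regular right ideal.\<close>

context rng
begin

lemma rng_l_null:
  assumes "x \<in> carrier R"
  shows "\<zero> \<otimes> x = \<zero>"
proof -
  have "\<zero> \<otimes> x \<oplus> \<zero> \<otimes> x = \<zero> \<otimes> x \<oplus> \<zero>"
    using assms rng_l_distr[of \<zero> \<zero> x] by (simp add: rng_m_closed)
  then show ?thesis
    using assms by (simp add: rng_m_closed)
qed

lemma right_ideal_iff:
  "right_ideal I R \<longleftrightarrow>
     I \<subseteq> carrier R \<and> \<zero> \<in> I \<and> (\<forall>x\<in>I. \<forall>y\<in>I. x \<oplus> y \<in> I) \<and> (\<forall>x\<in>I. \<ominus> x \<in> I) \<and>
     (\<forall>x\<in>I. \<forall>r\<in>carrier R. x \<otimes> r \<in> I)"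
proof -
  have "additive_subgroup I R \<longleftrightarrow>
      I \<subseteq> carrier R \<and> \<zero> \<in> I \<and> (\<forall>x\<in>I. \<forall>y\<in>I. x \<oplus> y \<in> I) \<and> (\<forall>x\<in>I. \<ominus> x \<in> I)"
    unfolding additive_subgroup_def subgroup_def by (auto simp: a_inv_def)
  then show ?thesis
    unfolding right_ideal_def by blast
qed

lemma right_quasi_regular_add:
  assumes "a \<in> carrier R" "right_quasi_regular R a"
    and "quasi_regular_right_ideal K R" "b \<in> K"
  shows "right_quasi_regular R (a \<oplus> b)"
proof -
  obtain a' where a': "a' \<in> carrier R" "a \<oplus> a' \<oplus> a \<otimes> a' = \<zero>"
    using assms(2) unfolding right_quasi_regular_def by blast
  have K: "right_ideal K R" "\<And>r. r \<in> K \<Longrightarrow> right_quasi_regular R r"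
    using assms(3) unfolding quasi_regular_right_ideal_def by auto
  have b: "b \<in> carrier R" and "b \<oplus> b \<otimes> a' \<in> K"
    using K(1) assms(4) a'(1) unfolding right_ideal_iff by auto
  then obtain c where c: "c \<in> carrier R" "b \<oplus> b \<otimes> a' \<oplus> c \<oplus> (b \<oplus> b \<otimes> a') \<otimes> c = \<zero>"
    using K(2) unfolding right_quasi_regular_def by blast
  let ?s = "a' \<oplus> c \<oplus> a' \<otimes> c"
  note cl = assms(1) b a'(1) c(1) rng_m_closed
  have "(a \<oplus> b) \<oplus> ?s \<oplus> (a \<oplus> b) \<otimes> ?s =
      (a \<oplus> a' \<oplus> a \<otimes> a') \<oplus> (a \<oplus> a' \<oplus> a \<otimes> a') \<otimes> c
        \<oplus> (b \<oplus> b \<otimes> a' \<oplus> c \<oplus> (b \<oplus> b \<otimes> a') \<otimes> c)"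
    by (simp add: cl rng_l_distr rng_r_distr rng_m_assoc a_ac)
  also have "\<dots> = \<zero>"
    unfolding a'(2) c(2) using c(1) by (simp add: rng_l_null)
  finally show ?thesis
    unfolding right_quasi_regular_def using cl by blast
qed

lemma quasi_regular_right_ideal_sum:
  assumes I: "quasi_regular_right_ideal I R" and K: "quasi_regular_right_ideal K R"
  shows "quasi_regular_right_ideal {a \<oplus> b | a b. a \<in> I \<and> b \<in> K} R" (is "quasi_regular_right_ideal ?S R")
proof -
  have rI: "right_ideal I R" and rK: "right_ideal K R"
    using I K unfolding quasi_regular_right_ideal_def by auto
  note rIK = rI[unfolded right_ideal_iff] rK[unfolded right_ideal_iff]
  have cl: "\<And>a. a \<in> I \<Longrightarrow> a \<in> carrier R" "\<And>b. b \<in> K \<Longrightarrow> b \<in> carrier R"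
    using rIK by auto
  have "right_ideal ?S R"
    unfolding right_ideal_iff
  proof (intro conjI ballI)
    show "?S \<subseteq> carrier R" using cl by auto
    show "\<zero> \<in> ?S" using rIK by (auto intro!: exI[of _ \<zero>])
  next
    fix x y assume "x \<in> ?S" "y \<in> ?S"
    then obtain a b a' b' where ab: "x = a \<oplus> b" "y = a' \<oplus> b'" "a \<in> I" "b \<in> K" "a' \<in> I" "b' \<in> K"
      by blast
    then have "x \<oplus> y = (a \<oplus> a') \<oplus> (b \<oplus> b')" using cl by (simp add: a_ac)
    then show "x \<oplus> y \<in> ?S" using ab rIK by blast
  next
    fix x assume "x \<in> ?S"
    then obtain a b where ab: "x = a \<oplus> b" "a \<in> I" "b \<in> K" by blast
    then have "\<ominus> x = \<ominus> a \<oplus> \<ominus> b" using cl by (simp add: minus_add)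
    then show "\<ominus> x \<in> ?S" using ab rIK by blast
  next
    fix x r assume "x \<in> ?S" and r: "r \<in> carrier R"
    then obtain a b where ab: "x = a \<oplus> b" "a \<in> I" "b \<in> K" by blast
    then have "x \<otimes> r = a \<otimes> r \<oplus> b \<otimes> r" using cl r by (simp add: rng_l_distr)
    then show "x \<otimes> r \<in> ?S" using ab rIK r by blast
  qed
  moreover have "right_quasi_regular R x" if "x \<in> ?S" for x
    using that right_quasi_regular_add[OF _ _ K] I cl
    unfolding quasi_regular_right_ideal_def by blast
  ultimately show ?thesis
    unfolding quasi_regular_right_ideal_def by blast
qed

lemma jacobson_radical_ex1:
  "\<exists>!J. quasi_regular_right_ideal J R \<and>
        (\<forall>K. quasi_regular_right_ideal K R \<and> J \<subseteq> K \<longrightarrow> K = J)"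
proof -
  let ?J = "\<Union>{I. quasi_regular_right_ideal I R}"
  have rid: "right_ideal I R" if "quasi_regular_right_ideal I R" for I
    using that unfolding quasi_regular_right_ideal_def by blast
  have "quasi_regular_right_ideal {\<zero>} R"
    unfolding quasi_regular_right_ideal_def right_ideal_iff right_quasi_regular_def
    by (auto simp: rng_l_null intro!: bexI[of _ \<zero>])
  then have zero: "\<zero> \<in> ?J" by blast
  have add: "x \<oplus> y \<in> ?J" if xy: "x \<in> ?J" "y \<in> ?J" for x y
  proof -
    obtain I K where "quasi_regular_right_ideal I R" "quasi_regular_right_ideal K R" "x \<in> I" "y \<in> K"
      using xy by blast
    then show ?thesis
      using quasi_regular_right_ideal_sum[of I K] by blast
  qed
  have "right_ideal ?J R"
    unfolding right_ideal_iff
  proof (intro conjI ballI)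
    show "?J \<subseteq> carrier R" using rid unfolding right_ideal_iff by blast
    show "\<zero> \<in> ?J" by (rule zero)
    show "\<And>x y. x \<in> ?J \<Longrightarrow> y \<in> ?J \<Longrightarrow> x \<oplus> y \<in> ?J" by (rule add)
    show "\<And>x. x \<in> ?J \<Longrightarrow> \<ominus> x \<in> ?J" using rid unfolding right_ideal_iff by blast
    show "\<And>x r. x \<in> ?J \<Longrightarrow> r \<in> carrier R \<Longrightarrow> x \<otimes> r \<in> ?J"
      using rid unfolding right_ideal_iff by blast
  qed
  then have J: "quasi_regular_right_ideal ?J R"
    unfolding quasi_regular_right_ideal_def by blast
  have le: "K \<subseteq> ?J" if "quasi_regular_right_ideal K R" for K
    using that by blast
  show ?thesis
  proof (rule ex1I[of _ ?J])
    show "quasi_regular_right_ideal ?J R \<and>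
        (\<forall>K. quasi_regular_right_ideal K R \<and> ?J \<subseteq> K \<longrightarrow> K = ?J)"
      using J le by (meson subset_antisym)
    show "J' = ?J" if "quasi_regular_right_ideal J' R \<and>
        (\<forall>K. quasi_regular_right_ideal K R \<and> J' \<subseteq> K \<longrightarrow> K = J')" for J'
      using that J le by metis
  qed
qed

end


section \<open>Matrix rings over division rings\<close>

definition division_ring :: "('a, 'm) ring_scheme \<Rightarrow> bool" where
  "division_ring D \<longleftrightarrow>
     ring D \<and> \<one>\<^bsub>D\<^esub> \<noteq> \<zero>\<^bsub>D\<^esub> \<and> Units D = carrier D - {\<zero>\<^bsub>D\<^esub>}"

definition matrix_ring :: "nat \<Rightarrow> ('a, 'm) ring_scheme \<Rightarrow> (nat \<times> nat \<Rightarrow> 'a) ring" where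
  "matrix_ring n D =
     \<lparr>carrier = ({..<n} \<times> {..<n}) \<rightarrow>\<^sub>E carrier D,
      monoid.mult = (\<lambda>A B. \<lambda>(i, j)\<in>{..<n} \<times> {..<n}. \<Oplus>\<^bsub>D\<^esub>k\<in>{..<n}. A (i, k) \<otimes>\<^bsub>D\<^esub> B (k, j)),
      one = (\<lambda>(i, j)\<in>{..<n} \<times> {..<n}. if i = j then \<one>\<^bsub>D\<^esub> else \<zero>\<^bsub>D\<^esub>),
      ring.zero = (\<lambda>_\<in>{..<n} \<times> {..<n}. \<zero>\<^bsub>D\<^esub>),
      add = (\<lambda>A B. \<lambda>ij\<in>{..<n} \<times> {..<n}. A ij \<oplus>\<^bsub>D\<^esub> B ij)\<rparr>"

end

theory Submission
  imports Defs
begin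

text \<open>
  Write \<open>\<Gamma>\<close> for the algebraic closure of the finite set \<open>A\<close>. Weak smallness enters through a
  chain condition: a descending chain of subgroups of \<open>\<Gamma>\<close>, each of them the trace on \<open>\<Gamma>\<close> of a
  set definable with parameters from \<open>\<Gamma>\<close>, becomes stationary (\<open>chain_stationary\<close>). Everything
  after that is ring theory.

  For the chain condition, the types of the finite tuples of \<open>\<Gamma>\<close> over \<open>A\<close> are isolated and have
  finitely many realisations. Hence the elementary permutations of \<open>\<Gamma>\<close> over \<open>A\<close> form a group with
  finite orbits, two tuples of the same type are conjugate (\<open>Aut_homogeneous\<close>), and a trace
  fixed by the permutations that fix a finite set \<open>B\<close> pointwise is definable over \<open>A \<union> B\<close>. A
  binary tree of such traces would give uncountably many types over \<open>A \<union> B\<close>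
  (\<open>no_binary_tree_of_traces\<close>). The chain condition follows from the absence of these trees, in
  three steps. A strictly descending chain of invariant subgroups yields a tree of finite unions
  of cosets (\<open>invariant_chain_stationary\<close>). A chain with infinite indices yields a tree of sets
  that contain cosets up to small pieces, where smallness is controlled by B. H. Neumann's
  covering lemma (\<open>no_infinite_index_chain\<close>). In a chain with finite indices, the intersections
  of the finitely many conjugates of the members form an invariant chain, and this reduces
  the last case to the first.

  Applied to the multiples of iterated squares, the chain condition makes every \<open>a\<close> in \<open>\<Gamma>\<close>
  strongly pi-regular in the whole ring: a power \<open>b\<close> of \<open>a\<close> has a commuting inverse \<open>c\<close> with
  \<open>b c b = b\<close> and \<open>c b c = c\<close>. As \<open>c\<close> is unique, it lies in \<open>\<Gamma>\<close>. Applied to annihilators and fixed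
  points of idempotents, the chain condition excludes infinite chains of idempotents.

  In a ring with these two properties, a right ideal that is not contained in the radical has a
  nonzero idempotent. There are orthogonal primitive idempotents with a largest sum, this sum
  is a unit modulo the radical (\<open>maximal_idem_unit_mod_radical\<close>), and each of them generates a
  simple right ideal modulo the radical (\<open>primitive_idem_unit\<close>). The theorem of Wedderburn and
  Artin then takes the form of explicit matrix units (\<open>matrix_decomposition\<close>).
\<close>

section \<open>Definable relations\<close>

fun subst_term :: "(nat \<Rightarrow> ('f, 'a) fo_term) \<Rightarrow> ('f, 'a) fo_term \<Rightarrow> ('f, 'a) fo_term" where
  "subst_term s (Var n) = s n"
| "subst_term s (Param a) = Param a"
| "subst_term s (Fn f ts) = Fn f (map (subst_term s) ts)"

lemma eval_subst_term: "eval M e (subst_term s t) = eval M (\<lambda>n. eval M e (s n)) t"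
  by (induction t) (auto simp: comp_def intro!: arg_cong[where f = "fun_interp M _"])

lemma term_vars_subst_term: "term_vars (subst_term s t) = (\<Union>n\<in>term_vars t. term_vars (s n))"
  by (induction t) auto

lemma wf_subst_term:
  assumes "wf_term L A t" "A \<subseteq> C" "\<And>n. wf_term L C (s n)"
  shows "wf_term L C (subst_term s t)"
  using assms(1) by (induction t) (use assms(2,3) in auto)

lemma finite_term_vars: "finite (term_vars t)"
  by (induction t) auto

lemma finite_free_vars: "finite (free_vars \<phi>)"
  by (induction \<phi>) (auto simp: finite_term_vars)

lemma eval_cong:
  assumes "\<And>n. n \<in> term_vars t \<Longrightarrow> e n = e' n"
  shows "eval M e t = eval M e' t"
  using assms
proof (induction t)
  case (Fn f ts)
  have "map (eval M e) ts = map (eval M e') ts"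
  proof (rule list.map_cong0)
    fix t assume t: "t \<in> set ts"
    show "eval M e t = eval M e' t"
      by (rule Fn.IH[OF t]) (use t Fn.prems in auto)
  qed
  then show ?case by (simp only: eval.simps)
qed auto

lemma sat_cong:
  assumes "\<And>n. n \<in> free_vars \<phi> \<Longrightarrow> e n = e' n"
  shows "sat M e \<phi> \<longleftrightarrow> sat M e' \<phi>"
  using assms
proof (induction \<phi> arbitrary: e e')
  case (Equal s t)
  then show ?case using eval_cong[of s e e' M] eval_cong[of t e e' M] by auto
next
  case (Rel r ts)
  then have "map (eval M e) ts = map (eval M e') ts"
    by (auto intro!: eval_cong)
  then show ?case by (simp only: sat.simps)
next
  case (Neg \<phi>)
  have "sat M e \<phi> \<longleftrightarrow> sat M e' \<phi>" by (rule Neg.IH) (use Neg.prems in auto)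
  then show ?case by (simp only: sat.simps)
next
  case (Conj \<phi> \<psi>)
  have "sat M e \<phi> \<longleftrightarrow> sat M e' \<phi>" by (rule Conj.IH(1)) (use Conj.prems in auto)
  moreover have "sat M e \<psi> \<longleftrightarrow> sat M e' \<psi>" by (rule Conj.IH(2)) (use Conj.prems in auto)
  ultimately show ?case by (simp only: sat.simps)
next
  case (Exists n \<phi>)
  have "sat M (e(n := a)) \<phi> \<longleftrightarrow> sat M (e'(n := a)) \<phi>" for a
    by (rule Exists.IH) (use Exists.prems in auto)
  then show ?case by simp
qed

text \<open>
  A bound variable is renamed away from the variables of the substituted terms, so that none of
  them is captured.
\<close>

lemma formula_substitution:
  assumes "wf_formula L A \<phi>" "A \<subseteq> C" "\<And>n. wf_term L C (s n)"
  shows "\<exists>\<phi>'. wf_formula L C \<phi>' \<and> free_vars \<phi>' \<subseteq> (\<Union>n\<in>free_vars \<phi>. term_vars (s n)) \<and>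
    (\<forall>e. sat M e \<phi>' \<longleftrightarrow> sat M (\<lambda>n. eval M e (s n)) \<phi>)"
  using assms(1,3)
proof (induction \<phi> arbitrary: s)
  case (Equal t u)
  then show ?case
    by (intro exI[of _ "Equal (subst_term s t) (subst_term s u)"])
      (auto simp: wf_subst_term[OF _ assms(2)] eval_subst_term term_vars_subst_term)
next
  case (Rel r ts)
  then show ?case
    by (intro exI[of _ "Rel r (map (subst_term s) ts)"])
      (auto simp: wf_subst_term[OF _ assms(2)] eval_subst_term term_vars_subst_term comp_def)
next
  case (Neg \<phi>)
  have "wf_formula L A \<phi>" using Neg.prems(1) by simp
  from Neg.IH[of s, OF this Neg.prems(2)] obtain \<phi>' where
    "wf_formula L C \<phi>'" "free_vars \<phi>' \<subseteq> (\<Union>n\<in>free_vars \<phi>. term_vars (s n))"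
    "\<forall>e. sat M e \<phi>' \<longleftrightarrow> sat M (\<lambda>n. eval M e (s n)) \<phi>"
    by (elim exE conjE) (rule that)
  then have "wf_formula L C (Neg \<phi>') \<and>
      free_vars (Neg \<phi>') \<subseteq> (\<Union>n\<in>free_vars (Neg \<phi>). term_vars (s n)) \<and>
      (\<forall>e. sat M e (Neg \<phi>') \<longleftrightarrow> sat M (\<lambda>n. eval M e (s n)) (Neg \<phi>))"
    by simp
  then show ?case by (rule exI)
next
  case (Conj \<phi> \<psi>)
  have w: "wf_formula L A \<phi>" "wf_formula L A \<psi>" using Conj.prems(1) by simp_all
  from Conj.IH(1)[of s, OF w(1) Conj.prems(2)] obtain \<phi>' where
    1: "wf_formula L C \<phi>'" "free_vars \<phi>' \<subseteq> (\<Union>n\<in>free_vars \<phi>. term_vars (s n))"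
    "\<forall>e. sat M e \<phi>' \<longleftrightarrow> sat M (\<lambda>n. eval M e (s n)) \<phi>"
    by (elim exE conjE) (rule that)
  from Conj.IH(2)[of s, OF w(2) Conj.prems(2)] obtain \<psi>' where
    2: "wf_formula L C \<psi>'" "free_vars \<psi>' \<subseteq> (\<Union>n\<in>free_vars \<psi>. term_vars (s n))"
    "\<forall>e. sat M e \<psi>' \<longleftrightarrow> sat M (\<lambda>n. eval M e (s n)) \<psi>"
    by (elim exE conjE) (rule that)
  have "free_vars (Conj \<phi>' \<psi>') \<subseteq> (\<Union>n\<in>free_vars (Conj \<phi> \<psi>). term_vars (s n))"
    using 1(2) 2(2) by auto
  then show ?case
    by (intro exI[of _ "Conj \<phi>' \<psi>'"] conjI) (simp_all add: 1(1,3) 2(1,3))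
next
  case (Exists n \<phi>)
  have "finite (\<Union>v\<in>free_vars \<phi>. term_vars (s v))"
    by (simp add: finite_free_vars finite_term_vars)
  then obtain m where m: "m \<notin> (\<Union>v\<in>free_vars \<phi>. term_vars (s v))"
    using ex_new_if_finite[OF infinite_UNIV_nat] by blast
  let ?s = "s(n := Var m)"
  obtain \<phi>' where 1: "wf_formula L C \<phi>'" "free_vars \<phi>' \<subseteq> (\<Union>v\<in>free_vars \<phi>. term_vars (?s v))"
    "\<forall>e. sat M e \<phi>' \<longleftrightarrow> sat M (\<lambda>v. eval M e (?s v)) \<phi>"
  proof -
    have "wf_formula L A \<phi>" "\<And>v. wf_term L C (?s v)" using Exists.prems by auto
    from Exists.IH[of ?s, OF this] show thesis by (elim exE conjE) (rule that)
  qed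
  have "sat M (e(m := a)) \<phi>' \<longleftrightarrow> sat M ((\<lambda>v. eval M e (s v))(n := a)) \<phi>" for e a
  proof -
    have "sat M (e(m := a)) \<phi>' \<longleftrightarrow> sat M (\<lambda>v. eval M (e(m := a)) (?s v)) \<phi>"
      by (rule 1(3)[rule_format])
    also have "\<dots> \<longleftrightarrow> sat M ((\<lambda>v. eval M e (s v))(n := a)) \<phi>"
      by (rule sat_cong) (use m in \<open>auto intro!: eval_cong\<close>)
    finally show ?thesis .
  qed
  moreover have "free_vars \<phi>' - {m} \<subseteq> (\<Union>v\<in>free_vars \<phi> - {n}. term_vars (s v))"
    using 1(2) by (auto split: if_splits)
  ultimately show ?case
    by (intro exI[of _ "Exists m \<phi>'"] conjI) (simp_all add: 1(1))
qed

locale structure_over =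
  fixes L :: "('f, 'r) language" and M :: "('f, 'r, 'a) fo_structure" and A :: "'a set"
begin

definition tuples :: "nat \<Rightarrow> 'a list set" where
  "tuples k = {xs. set xs \<subseteq> univ M \<and> length xs = k}"

text \<open>
  A formula is identified with the relation that it defines on the lists of length \<open>k\<close>, read as
  assignments to the variables with index below \<open>k\<close>. On other lists the relation may be anything.
\<close>

definition definable :: "nat \<Rightarrow> ('a list \<Rightarrow> bool) \<Rightarrow> bool" where
  "definable k P \<longleftrightarrow> (\<exists>\<phi>. wf_formula L A \<phi> \<and> free_vars \<phi> \<subseteq> {..<k} \<and>
     (\<forall>xs\<in>tuples k. P xs \<longleftrightarrow> sat M ((!) xs) \<phi>))"

lemma definableI:
  assumes "wf_formula L A \<phi>" "free_vars \<phi> \<subseteq> {..<k}"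
    and "\<And>xs. xs \<in> tuples k \<Longrightarrow> P xs \<longleftrightarrow> sat M ((!) xs) \<phi>"
  shows "definable k P"
  using assms unfolding definable_def by blast

lemma definableE:
  assumes "definable k P"
  obtains \<phi> where "wf_formula L A \<phi>" "free_vars \<phi> \<subseteq> {..<k}"
    "\<forall>xs\<in>tuples k. P xs \<longleftrightarrow> sat M ((!) xs) \<phi>"
  using assms unfolding definable_def by (elim exE conjE) (rule that)

lemma definable_cong:
  assumes "definable k P" "\<And>xs. xs \<in> tuples k \<Longrightarrow> P xs \<longleftrightarrow> Q xs"
  shows "definable k Q"
proof -
  obtain \<phi> where \<phi>: "wf_formula L A \<phi>" "free_vars \<phi> \<subseteq> {..<k}"
    "\<forall>xs\<in>tuples k. P xs \<longleftrightarrow> sat M ((!) xs) \<phi>"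
    by (rule definableE[OF assms(1)]) 
  show ?thesis by (rule definableI[OF \<phi>(1,2)]) (simp add: assms(2)[symmetric] \<phi>(3))
qed

lemma definable_not:
  assumes "definable k P"
  shows "definable k (\<lambda>xs. \<not> P xs)"
proof -
  obtain \<phi> where \<phi>: "wf_formula L A \<phi>" "free_vars \<phi> \<subseteq> {..<k}"
    "\<forall>xs\<in>tuples k. P xs \<longleftrightarrow> sat M ((!) xs) \<phi>"
    by (rule definableE[OF assms])
  show ?thesis by (rule definableI[of "Neg \<phi>"]) (simp_all add: \<phi>)
qed

lemma definable_conj:
  assumes "definable k P" "definable k Q"
  shows "definable k (\<lambda>xs. P xs \<and> Q xs)"
proof -
  obtain \<phi> where \<phi>: "wf_formula L A \<phi>" "free_vars \<phi> \<subseteq> {..<k}"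
    "\<forall>xs\<in>tuples k. P xs \<longleftrightarrow> sat M ((!) xs) \<phi>"
    by (rule definableE[OF assms(1)])
  obtain \<psi> where \<psi>: "wf_formula L A \<psi>" "free_vars \<psi> \<subseteq> {..<k}"
    "\<forall>xs\<in>tuples k. Q xs \<longleftrightarrow> sat M ((!) xs) \<psi>"
    by (rule definableE[OF assms(2)])
  show ?thesis by (rule definableI[of "Conj \<phi> \<psi>"]) (simp_all add: \<phi> \<psi>)
qed

lemma definable_disj:
  assumes "definable k P" "definable k Q"
  shows "definable k (\<lambda>xs. P xs \<or> Q xs)"
  by (rule definable_cong[OF
        definable_not[OF definable_conj[OF definable_not[OF assms(1)] definable_not[OF assms(2)]]]])
    blast

lemma definable_imp:
  assumes "definable k P" "definable k Q"
  shows "definable k (\<lambda>xs. P xs \<longrightarrow> Q xs)"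
  by (rule definable_cong[OF definable_disj[OF definable_not[OF assms(1)] assms(2)]]) blast

lemma definable_ex:
  assumes "definable (Suc k) P"
  shows "definable k (\<lambda>xs. \<exists>a\<in>univ M. P (xs @ [a]))"
proof -
  obtain \<phi> where \<phi>: "wf_formula L A \<phi>" "free_vars \<phi> \<subseteq> {..<Suc k}"
    "\<forall>xs\<in>tuples (Suc k). P xs \<longleftrightarrow> sat M ((!) xs) \<phi>"
    by (rule definableE[OF assms])
  show ?thesis
  proof (rule definableI[of "Exists k \<phi>"])
    fix xs assume xs: "xs \<in> tuples k"
    have "P (xs @ [a]) \<longleftrightarrow> sat M (((!) xs)(k := a)) \<phi>" if "a \<in> univ M" for a
    proof -
      have "P (xs @ [a]) \<longleftrightarrow> sat M ((!) (xs @ [a])) \<phi>"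
        by (rule \<phi>(3)[rule_format]) (use xs that in \<open>simp add: tuples_def\<close>)
      also have "\<dots> \<longleftrightarrow> sat M (((!) xs)(k := a)) \<phi>"
        by (rule sat_cong) (use \<phi>(2) xs in \<open>auto simp: nth_append tuples_def\<close>)
      finally show ?thesis .
    qed
    then show "(\<exists>a\<in>univ M. P (xs @ [a])) \<longleftrightarrow> sat M ((!) xs) (Exists k \<phi>)" by simp
  qed (use \<phi> in auto)
qed

lemma definable_all:
  assumes "definable (Suc k) P"
  shows "definable k (\<lambda>xs. \<forall>a\<in>univ M. P (xs @ [a]))"
  by (rule definable_cong[OF definable_not[OF definable_ex[OF definable_not[OF assms]]]]) blast

lemma definable_rename:
  assumes "definable k P" "length is = k" "set is \<subseteq> {..<m}"
  shows "definable m (\<lambda>xs. P (map ((!) xs) is))"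
proof -
  obtain \<phi> where \<phi>: "wf_formula L A \<phi>" "free_vars \<phi> \<subseteq> {..<k}"
    "\<forall>xs\<in>tuples k. P xs \<longleftrightarrow> sat M ((!) xs) \<phi>"
    by (rule definableE[OF assms(1)])
  obtain \<phi>' where \<phi>': "wf_formula L A \<phi>'"
      "free_vars \<phi>' \<subseteq> (\<Union>n\<in>free_vars \<phi>. term_vars (Var (is ! n) :: ('f, 'a) fo_term))"
      "\<forall>e. sat M e \<phi>' \<longleftrightarrow> sat M (\<lambda>n. eval M e (Var (is ! n))) \<phi>"
  proof -
    have "\<And>n. wf_term L A (Var (is ! n))" by simp
    from formula_substitution[of L A \<phi> A "\<lambda>n. Var (is ! n)" M, OF \<phi>(1) subset_refl this]
    show thesis by (elim exE conjE) (rule that)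
  qed
  show ?thesis
  proof (rule definableI[of \<phi>'])
    show "free_vars \<phi>' \<subseteq> {..<m}"
    proof
      fix j assume "j \<in> free_vars \<phi>'"
      then obtain n where "n \<in> free_vars \<phi>" "j = is ! n" using \<phi>'(2) by auto
      then show "j \<in> {..<m}" using \<phi>(2) assms(2,3) by (meson lessThan_iff nth_mem subsetD)
    qed
  next
    fix xs assume xs: "xs \<in> tuples m"
    have "map ((!) xs) is \<in> tuples k"
      using xs assms(2,3) by (auto simp: tuples_def subset_iff)
    then have "P (map ((!) xs) is) \<longleftrightarrow> sat M ((!) (map ((!) xs) is)) \<phi>"
      by (rule \<phi>(3)[rule_format])
    also have "\<dots> \<longleftrightarrow> sat M (\<lambda>n. eval M ((!) xs) (Var (is ! n))) \<phi>"
      by (rule sat_cong) (use \<phi>(2) assms(2) in auto)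
    finally show "P (map ((!) xs) is) \<longleftrightarrow> sat M ((!) xs) \<phi>'"
      using \<phi>'(3) by simp
  qed (rule \<phi>'(1))
qed

lemma definable_take:
  assumes "definable k P" "k \<le> m"
  shows "definable m (\<lambda>xs. P (take k xs))"
proof (rule definable_cong)
  show "definable m (\<lambda>xs. P (map ((!) xs) [0..<k]))"
    by (rule definable_rename[OF assms(1)]) (use assms(2) in auto)
  show "P (map ((!) xs) [0..<k]) = P (take k xs)" if "xs \<in> tuples m" for xs
  proof -
    have "map ((!) xs) [0..<k] = take k xs"
      by (rule nth_equalityI) (use that assms(2) in \<open>simp_all add: tuples_def\<close>)
    then show ?thesis by (simp only:)
  qed
qed

lemma definable_drop:
  assumes "definable k P" "m = n + k"
  shows "definable m (\<lambda>xs. P (drop n xs))"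
proof (rule definable_cong)
  show "definable m (\<lambda>xs. P (map ((!) xs) [n..<n + k]))"
    by (rule definable_rename[OF assms(1)]) (use assms(2) in auto)
  show "P (map ((!) xs) [n..<n + k]) = P (drop n xs)" if "xs \<in> tuples m" for xs
  proof -
    have "map ((!) xs) [n..<n + k] = drop n xs"
      by (rule nth_equalityI) (use that assms(2) in \<open>simp_all add: tuples_def\<close>)
    then show ?thesis by (simp only:)
  qed
qed

lemma definable_ex_list:
  assumes "definable (k + m) P"
  shows "definable k (\<lambda>xs. \<exists>ys\<in>tuples m. P (xs @ ys))"
  using assms
proof (induction m arbitrary: P)
  case 0
  then show ?case by (simp add: tuples_def)
next
  case (Suc m)
  have "definable (k + m) (\<lambda>xs. \<exists>a\<in>univ M. P (xs @ [a]))"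
    using definable_ex Suc.prems by simp
  from Suc.IH[OF this] show ?case
  proof (rule definable_cong)
    fix xs
    have "(\<exists>ys\<in>tuples m. \<exists>a\<in>univ M. P ((xs @ ys) @ [a])) \<longleftrightarrow>
        (\<exists>zs\<in>tuples (Suc m). P (xs @ zs))" (is "?l \<longleftrightarrow> ?r")
    proof
      assume ?l
      then obtain ys a where "ys \<in> tuples m" "a \<in> univ M" "P ((xs @ ys) @ [a])" by blast
      then show ?r by (intro bexI[of _ "ys @ [a]"]) (auto simp: tuples_def)
    next
      assume ?r
      then obtain zs where zs: "zs \<in> tuples (Suc m)" "P (xs @ zs)" by blast
      then obtain ys a where "zs = ys @ [a]" by (cases zs rule: rev_cases) (auto simp: tuples_def)
      then show ?l using zs by (intro bexI[of _ ys] bexI[of _ a]) (auto simp: tuples_def)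
    qed
    then show "(\<exists>ys\<in>tuples m. \<exists>a\<in>univ M. P ((xs @ ys) @ [a])) \<longleftrightarrow>
        (\<exists>zs\<in>tuples (Suc m). P (xs @ zs))" .
  qed
qed

lemma definable_eq: "i < k \<Longrightarrow> j < k \<Longrightarrow> definable k (\<lambda>xs. xs ! i = xs ! j)"
  by (rule definableI[of "Equal (Var i) (Var j)"]) auto

section \<open>Types of algebraic tuples\<close>

definition same_type :: "'a list \<Rightarrow> 'a list \<Rightarrow> bool" where
  "same_type xs ys \<longleftrightarrow> xs \<in> tuples (length xs) \<and> ys \<in> tuples (length xs) \<and>
     (\<forall>P. definable (length xs) P \<longrightarrow> P xs = P ys)"

lemma same_type_refl: "set xs \<subseteq> univ M \<Longrightarrow> same_type xs xs"
  by (simp add: same_type_def tuples_def)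

lemma same_type_sym: "same_type xs ys \<Longrightarrow> same_type ys xs"
  unfolding same_type_def by (auto simp: tuples_def)

lemma same_type_trans: "same_type xs ys \<Longrightarrow> same_type ys zs \<Longrightarrow> same_type xs zs"
  unfolding same_type_def by (auto simp: tuples_def)

lemma same_type_length: "same_type xs ys \<Longrightarrow> length ys = length xs"
  by (auto simp: same_type_def tuples_def)

lemma same_typeD: "same_type xs ys \<Longrightarrow> definable (length xs) P \<Longrightarrow> P xs \<longleftrightarrow> P ys"
  by (auto simp: same_type_def)

lemma same_type_reindex:
  assumes "same_type xs ys" "set is \<subseteq> {..<length xs}"
  shows "same_type (map ((!) xs) is) (map ((!) ys) is)"
  unfolding same_type_def
proof (intro conjI allI impI)
  show "map ((!) xs) is \<in> tuples (length (map ((!) xs) is))"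
    "map ((!) ys) is \<in> tuples (length (map ((!) xs) is))"
    using assms by (auto simp: tuples_def same_type_def subset_iff)
next
  fix P assume "definable (length (map ((!) xs) is)) P"
  then have "definable (length xs) (\<lambda>xs. P (map ((!) xs) is))"
    using definable_rename assms(2) by simp
  then show "P (map ((!) xs) is) = P (map ((!) ys) is)"
    by (rule same_typeD[OF assms(1)])
qed

lemma acl_subset_univ: "acl L M A \<subseteq> univ M"
  by (auto simp: acl_def)

lemma acl_iff:
  "x \<in> acl L M A \<longleftrightarrow> x \<in> univ M \<and> (\<exists>P. definable 1 P \<and> finite {a \<in> univ M. P [a]} \<and> P [x])"
proof (intro iffI conjI)
  assume x: "x \<in> acl L M A"
  then show "x \<in> univ M" by (simp add: acl_def)
  from x obtain \<phi> where \<phi>: "\<phi> \<in> unary_formulas L A" "finite {c \<in> univ M. sat1 M c \<phi>}" "sat1 M x \<phi>"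
    by (auto simp: acl_def)
  show "\<exists>P. definable 1 P \<and> finite {a \<in> univ M. P [a]} \<and> P [x]"
  proof (intro exI conjI)
    show "definable 1 (\<lambda>xs. sat1 M (xs ! 0) \<phi>)"
      by (rule definableI[of \<phi>])
        (use \<phi>(1) in \<open>auto simp: unary_formulas_def sat1_def intro!: sat_cong\<close>)
  qed (use \<phi> in auto)
next
  assume r: "x \<in> univ M \<and> (\<exists>P. definable 1 P \<and> finite {a \<in> univ M. P [a]} \<and> P [x])"
  then obtain P where P: "finite {a \<in> univ M. P [a]}" "P [x]" and "definable 1 P" by blast
  obtain \<phi> where
    \<phi>: "wf_formula L A \<phi>" "free_vars \<phi> \<subseteq> {..<1}" "\<forall>xs\<in>tuples 1. P xs \<longleftrightarrow> sat M ((!) xs) \<phi>"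
    by (rule definableE[OF \<open>definable 1 P\<close>])
  have "sat1 M a \<phi> \<longleftrightarrow> P [a]" if "a \<in> univ M" for a
  proof -
    have "sat1 M a \<phi> \<longleftrightarrow> sat M ((!) [a]) \<phi>"
      unfolding sat1_def by (rule sat_cong) (use \<phi>(2) in auto)
    then show ?thesis using \<phi>(3)[rule_format, of "[a]"] that by (simp add: tuples_def)
  qed
  then have "{c \<in> univ M. sat1 M c \<phi>} = {a \<in> univ M. P [a]}" "sat1 M x \<phi>"
    using r P(2) by auto
  moreover have "\<phi> \<in> unary_formulas L A" using \<phi> by (auto simp: unary_formulas_def)
  ultimately show "x \<in> acl L M A" unfolding acl_def using r P(1) by (metis (mono_tags, lifting) CollectI)
qed

lemma same_type_acl:
  assumes "same_type xs ys" "set xs \<subseteq> acl L M A"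
  shows "set ys \<subseteq> acl L M A"
proof
  fix y assume "y \<in> set ys"
  then obtain i where i: "i < length xs" "y = ys ! i"
    using same_type_length[OF assms(1)] by (auto simp: in_set_conv_nth)
  then obtain P where P: "definable 1 P" "finite {a \<in> univ M. P [a]}" "P [xs ! i]"
    using assms(2) acl_iff nth_mem by (metis subsetD)
  have "P [ys ! i]"
    using same_typeD[OF same_type_reindex[OF assms(1), of "[i]"], of P] P i by simp
  moreover have "y \<in> univ M"
    using \<open>y \<in> set ys\<close> assms(1) by (auto simp: same_type_def tuples_def)
  ultimately show "y \<in> acl L M A" using P i acl_iff by blast
qed

lemma algebraic_tuple:
  assumes "set xs \<subseteq> acl L M A"
  shows "\<exists>Q. definable (length xs) Q \<and> Q xs \<and> finite {ys \<in> tuples (length xs). Q ys}"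
  using assms
proof (induction xs rule: rev_induct)
  case Nil
  have "finite (tuples 0)" by (rule finite_subset[of _ "{[]}"]) (auto simp: tuples_def)
  moreover have "definable 0 (\<lambda>_. True)"
    by (rule definableI[of "Neg (Exists 0 (Neg (Equal (Var 0) (Var 0))))"]) auto
  ultimately show ?case by (intro exI[of _ "\<lambda>_. True"]) auto
next
  case (snoc x xs)
  then obtain Q P where Q: "definable (length xs) Q" "Q xs" "finite {ys \<in> tuples (length xs). Q ys}"
    and P: "definable 1 P" "finite {a \<in> univ M. P [a]}" "P [x]"
    using acl_iff[of x] by auto
  let ?R = "\<lambda>zs. Q (take (length xs) zs) \<and> P (drop (length xs) zs)"
  have "definable (length (xs @ [x])) ?R"
    using definable_conj[OF definable_take[OF Q(1)] definable_drop[OF P(1)]] by simp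
  moreover have "?R (xs @ [x])" using Q P by simp
  moreover have "{ys \<in> tuples (length (xs @ [x])). ?R ys} \<subseteq>
      (\<lambda>(ys, a). ys @ [a]) ` ({ys \<in> tuples (length xs). Q ys} \<times> {a \<in> univ M. P [a]})"
  proof
    fix zs assume zs: "zs \<in> {ys \<in> tuples (length (xs @ [x])). ?R ys}"
    then obtain ys a where "zs = ys @ [a]" by (cases zs rule: rev_cases) (auto simp: tuples_def)
    with zs show "zs \<in> (\<lambda>(ys, a). ys @ [a]) ` ({ys \<in> tuples (length xs). Q ys} \<times> {a \<in> univ M. P [a]})"
      by (intro rev_image_eqI[of "(ys, a)"]) (auto simp: tuples_def)
  qed
  then have "finite {ys \<in> tuples (length (xs @ [x])). ?R ys}"
    using Q(3) P(2) finite_subset by blast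
  ultimately show ?case by blast
qed

text \<open>
  Among the definable relations that hold of an algebraic tuple and have finitely many
  solutions, one with the fewest solutions isolates the type of the tuple: any further definable
  relation would cut down its set of solutions.
\<close>

lemma isolating_relation:
  assumes "set xs \<subseteq> acl L M A"
  obtains \<theta> where "definable (length xs) \<theta>" "\<theta> xs" "finite {ys \<in> tuples (length xs). \<theta> ys}"
    and "\<forall>ys\<in>tuples (length xs). \<theta> ys \<longrightarrow> same_type xs ys"
proof -
  let ?k = "length xs"
  have xs: "xs \<in> tuples ?k" using assms acl_subset_univ by (auto simp: tuples_def)
  let ?S = "\<lambda>Q. {ys \<in> tuples ?k. Q ys}"
  let ?C = "\<lambda>Q. definable ?k Q \<and> Q xs \<and> finite (?S Q)"
  obtain Q0 where "?C Q0" using algebraic_tuple[OF assms] by blast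
  from ex_has_least_nat[of ?C, OF this, of "\<lambda>Q. card (?S Q)"]
  obtain \<theta> where \<theta>: "?C \<theta>" and min: "\<And>Q. ?C Q \<Longrightarrow> card (?S \<theta>) \<le> card (?S Q)"
    by blast
  have dec: "Q ys" if "definable ?k Q" "Q xs" "ys \<in> tuples ?k" "\<theta> ys" for Q ys
  proof (rule ccontr)
    assume "\<not> Q ys"
    let ?R = "\<lambda>ys. \<theta> ys \<and> Q ys"
    have "?S ?R \<subset> ?S \<theta>" using \<open>\<not> Q ys\<close> that by auto
    then have "card (?S ?R) < card (?S \<theta>)" using \<theta> psubset_card_mono by blast
    moreover have "finite (?S ?R)"
      by (rule finite_subset[of _ "?S \<theta>"]) (use \<theta> in auto)
    then have "?C ?R" using \<theta> that(1,2) definable_conj by simp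
    then have "card (?S \<theta>) \<le> card (?S ?R)" by (rule min)
    ultimately show False by simp
  qed
  have "\<forall>ys\<in>tuples ?k. \<theta> ys \<longrightarrow> same_type xs ys"
    unfolding same_type_def
  proof (intro ballI conjI allI impI)
    fix ys P assume ys: "ys \<in> tuples ?k" "\<theta> ys" and P: "definable ?k P"
    show "P xs = P ys"
      using dec[OF P _ ys] dec[OF definable_not[OF P] _ ys] by blast
  qed (use xs in simp_all)
  moreover have "definable ?k \<theta>" "\<theta> xs" "finite (?S \<theta>)" using \<theta> by simp_all
  ultimately show thesis by (rule that[rotated 3])
qed

lemma finite_same_type:
  assumes "set xs \<subseteq> acl L M A"
  shows "finite {ys. same_type xs ys}"
proof -
  obtain \<theta> where \<theta>: "definable (length xs) \<theta>" "\<theta> xs" "finite {ys \<in> tuples (length xs). \<theta> ys}"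
    using isolating_relation[OF assms] by metis
  have "{ys. same_type xs ys} \<subseteq> {ys \<in> tuples (length xs). \<theta> ys}"
    using \<theta> by (auto simp: same_type_def)
  then show ?thesis using \<theta>(3) finite_subset by blast
qed

lemma same_type_extend:
  assumes "same_type xs ys" "set xs \<subseteq> acl L M A" "c \<in> acl L M A"
  shows "\<exists>d. same_type (xs @ [c]) (ys @ [d])"
proof -
  have "set (xs @ [c]) \<subseteq> acl L M A" using assms(2,3) by simp
  then obtain \<theta> where \<theta>: "definable (length (xs @ [c])) \<theta>" "\<theta> (xs @ [c])"
    "finite {zs \<in> tuples (length (xs @ [c])). \<theta> zs}"
    "\<forall>zs\<in>tuples (length (xs @ [c])). \<theta> zs \<longrightarrow> same_type (xs @ [c]) zs"
    by (rule isolating_relation)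
  have "definable (length xs) (\<lambda>xs. \<exists>a\<in>univ M. \<theta> (xs @ [a]))"
    using definable_ex \<theta>(1) by simp
  then have "(\<exists>a\<in>univ M. \<theta> (xs @ [a])) \<longleftrightarrow> (\<exists>a\<in>univ M. \<theta> (ys @ [a]))"
    by (rule same_typeD[OF assms(1)])
  then obtain d where "d \<in> univ M" "\<theta> (ys @ [d])"
    using \<theta>(2) assms(3) acl_subset_univ by blast
  then show ?thesis
    using \<theta>(4)[rule_format, of "ys @ [d]"] assms(1) by (auto simp: same_type_def tuples_def)
qed

text \<open>
  Each realisation of the isolated type of \<open>b\<close> determines at most one solution, so the solutions
  for all of them form a finite set, which is definable without \<open>b\<close>.
\<close>

lemma unique_solution_algebraic:
  assumes "set b \<subseteq> acl L M A" "definable (Suc (length b)) P" "z \<in> univ M"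
    and "\<And>y. y \<in> univ M \<Longrightarrow> P (b @ [y]) \<longleftrightarrow> y = z"
  shows "z \<in> acl L M A"
proof -
  let ?k = "length b"
  obtain \<theta> where \<theta>: "definable ?k \<theta>" "\<theta> b" "finite {ys \<in> tuples ?k. \<theta> ys}"
    using isolating_relation[OF assms(1)] by metis
  have bt: "b \<in> tuples ?k" using assms(1) acl_subset_univ by (auto simp: tuples_def)
  let ?U = "\<lambda>zs. P zs \<and> (\<forall>y\<in>univ M. P (take ?k zs @ [y]) \<longrightarrow> y = zs ! ?k)"
  have "definable (Suc (Suc ?k)) (\<lambda>zs. P (map ((!) zs) ([0..<?k] @ [Suc ?k])) \<longrightarrow> zs ! Suc ?k = zs ! ?k)"
    by (intro definable_imp definable_rename[OF assms(2)] definable_eq) auto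
  from definable_all[OF this]
  have "definable (Suc ?k) (\<lambda>zs. \<forall>y\<in>univ M. P (take ?k zs @ [y]) \<longrightarrow> y = zs ! ?k)"
  proof (rule definable_cong)
    fix zs assume "zs \<in> tuples (Suc ?k)"
    then have l: "length zs = Suc ?k" by (simp add: tuples_def)
    have "map ((!) (zs @ [y])) ([0..<?k] @ [Suc ?k]) = take ?k zs @ [y]" for y
      using l by (auto intro!: nth_equalityI simp: nth_append)
    then show "(\<forall>y\<in>univ M. P (map ((!) (zs @ [y])) ([0..<?k] @ [Suc ?k])) \<longrightarrow>
        (zs @ [y]) ! Suc ?k = (zs @ [y]) ! ?k) \<longleftrightarrow>
      (\<forall>y\<in>univ M. P (take ?k zs @ [y]) \<longrightarrow> y = zs ! ?k)"
      using l by (simp add: nth_append)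
  qed
  then have U: "definable (Suc ?k) ?U" using definable_conj[OF assms(2)] by blast
  have "definable (1 + ?k) (\<lambda>zs. \<theta> (drop 1 zs) \<and> ?U (map ((!) zs) ([1..<Suc ?k] @ [0])))"
    by (rule definable_conj[OF definable_drop[OF \<theta>(1)] definable_rename[OF U]])
      (auto simp del: upt_Suc)
  from definable_ex_list[OF this]
  have D: "definable 1 (\<lambda>xs. \<exists>c\<in>tuples ?k. \<theta> c \<and> ?U (c @ [xs ! 0]))"
  proof (rule definable_cong)
    fix xs assume "xs \<in> tuples 1"
    then obtain x where x: "xs = [x]" by (auto simp: tuples_def length_Suc_conv)
    have "map ((!) (x # c)) ([1..<Suc ?k] @ [0]) = c @ [x]" if "c \<in> tuples ?k" for c
    proof -
      have "[1..<Suc ?k] = map Suc [0..<?k]" by (simp add: map_Suc_upt del: upt_Suc)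
      moreover have "map ((!) c) [0..<?k] = c"
        by (rule nth_equalityI) (use that in \<open>simp_all add: tuples_def\<close>)
      ultimately show ?thesis by (simp add: comp_def del: upt_Suc)
    qed
    then show "(\<exists>c\<in>tuples ?k. \<theta> (drop 1 (xs @ c)) \<and> ?U (map ((!) (xs @ c)) ([1..<Suc ?k] @ [0]))) \<longleftrightarrow>
      (\<exists>c\<in>tuples ?k. \<theta> c \<and> ?U (c @ [xs ! 0]))"
      unfolding x by (intro bex_cong refl) (simp del: upt_Suc)
  qed
  let ?V = "\<lambda>x. \<exists>c\<in>tuples ?k. \<theta> c \<and> ?U (c @ [x])"
  have "{x \<in> univ M. ?V x} \<subseteq> (\<lambda>c. THE x. x \<in> univ M \<and> ?U (c @ [x])) ` {ys \<in> tuples ?k. \<theta> ys}"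
  proof
    fix x assume "x \<in> {x \<in> univ M. ?V x}"
    then obtain c where c: "x \<in> univ M" "c \<in> tuples ?k" "\<theta> c" "?U (c @ [x])" by blast
    have l: "length c = ?k" using c(2) by (simp add: tuples_def)
    have "x = (THE x. x \<in> univ M \<and> ?U (c @ [x]))"
    proof (rule the_equality[symmetric])
      show "x \<in> univ M \<and> ?U (c @ [x])" using c(1,4) by (rule conjI)
      fix y assume "y \<in> univ M \<and> ?U (c @ [y])"
      then have "P (take ?k (c @ [x]) @ [y])" "y \<in> univ M" using l by simp_all
      then have "y = (c @ [x]) ! ?k" using c(4) by blast
      then show "y = x" using l by (simp add: nth_append)
    qed
    then show "x \<in> (\<lambda>c. THE x. x \<in> univ M \<and> ?U (c @ [x])) ` {ys \<in> tuples ?k. \<theta> ys}"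
      using c by blast
  qed
  then have "finite {x \<in> univ M. ?V x}" using \<theta>(3) finite_subset by blast
  moreover have "?V z"
  proof (rule bexI[OF _ bt], intro conjI ballI impI)
    show "\<theta> b" by (rule \<theta>(2))
    show "P (b @ [z])" using assms(3,4) by blast
    fix y assume "y \<in> univ M" "P (take ?k (b @ [z]) @ [y])"
    then show "y = (b @ [z]) ! ?k" using assms(4) by simp
  qed
  ultimately have "definable 1 (\<lambda>xs. ?V (xs ! 0)) \<and> finite {a \<in> univ M. ?V ([a] ! 0)} \<and> ?V ([z] ! 0)"
    using D by (simp only: nth_Cons_0 simp_thms)
  then show ?thesis unfolding acl_iff using assms(3) by blast
qed

end

section \<open>Elementary permutations of the algebraic closure\<close>

context structure_over
begin

text \<open>
  Partial maps are sets of pairs, not assumed to be functional: equality is a definable relation,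
  so an elementary set of pairs is the graph of an injection anyway.
\<close>

definition elementary :: "('a \<times> 'a) set \<Rightarrow> bool" where
  "elementary F \<longleftrightarrow> (\<forall>us. set us \<subseteq> F \<longrightarrow> same_type (map fst us) (map snd us))"

lemma same_type_pairs_mono:
  assumes "same_type (map fst us) (map snd us)" "set vs \<subseteq> set us"
  shows "same_type (map fst vs) (map snd vs)"
proof -
  have "\<exists>is. length is = length vs \<and> (\<forall>j<length vs. is ! j < length us \<and> us ! (is ! j) = vs ! j)"
  proof -
    have "\<forall>j. \<exists>i. j < length vs \<longrightarrow> i < length us \<and> us ! i = vs ! j"
      using assms(2) by (metis in_set_conv_nth nth_mem subsetD)
    then obtain f where f: "\<And>j. j < length vs \<Longrightarrow> f j < length us \<and> us ! f j = vs ! j"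
      by metis
    show ?thesis by (rule exI[of _ "map f [0..<length vs]"]) (simp add: f)
  qed
  then obtain js where js: "length js = length vs"
    "\<And>j. j < length vs \<Longrightarrow> js ! j < length us" "\<And>j. j < length vs \<Longrightarrow> us ! (js ! j) = vs ! j"
    by blast
  have "set js \<subseteq> {..<length (map fst us)}"
    using js(1,2) by (auto simp: in_set_conv_nth)
  from same_type_reindex[OF assms(1) this]
  have "same_type (map ((!) (map fst us)) js) (map ((!) (map snd us)) js)" .
  moreover have "map ((!) (map fst us)) js = map fst vs" "map ((!) (map snd us)) js = map snd vs"
    by (rule nth_equalityI; simp add: js)+
  ultimately show ?thesis by (simp only:)
qed

text \<open>
  Algebraicity replaces saturation here: the candidates for the image of \<open>c\<close> form a finite set.
\<close>

lemma elementary_extend_point: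
  assumes F: "elementary F" "F \<subseteq> acl L M A \<times> acl L M A" and c: "c \<in> acl L M A"
  shows "\<exists>d\<in>acl L M A. elementary (insert (c, d) F)"
proof (rule ccontr)
  assume neg: "\<not> ?thesis"
  let ?E = "{d. same_type [c] [d]}"
  have "finite ((\<lambda>ys. hd ys) ` {ys. same_type [c] ys})"
    using finite_same_type[of "[c]"] c by simp
  moreover have "?E \<subseteq> (\<lambda>ys. hd ys) ` {ys. same_type [c] ys}"
    by (auto intro: rev_image_eqI)
  ultimately have fin: "finite ?E" by (rule rev_finite_subset)
  have "\<exists>ps. set ps \<subseteq> insert (c, d) F \<and> \<not> same_type (map fst ps) (map snd ps)" if "d \<in> ?E" for d
  proof -
    have "d \<in> acl L M A" using same_type_acl[of "[c]" "[d]"] that c by simp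
    then show ?thesis using neg unfolding elementary_def by blast
  qed
  then obtain ps where ps: "\<And>d. d \<in> ?E \<Longrightarrow> set (ps d) \<subseteq> insert (c, d) F"
    "\<And>d. d \<in> ?E \<Longrightarrow> \<not> same_type (map fst (ps d)) (map snd (ps d))"
    by metis
  \<comment> \<open>Only finitely many images are possible, so one finite part of \<open>F\<close> refutes all of them.\<close>
  have "finite (F \<inter> (\<Union>d\<in>?E. set (ps d)))" using fin by blast
  then obtain us where us: "set us = F \<inter> (\<Union>d\<in>?E. set (ps d))" using finite_list by blast
  have T: "same_type (map fst us) (map snd us)" using F(1) us by (simp add: elementary_def)
  have "set (map fst us) \<subseteq> acl L M A" using us F(2) by auto
  from same_type_extend[OF T this c] obtain d where
    "same_type (map fst us @ [c]) (map snd us @ [d])" by blast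
  then have d: "same_type (map fst (us @ [(c, d)])) (map snd (us @ [(c, d)]))" by simp
  have "d \<in> ?E" using same_type_pairs_mono[OF d, of "[(c, d)]"] by simp
  moreover have "set (ps d) \<subseteq> set (us @ [(c, d)])" using us ps(1)[OF \<open>d \<in> ?E\<close>] \<open>d \<in> ?E\<close> by auto
  then have "same_type (map fst (ps d)) (map snd (ps d))" by (rule same_type_pairs_mono[OF d])
  ultimately show False using ps(2) by blast
qed

definition Aut :: "('a \<Rightarrow> 'a) set" where
  "Aut = {\<sigma>. \<forall>xs. set xs \<subseteq> acl L M A \<longrightarrow> same_type xs (map \<sigma> xs)}"

lemma AutD: "\<sigma> \<in> Aut \<Longrightarrow> set xs \<subseteq> acl L M A \<Longrightarrow> same_type xs (map \<sigma> xs)"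
  by (simp add: Aut_def)

lemma Aut_closed: "\<sigma> \<in> Aut \<Longrightarrow> x \<in> acl L M A \<Longrightarrow> \<sigma> x \<in> acl L M A"
  using AutD[of \<sigma> "[x]"] same_type_acl[of "[x]" "[\<sigma> x]"] by simp

lemma same_type_eq_iff:
  assumes "same_type [x, y] [x', y']"
  shows "x = y \<longleftrightarrow> x' = y'"
  using same_typeD[OF assms, of "\<lambda>xs. xs ! 0 = xs ! 1"] definable_eq[of 0 2 1]
  by (simp add: numeral_2_eq_2)

text \<open>Surjectivity is free: an injection of the finite set of conjugates of a point is onto.\<close>

lemma Aut_bij:
  assumes "\<sigma> \<in> Aut"
  shows "bij_betw \<sigma> (acl L M A) (acl L M A)"
proof -
  have inj: "inj_on \<sigma> (acl L M A)"
    using same_type_eq_iff[OF AutD[OF assms, of "[_, _]", simplified]] by (auto simp: inj_on_def)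
  have "y \<in> \<sigma> ` acl L M A" if y: "y \<in> acl L M A" for y
  proof -
    let ?O = "{z. same_type [y] [z]}"
    have O: "?O \<subseteq> acl L M A"
    proof
      fix z assume "z \<in> ?O"
      then show "z \<in> acl L M A" using same_type_acl[of "[y]" "[z]"] y by simp
    qed
    have "finite ((\<lambda>ys. hd ys) ` {ys. same_type [y] ys})"
      using finite_same_type[of "[y]"] y by simp
    moreover have "?O \<subseteq> (\<lambda>ys. hd ys) ` {ys. same_type [y] ys}"
      by (auto intro: rev_image_eqI)
    ultimately have fin: "finite ?O" by (rule rev_finite_subset)
    have "\<sigma> ` ?O \<subseteq> ?O"
      using same_type_trans AutD[OF assms, of "[_]"] O by fastforce
    moreover have "inj_on \<sigma> ?O" using inj O by (rule inj_on_subset)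
    ultimately have "\<sigma> ` ?O = ?O" using endo_inj_surj[OF fin] by blast
    moreover have "y \<in> ?O" using same_type_refl[of "[y]"] y acl_subset_univ by auto
    ultimately show ?thesis using O by blast
  qed
  then show ?thesis using inj Aut_closed[OF assms] by (auto simp: bij_betw_def)
qed

lemma Aut_id: "(\<lambda>x. x) \<in> Aut"
  using same_type_refl acl_subset_univ by (auto simp: Aut_def)

lemma Aut_comp:
  assumes "\<sigma> \<in> Aut" "\<tau> \<in> Aut"
  shows "(\<lambda>x. \<sigma> (\<tau> x)) \<in> Aut"
  unfolding Aut_def
proof (rule CollectI, intro allI impI)
  fix xs assume xs: "set xs \<subseteq> acl L M A"
  then have "set (map \<tau> xs) \<subseteq> acl L M A" using Aut_closed[OF assms(2)] by auto
  from same_type_trans[OF AutD[OF assms(2) xs] AutD[OF assms(1) this]]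
  show "same_type xs (map (\<lambda>x. \<sigma> (\<tau> x)) xs)" by (simp add: comp_def)
qed

lemma Aut_inverse:
  assumes "\<sigma> \<in> Aut"
  shows "\<exists>\<tau>\<in>Aut. \<forall>x\<in>acl L M A. \<tau> (\<sigma> x) = x"
proof
  let ?\<tau> = "inv_into (acl L M A) \<sigma>"
  note bij = Aut_bij[OF assms]
  show "\<forall>x\<in>acl L M A. ?\<tau> (\<sigma> x) = x" using bij by (simp add: bij_betw_def)
  show "?\<tau> \<in> Aut"
    unfolding Aut_def
  proof (rule CollectI, intro allI impI)
    fix xs assume xs: "set xs \<subseteq> acl L M A"
    have "set (map ?\<tau> xs) \<subseteq> acl L M A"
      using xs bij_betw_inv_into[OF bij] by (auto simp: bij_betw_def)
    from AutD[OF assms this] have "same_type (map ?\<tau> xs) (map (\<lambda>x. \<sigma> (?\<tau> x)) xs)"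
      by (simp add: comp_def)
    moreover have "map (\<lambda>x. \<sigma> (?\<tau> x)) xs = xs"
      by (rule map_idI) (use xs bij_betw_inv_into_right[OF bij] in blast)
    ultimately show "same_type xs (map ?\<tau> xs)" using same_type_sym by simp
  qed
qed

text \<open>
  The algebraic closure is homogeneous, although the structure need not be: by Zorn's lemma
  an elementary partial map of the algebraic closure extends to a total one.
\<close>

lemma Aut_homogeneous:
  assumes "same_type b b'" "set b \<subseteq> acl L M A"
  shows "\<exists>\<sigma>\<in>Aut. map \<sigma> b = b'"
proof -
  let ?\<Gamma> = "acl L M A"
  let ?F0 = "set (zip b b')"
  have len: "length b' = length b" by (rule same_type_length[OF assms(1)])
  let ?X = "{F. ?F0 \<subseteq> F \<and> F \<subseteq> ?\<Gamma> \<times> ?\<Gamma> \<and> elementary F}"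
  have "elementary ?F0"
    unfolding elementary_def
  proof (intro allI impI)
    fix us assume "set us \<subseteq> ?F0"
    moreover have "same_type (map fst (zip b b')) (map snd (zip b b'))"
      using assms(1) len by simp
    ultimately show "same_type (map fst us) (map snd us)" by (rule same_type_pairs_mono[rotated])
  qed
  moreover have "?F0 \<subseteq> ?\<Gamma> \<times> ?\<Gamma>"
    using assms(2) same_type_acl[OF assms] by (auto dest: set_zip_leftD set_zip_rightD)
  ultimately have "?X \<noteq> {}" by blast
  moreover have "\<Union>\<C> \<in> ?X" if ch: "\<C> \<noteq> {}" "subset.chain ?X \<C>" for \<C>
  proof -
    have "\<C> \<subseteq> ?X" using ch(2) by (simp add: subset.chain_def)
    moreover have "elementary (\<Union>\<C>)"
      unfolding elementary_def
    proof (intro allI impI)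
      fix us assume "set us \<subseteq> \<Union>\<C>"
      then obtain F where "F \<in> \<C>" "set us \<subseteq> F"
        using finite_subset_Union_chain[OF finite_set _ ch] by blast
      then have "elementary F" using \<open>\<C> \<subseteq> ?X\<close> by blast
      then show "same_type (map fst us) (map snd us)"
        unfolding elementary_def using \<open>set us \<subseteq> F\<close> by blast
    qed
    moreover have "?F0 \<subseteq> \<Union>\<C>" using ch(1) \<open>\<C> \<subseteq> ?X\<close> by blast
    moreover have "\<Union>\<C> \<subseteq> ?\<Gamma> \<times> ?\<Gamma>" using \<open>\<C> \<subseteq> ?X\<close> by blast
    ultimately show ?thesis by simp
  qed
  ultimately have "\<exists>F\<in>?X. \<forall>F'\<in>?X. F \<subseteq> F' \<longrightarrow> F' = F" by (rule subset_Zorn_nonempty)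
  then obtain F where F: "F \<in> ?X" and max: "\<forall>F'\<in>?X. F \<subseteq> F' \<longrightarrow> F' = F" by (elim bexE) (rule that)
  have el: "elementary F" and sub: "F \<subseteq> ?\<Gamma> \<times> ?\<Gamma>" using F by simp_all
  have total: "\<exists>d. (c, d) \<in> F" if c: "c \<in> ?\<Gamma>" for c
  proof -
    obtain d where d: "d \<in> ?\<Gamma>" "elementary (insert (c, d) F)"
      using elementary_extend_point[OF el sub c] by blast
    have "insert (c, d) F \<in> ?X" using F d c by auto
    then have "insert (c, d) F = F" by (rule mp[OF bspec[OF max]]) (rule subset_insertI)
    then show ?thesis by blast
  qed
  define \<sigma> where "\<sigma> = (\<lambda>c. SOME d. (c, d) \<in> F)"
  have \<sigma>: "(c, \<sigma> c) \<in> F" if "c \<in> ?\<Gamma>" for c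
    unfolding \<sigma>_def using total[OF that] by (rule someI_ex)
  have "\<sigma> \<in> Aut"
    unfolding Aut_def
  proof (rule CollectI, intro allI impI)
    fix xs assume "set xs \<subseteq> ?\<Gamma>"
    then have "set (map (\<lambda>x. (x, \<sigma> x)) xs) \<subseteq> F" using \<sigma> by auto
    then have "same_type (map fst (map (\<lambda>x. (x, \<sigma> x)) xs)) (map snd (map (\<lambda>x. (x, \<sigma> x)) xs))"
      using el unfolding elementary_def by blast
    then show "same_type xs (map \<sigma> xs)" by (simp add: comp_def)
  qed
  moreover have "map \<sigma> b = b'"
  proof (rule nth_equalityI)
    fix i assume "i < length (map \<sigma> b)"
    then have i: "i < length b" by simp
    have "(b ! i, b' ! i) \<in> ?F0" using i len by (auto simp: in_set_zip)
    then have "(b ! i, b' ! i) \<in> F" using F by blast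
    moreover have "(b ! i, \<sigma> (b ! i)) \<in> F" using \<sigma> assms(2) nth_mem[OF i] by blast
    ultimately have "set [(b ! i, b' ! i), (b ! i, \<sigma> (b ! i))] \<subseteq> F" by simp
    with el have "same_type (map fst [(b ! i, b' ! i), (b ! i, \<sigma> (b ! i))])
        (map snd [(b ! i, b' ! i), (b ! i, \<sigma> (b ! i))])"
      unfolding elementary_def by blast
    then have "same_type [b ! i, b ! i] [b' ! i, \<sigma> (b ! i)]" by simp
    from same_type_eq_iff[OF this] show "map \<sigma> b ! i = b' ! i" using i by simp
  qed (simp add: len)
  ultimately show ?thesis by blast
qed

section \<open>Traces of definable sets and weak smallness\<close>

definition traces :: "'a set set" where
  "traces = {D. \<exists>b P. set b \<subseteq> acl L M A \<and> definable (Suc (length b)) P \<and>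
     D = {x \<in> acl L M A. P (b @ [x])}}"

lemma tracesI:
  assumes "set b \<subseteq> acl L M A" "definable (Suc (length b)) P"
  shows "{x \<in> acl L M A. P (b @ [x])} \<in> traces"
  using assms unfolding traces_def by blast

lemma tracesE:
  assumes "D \<in> traces"
  obtains b P where "set b \<subseteq> acl L M A" "definable (Suc (length b)) P"
    "D = {x \<in> acl L M A. P (b @ [x])}"
  using assms unfolding traces_def by blast

lemma traces_subset: "D \<in> traces \<Longrightarrow> D \<subseteq> acl L M A"
  by (auto simp: traces_def)

lemma traces_compl:
  assumes "D \<in> traces"
  shows "acl L M A - D \<in> traces"
proof -
  obtain b P where b: "set b \<subseteq> acl L M A" "definable (Suc (length b)) P"
    "D = {x \<in> acl L M A. P (b @ [x])}"
    by (rule tracesE[OF assms])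
  have "acl L M A - D = {x \<in> acl L M A. \<not> P (b @ [x])}" using b(3) by blast
  then show ?thesis using tracesI[OF b(1) definable_not[OF b(2)]] by simp
qed

lemma traces_Int:
  assumes "D \<in> traces" "E \<in> traces"
  shows "D \<inter> E \<in> traces"
proof -
  obtain b P where b: "set b \<subseteq> acl L M A" "definable (Suc (length b)) P"
    "D = {x \<in> acl L M A. P (b @ [x])}"
    by (rule tracesE[OF assms(1)])
  obtain c Q where c: "set c \<subseteq> acl L M A" "definable (Suc (length c)) Q"
    "E = {x \<in> acl L M A. Q (c @ [x])}"
    by (rule tracesE[OF assms(2)])
  let ?n = "length b" and ?m = "length c"
  let ?R = "\<lambda>xs. P (map ((!) xs) ([0..<?n] @ [?n + ?m])) \<and> Q (drop ?n xs)"
  have "definable (Suc (length (b @ c))) ?R"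
    by (rule definable_conj[OF definable_rename[OF b(2)] definable_drop[OF c(2)]]) auto
  from tracesI[OF _ this] have "{x \<in> acl L M A. ?R ((b @ c) @ [x])} \<in> traces"
    using b(1) c(1) by simp
  moreover have "map ((!) ((b @ c) @ [x])) ([0..<?n] @ [?n + ?m]) = b @ [x]" for x
    by (rule nth_equalityI) (auto simp: nth_append)
  then have "{x \<in> acl L M A. ?R ((b @ c) @ [x])} = D \<inter> E" using b(3) c(3) by auto
  ultimately show ?thesis by simp
qed

lemma Aut_image_trace:
  assumes "\<sigma> \<in> Aut" "set b \<subseteq> acl L M A" "definable (Suc (length b)) P"
  shows "\<sigma> ` {x \<in> acl L M A. P (b @ [x])} = {x \<in> acl L M A. P (map \<sigma> b @ [x])}"
proof -
  have eq: "P (b @ [x]) \<longleftrightarrow> P (map \<sigma> b @ [\<sigma> x])" if "x \<in> acl L M A" for x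
    using same_typeD[OF AutD[OF assms(1), of "b @ [x]"], of P] assms(2,3) that by simp
  show ?thesis
  proof (intro equalityI subsetI)
    fix y assume "y \<in> \<sigma> ` {x \<in> acl L M A. P (b @ [x])}"
    then show "y \<in> {x \<in> acl L M A. P (map \<sigma> b @ [x])}"
      using eq Aut_closed[OF assms(1)] by auto
  next
    fix y assume y: "y \<in> {x \<in> acl L M A. P (map \<sigma> b @ [x])}"
    then obtain x where "x \<in> acl L M A" "y = \<sigma> x"
      using Aut_bij[OF assms(1)] by (auto simp: bij_betw_def)
    then show "y \<in> \<sigma> ` {x \<in> acl L M A. P (b @ [x])}" using eq y by auto
  qed
qed

lemma traces_image:
  assumes "D \<in> traces" "\<sigma> \<in> Aut"
  shows "\<sigma> ` D \<in> traces"
proof -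
  obtain b P where b: "set b \<subseteq> acl L M A" "definable (Suc (length b)) P"
    "D = {x \<in> acl L M A. P (b @ [x])}"
    by (rule tracesE[OF assms(1)])
  have "set (map \<sigma> b) \<subseteq> acl L M A" using b(1) Aut_closed[OF assms(2)] by auto
  then show ?thesis
    using Aut_image_trace[OF assms(2) b(1,2)] tracesI[of "map \<sigma> b" P] b(2,3) by simp
qed

lemma finite_trace_orbit:
  assumes "D \<in> traces"
  shows "finite {\<sigma> ` D | \<sigma>. \<sigma> \<in> Aut}"
proof -
  obtain b P where b: "set b \<subseteq> acl L M A" "definable (Suc (length b)) P"
    "D = {x \<in> acl L M A. P (b @ [x])}"
    by (rule tracesE[OF assms(1)])
  have "{\<sigma> ` D | \<sigma>. \<sigma> \<in> Aut} \<subseteq> (\<lambda>c. {x \<in> acl L M A. P (c @ [x])}) ` {c. same_type b c}"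
    using Aut_image_trace[OF _ b(1,2)] AutD[OF _ b(1)] b(3) by auto
  then show ?thesis using finite_same_type[OF b(1)] finite_subset by blast
qed

lemma finite_point_orbit:
  assumes "x \<in> acl L M A"
  shows "finite {\<sigma> x | \<sigma>. \<sigma> \<in> Aut}"
proof -
  have "{\<sigma> x | \<sigma>. \<sigma> \<in> Aut} \<subseteq> hd ` {c. same_type [x] c}"
  proof
    fix y assume "y \<in> {\<sigma> x | \<sigma>. \<sigma> \<in> Aut}"
    then obtain \<sigma> where \<sigma>: "\<sigma> \<in> Aut" "y = \<sigma> x" by blast
    then have "same_type [x] [y]" using AutD[of \<sigma> "[x]"] assms by simp
    then show "y \<in> hd ` {c. same_type [x] c}" by (intro rev_image_eqI[of "[y]"]) simp_all
  qed
  moreover have "finite (hd ` {c. same_type [x] c})" using finite_same_type[of "[x]"] assms by simp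
  ultimately show ?thesis by (rule finite_subset)
qed

lemma trace_support:
  assumes "D \<in> traces"
  shows "\<exists>B. finite B \<and> B \<subseteq> acl L M A \<and> (\<forall>\<sigma>\<in>Aut. (\<forall>x\<in>B. \<sigma> x = x) \<longrightarrow> \<sigma> ` D = D)"
proof -
  obtain b P where b: "set b \<subseteq> acl L M A" "definable (Suc (length b)) P"
    "D = {x \<in> acl L M A. P (b @ [x])}"
    by (rule tracesE[OF assms(1)])
  have "\<sigma> ` D = D" if "\<sigma> \<in> Aut" "\<forall>x\<in>set b. \<sigma> x = x" for \<sigma>
  proof -
    have "map \<sigma> b = b" by (rule map_idI) (use that(2) in blast)
    then show ?thesis using Aut_image_trace[OF that(1) b(1,2)] b(3) by simp
  qed
  then show ?thesis using b(1) by (intro exI[of _ "set b"]) simp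
qed

text \<open>
  A trace fixed by the permutations that fix \<open>B\<close> pointwise is definable over \<open>A \<union> B\<close>: its
  parameters can be quantified away together with the formula that isolates their type over
  \<open>A \<union> B\<close>, because all realisations of that type define the same trace.
\<close>

lemma invariant_trace_formula:
  assumes "D \<in> traces" "finite B" "B \<subseteq> acl L M A"
    and inv: "\<And>\<sigma>. \<sigma> \<in> Aut \<Longrightarrow> (\<forall>x\<in>B. \<sigma> x = x) \<Longrightarrow> \<sigma> ` D = D"
  shows "\<exists>\<phi>\<in>unary_formulas L (A \<union> B). \<forall>x\<in>acl L M A. x \<in> D \<longleftrightarrow> sat1 M x \<phi>"
proof -
  obtain b P where b: "set b \<subseteq> acl L M A" "definable (Suc (length b)) P"
    "D = {x \<in> acl L M A. P (b @ [x])}"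
    by (rule tracesE[OF assms(1)])
  obtain bs where bs: "set bs = B" using finite_list[OF assms(2)] by blast
  let ?n = "length bs" and ?k = "length b"
  have "set (bs @ b) \<subseteq> acl L M A" using bs b(1) assms(3) by simp
  then obtain \<theta> where \<theta>: "definable (length (bs @ b)) \<theta>" "\<theta> (bs @ b)"
    "finite {ys \<in> tuples (length (bs @ b)). \<theta> ys}"
    "\<forall>ys\<in>tuples (length (bs @ b)). \<theta> ys \<longrightarrow> same_type (bs @ b) ys"
    by (rule isolating_relation)
  let ?i = "[0..<?n] @ [Suc ?n..<Suc ?n + ?k]" and ?j = "[Suc ?n..<Suc ?n + ?k] @ [?n]"
  have "definable (Suc ?n + ?k) (\<lambda>zs. \<theta> (map ((!) zs) ?i) \<and> P (map ((!) zs) ?j))"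
    by (rule definable_conj[OF definable_rename[OF \<theta>(1)] definable_rename[OF b(2)]])
      (auto simp del: upt_Suc)
  from definable_ex_list[OF this] obtain \<psi> where
    \<psi>: "wf_formula L A \<psi>" "free_vars \<psi> \<subseteq> {..<Suc ?n}"
    "\<forall>xs\<in>tuples (Suc ?n). (\<exists>c\<in>tuples ?k. \<theta> (map ((!) (xs @ c)) ?i) \<and> P (map ((!) (xs @ c)) ?j))
        \<longleftrightarrow> sat M ((!) xs) \<psi>"
    by (rule definableE)
  let ?s = "\<lambda>i. (if i < ?n then Param (bs ! i) else Var 0) :: ('f, 'a) fo_term"
  have "A \<subseteq> A \<union> B" and "\<And>i. wf_term L (A \<union> B) (?s i)" using bs nth_mem by auto
  from formula_substitution[of L A \<psi> "A \<union> B" ?s M, OF \<psi>(1) this] obtain \<phi> where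
    \<phi>: "wf_formula L (A \<union> B) \<phi>" "free_vars \<phi> \<subseteq> (\<Union>i\<in>free_vars \<psi>. term_vars (?s i))"
    "\<forall>e. sat M e \<phi> \<longleftrightarrow> sat M (\<lambda>i. eval M e (?s i)) \<psi>"
    by (elim exE conjE) (rule that)
  show ?thesis
  proof (rule bexI[of _ \<phi>])
    show "\<phi> \<in> unary_formulas L (A \<union> B)"
      using \<phi>(1,2) by (auto simp: unary_formulas_def split: if_splits)
    show "\<forall>x\<in>acl L M A. x \<in> D \<longleftrightarrow> sat1 M x \<phi>"
    proof
      fix x assume x: "x \<in> acl L M A"
      have t: "bs @ [x] \<in> tuples (Suc ?n)"
        using bs x assms(3) acl_subset_univ by (auto simp: tuples_def)
      have ij: "map ((!) ((bs @ [x]) @ c)) ?i = bs @ c" "map ((!) ((bs @ [x]) @ c)) ?j = c @ [x]"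
        if "c \<in> tuples ?k" for c
        by (rule nth_equalityI; use that in \<open>auto simp: nth_append tuples_def simp del: upt_Suc\<close>)+
      have "sat1 M x \<phi> \<longleftrightarrow> sat M (\<lambda>i. eval M (\<lambda>_. x) (?s i)) \<psi>"
        unfolding sat1_def by (rule \<phi>(3)[rule_format])
      also have "\<dots> \<longleftrightarrow> sat M ((!) (bs @ [x])) \<psi>"
        by (rule sat_cong) (use \<psi>(2) in \<open>auto simp: nth_append\<close>)
      also have "\<dots> \<longleftrightarrow> (\<exists>c\<in>tuples ?k. \<theta> (map ((!) ((bs @ [x]) @ c)) ?i) \<and>
          P (map ((!) ((bs @ [x]) @ c)) ?j))"
        by (rule \<psi>(3)[rule_format, symmetric, OF t])
      also have "\<dots> \<longleftrightarrow> (\<exists>c\<in>tuples ?k. \<theta> (bs @ c) \<and> P (c @ [x]))"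
        by (intro bex_cong refl) (simp only: ij)
      also have "\<dots> \<longleftrightarrow> x \<in> D"
      proof
        assume "x \<in> D"
        moreover have "b \<in> tuples ?k" using b(1) acl_subset_univ by (auto simp: tuples_def)
        ultimately show "\<exists>c\<in>tuples ?k. \<theta> (bs @ c) \<and> P (c @ [x])" using b(3) \<theta>(2) by blast
      next
        assume "\<exists>c\<in>tuples ?k. \<theta> (bs @ c) \<and> P (c @ [x])"
        then obtain c where c: "c \<in> tuples ?k" "\<theta> (bs @ c)" "P (c @ [x])" by blast
        have "bs @ c \<in> tuples (length (bs @ b))"
          using c(1) bs assms(3) acl_subset_univ by (auto simp: tuples_def)
        then have "same_type (bs @ b) (bs @ c)" using \<theta>(4) c(2) by blast
        then obtain \<sigma> where \<sigma>: "\<sigma> \<in> Aut" "map \<sigma> (bs @ b) = bs @ c"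
          using Aut_homogeneous \<open>set (bs @ b) \<subseteq> acl L M A\<close> by blast
        have m: "map \<sigma> bs = bs" "map \<sigma> b = c" using \<sigma>(2) c(1) by (simp_all add: tuples_def)
        have "\<forall>y\<in>B. \<sigma> y = y" using m(1) bs map_idI[of bs \<sigma>] by (metis in_set_conv_nth nth_map)
        then have "\<sigma> ` D = D" using inv \<sigma>(1) by blast
        then show "x \<in> D" using Aut_image_trace[OF \<sigma>(1) b(1,2)] b(3) m(2) c(3) x by blast
      qed
      finally show "x \<in> D \<longleftrightarrow> sat1 M x \<phi>" by blast
    qed
  qed
qed

end

text \<open>
  A maximal finitely satisfiable set of formulas is complete. Satisfiability by points of \<open>S\<close>,
  and not only by points of the structure, is kept because disjointness of traces is a
  statement about the algebraic closure only.
\<close>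

lemma finitely_satisfiable_extends:
  assumes "p0 \<subseteq> unary_formulas L C" "S \<subseteq> univ M"
    and "\<And>\<Phi>. \<Phi> \<subseteq> p0 \<Longrightarrow> finite \<Phi> \<Longrightarrow> \<exists>a\<in>S. \<forall>\<phi>\<in>\<Phi>. sat1 M a \<phi>"
  shows "\<exists>p\<in>complete_1_types L M C. p0 \<subseteq> p \<and>
    (\<forall>\<Phi>\<subseteq>p. finite \<Phi> \<longrightarrow> (\<exists>a\<in>S. \<forall>\<phi>\<in>\<Phi>. sat1 M a \<phi>))"
proof -
  let ?fs = "\<lambda>p. \<forall>\<Phi>\<subseteq>p. finite \<Phi> \<longrightarrow> (\<exists>a\<in>S. \<forall>\<phi>\<in>\<Phi>. sat1 M a \<phi>)"
  let ?X = "{p. p0 \<subseteq> p \<and> p \<subseteq> unary_formulas L C \<and> ?fs p}"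
  have "?X \<noteq> {}" using assms(1,3) by blast
  moreover have "\<Union>\<C> \<in> ?X" if ch: "\<C> \<noteq> {}" "subset.chain ?X \<C>" for \<C>
  proof -
    have sub: "\<C> \<subseteq> ?X" using ch(2) by (simp add: subset.chain_def)
    have "?fs (\<Union>\<C>)"
    proof (intro allI impI)
      fix \<Phi> assume \<Phi>: "\<Phi> \<subseteq> \<Union>\<C>" "finite \<Phi>"
      obtain p where p: "p \<in> \<C>" "\<Phi> \<subseteq> p"
        using finite_subset_Union_chain[OF \<Phi>(2,1) ch] by blast
      from p(1) sub have "?fs p" by blast
      then show "\<exists>a\<in>S. \<forall>\<phi>\<in>\<Phi>. sat1 M a \<phi>" using p(2) \<Phi>(2) by blast
    qed
    moreover have "p0 \<subseteq> \<Union>\<C>" using sub ch(1) by blast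
    moreover have "\<Union>\<C> \<subseteq> unary_formulas L C" using sub by blast
    ultimately show ?thesis by simp
  qed
  ultimately have "\<exists>p\<in>?X. \<forall>q\<in>?X. p \<subseteq> q \<longrightarrow> q = p" by (rule subset_Zorn_nonempty)
  then obtain p where p: "p \<in> ?X" and max: "\<forall>q\<in>?X. p \<subseteq> q \<longrightarrow> q = p" by (elim bexE) (rule that)
  have fs: "?fs p" and pu: "p \<subseteq> unary_formulas L C" "p0 \<subseteq> p" using p by simp_all
  have split: "\<exists>\<Phi>\<subseteq>p. finite \<Phi> \<and> (\<forall>a\<in>S. (\<forall>\<psi>\<in>\<Phi>. sat1 M a \<psi>) \<longrightarrow> \<not> sat1 M a \<phi>)"
    if \<phi>: "\<phi> \<in> unary_formulas L C" "\<phi> \<notin> p" for \<phi>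
  proof (rule ccontr)
    assume neg: "\<not> ?thesis"
    have "?fs (insert \<phi> p)"
    proof (intro allI impI)
      fix \<Phi> assume \<Phi>: "\<Phi> \<subseteq> insert \<phi> p" "finite \<Phi>"
      then have "\<Phi> - {\<phi>} \<subseteq> p" "finite (\<Phi> - {\<phi>})" by auto
      then obtain a where "a \<in> S" "\<forall>\<psi>\<in>\<Phi> - {\<phi>}. sat1 M a \<psi>" "sat1 M a \<phi>" using neg by blast
      then show "\<exists>a\<in>S. \<forall>\<psi>\<in>\<Phi>. sat1 M a \<psi>" by blast
    qed
    moreover have "p0 \<subseteq> insert \<phi> p" "insert \<phi> p \<subseteq> unary_formulas L C" using pu \<phi>(1) by blast+
    ultimately have "insert \<phi> p \<in> ?X" by (intro CollectI conjI)
    then have "insert \<phi> p = p" by (rule mp[OF bspec[OF max]]) (rule subset_insertI)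
    then show False using \<phi>(2) by blast
  qed
  have "\<phi> \<in> p \<or> Neg \<phi> \<in> p" if \<phi>: "\<phi> \<in> unary_formulas L C" for \<phi>
  proof (rule ccontr)
    assume n: "\<not> ?thesis"
    have "Neg \<phi> \<in> unary_formulas L C" using \<phi> by (simp add: unary_formulas_def)
    then obtain \<Psi> where \<Psi>: "\<Psi> \<subseteq> p" "finite \<Psi>"
      "\<forall>a\<in>S. (\<forall>\<psi>\<in>\<Psi>. sat1 M a \<psi>) \<longrightarrow> \<not> sat1 M a (Neg \<phi>)"
      using split[of "Neg \<phi>"] n by blast
    obtain \<Phi> where \<Phi>: "\<Phi> \<subseteq> p" "finite \<Phi>"
      "\<forall>a\<in>S. (\<forall>\<psi>\<in>\<Phi>. sat1 M a \<psi>) \<longrightarrow> \<not> sat1 M a \<phi>"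
      using split[OF \<phi>] n by blast
    have "\<Phi> \<union> \<Psi> \<subseteq> p" "finite (\<Phi> \<union> \<Psi>)" using \<Phi>(1,2) \<Psi>(1,2) by simp_all
    then obtain a where a: "a \<in> S" "\<forall>\<psi>\<in>\<Phi> \<union> \<Psi>. sat1 M a \<psi>" using fs by blast
    then have "\<not> sat1 M a \<phi>" "\<not> sat1 M a (Neg \<phi>)" using \<Phi>(3) \<Psi>(3) by blast+
    then show False by (simp add: sat1_def)
  qed
  moreover have "\<exists>a\<in>univ M. \<forall>\<phi>\<in>\<Phi>. sat1 M a \<phi>" if "\<Phi> \<subseteq> p" "finite \<Phi>" for \<Phi>
    using fs that assms(2) by blast
  ultimately have "p \<in> complete_1_types L M C"
    unfolding complete_1_types_def using pu(1) by simp
  then show ?thesis using pu(2) fs by blast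
qed

text \<open>
  Weak smallness over \<open>A \<union> B\<close>: a binary tree of traces defined over \<open>A \<union> B\<close> has uncountably many
  branches, and the formulas along different branches extend to different types.
\<close>

lemma (in structure_over) no_binary_tree_of_traces:
  assumes "weakly_small L M" "finite A" "A \<subseteq> univ M" "finite B" "B \<subseteq> acl L M A"
    and N: "N \<subseteq> traces" "{} \<notin> N"
    and inv: "\<And>\<sigma> E. E \<in> N \<Longrightarrow> \<sigma> \<in> Aut \<Longrightarrow> (\<forall>x\<in>B. \<sigma> x = x) \<Longrightarrow> \<sigma> ` E = E"
    and split: "\<And>E. E \<in> N \<Longrightarrow> \<exists>Y\<in>N. \<exists>Z\<in>N. Y \<subseteq> E \<and> Z \<subseteq> E \<and> Y \<inter> Z = {}"
  shows "N = {}"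
proof (rule ccontr)
  assume "N \<noteq> {}"
  then obtain X0 where X0: "X0 \<in> N" by blast
  have "\<forall>E\<in>N. \<exists>\<phi>. \<phi> \<in> unary_formulas L (A \<union> B) \<and> (\<forall>x\<in>acl L M A. x \<in> E \<longleftrightarrow> sat1 M x \<phi>)"
    using invariant_trace_formula[OF _ assms(4,5)] N(1) inv by blast
  then obtain fm where fm: "\<And>E. E \<in> N \<Longrightarrow> fm E \<in> unary_formulas L (A \<union> B)"
    "\<And>E x. E \<in> N \<Longrightarrow> x \<in> acl L M A \<Longrightarrow> x \<in> E \<longleftrightarrow> sat1 M x (fm E)"
    using bchoice[of N] by metis
  obtain l r where lr: "\<And>E. E \<in> N \<Longrightarrow> l E \<in> N \<and> r E \<in> N \<and> l E \<subseteq> E \<and> r E \<subseteq> E \<and> l E \<inter> r E = {}"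
    using split by metis
  define T where "T = (\<lambda>\<beta>. rec_nat X0 (\<lambda>n E. if \<beta> n then l E else r E))"
  have T0: "T \<beta> 0 = X0" and TS: "T \<beta> (Suc n) = (if \<beta> n then l (T \<beta> n) else r (T \<beta> n))"
    for \<beta> n by (simp_all add: T_def)
  have TN: "T \<beta> n \<in> N" for \<beta> n by (induction n) (auto simp: T0 TS X0 lr)
  have "T \<beta> (Suc n) \<subseteq> T \<beta> n" for \<beta> n using lr[OF TN] by (simp add: TS)
  then have Tmono: "T \<beta> m \<subseteq> T \<beta> n" if "n \<le> m" for \<beta> n m by (rule lift_Suc_antimono_le[OF _ that])
  have "\<exists>p\<in>complete_1_types L M (A \<union> B). (\<lambda>n. fm (T \<beta> n)) ` UNIV \<subseteq> p \<and>
      (\<forall>\<Phi>\<subseteq>p. finite \<Phi> \<longrightarrow> (\<exists>a\<in>acl L M A. \<forall>\<phi>\<in>\<Phi>. sat1 M a \<phi>))" for \<beta>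
  proof (rule finitely_satisfiable_extends)
    show "(\<lambda>n. fm (T \<beta> n)) ` UNIV \<subseteq> unary_formulas L (A \<union> B)" using fm(1)[OF TN] by blast
    fix \<Phi> assume "\<Phi> \<subseteq> (\<lambda>n. fm (T \<beta> n)) ` UNIV" "finite \<Phi>"
    then obtain I where I: "finite I" "\<Phi> = (\<lambda>n. fm (T \<beta> n)) ` I"
      using finite_subset_image by metis
    then obtain m where m: "\<forall>i\<in>I. i \<le> m" using finite_nat_set_iff_bounded_le by blast
    have "T \<beta> m \<noteq> {}" using N(2) TN[of \<beta> m] by auto
    then obtain a where a: "a \<in> T \<beta> m" by blast
    then have "a \<in> acl L M A" using TN N(1) traces_subset by blast
    moreover have "sat1 M a (fm (T \<beta> i))" if "i \<in> I" for i
    proof -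
      have "a \<in> T \<beta> i" using Tmono[of i m \<beta>] m that a by blast
      then show ?thesis using fm(2)[OF TN] \<open>a \<in> acl L M A\<close> by blast
    qed
    ultimately show "\<exists>a\<in>acl L M A. \<forall>\<phi>\<in>\<Phi>. sat1 M a \<phi>" using I(2) by blast
  qed (rule acl_subset_univ)
  then have "\<forall>\<beta>. \<exists>p. p \<in> complete_1_types L M (A \<union> B) \<and> (\<lambda>n. fm (T \<beta> n)) ` UNIV \<subseteq> p \<and>
      (\<forall>\<Phi>\<subseteq>p. finite \<Phi> \<longrightarrow> (\<exists>a\<in>acl L M A. \<forall>\<phi>\<in>\<Phi>. sat1 M a \<phi>))"
    by blast
  from choice[OF this] obtain p where P: "\<forall>\<beta>. p \<beta> \<in> complete_1_types L M (A \<union> B) \<and>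
      (\<lambda>n. fm (T \<beta> n)) ` UNIV \<subseteq> p \<beta> \<and>
      (\<forall>\<Phi>\<subseteq>p \<beta>. finite \<Phi> \<longrightarrow> (\<exists>a\<in>acl L M A. \<forall>\<phi>\<in>\<Phi>. sat1 M a \<phi>))"
    by (elim exE) (rule that)
  have p: "\<And>\<beta>. p \<beta> \<in> complete_1_types L M (A \<union> B)"
    "\<And>\<beta> n. fm (T \<beta> n) \<in> p \<beta>"
    "\<And>\<beta> \<Phi>. \<Phi> \<subseteq> p \<beta> \<Longrightarrow> finite \<Phi> \<Longrightarrow> \<exists>a\<in>acl L M A. \<forall>\<phi>\<in>\<Phi>. sat1 M a \<phi>"
    using P by blast+
  have "inj p"
  proof (rule injI, rule ccontr)
    fix \<beta> \<gamma> :: "nat \<Rightarrow> bool" assume eq: "p \<beta> = p \<gamma>" and "\<beta> \<noteq> \<gamma>"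
    then have ex: "\<exists>n. \<beta> n \<noteq> \<gamma> n" by blast
    define n where "n = (LEAST n. \<beta> n \<noteq> \<gamma> n)"
    have n: "\<beta> n \<noteq> \<gamma> n" unfolding n_def using ex by (rule LeastI_ex)
    have "\<beta> i = \<gamma> i" if "i < n" for i using not_less_Least that unfolding n_def by blast
    then have "T \<beta> i = T \<gamma> i" if "i \<le> n" for i
      using that by (induction i) (simp_all add: T0 TS)
    then have "T \<beta> (Suc n) \<inter> T \<gamma> (Suc n) = {}"
      using n lr[OF TN[of \<gamma> n]] by (auto simp: TS)
    moreover have "{fm (T \<beta> (Suc n)), fm (T \<gamma> (Suc n))} \<subseteq> p \<beta>"
      using p(2)[of \<beta>] p(2)[of \<gamma>] eq by simp
    from p(3)[OF this] obtain a where "a \<in> acl L M A" "sat1 M a (fm (T \<beta> (Suc n)))"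
      "sat1 M a (fm (T \<gamma> (Suc n)))" by auto
    then have "a \<in> T \<beta> (Suc n)" "a \<in> T \<gamma> (Suc n)" using fm(2)[OF TN] by blast+
    ultimately show False by blast
  qed
  have "finite (A \<union> B) \<and> A \<union> B \<subseteq> univ M"
    using assms(2-5) acl_subset_univ by simp
  then have "countable (complete_1_types L M (A \<union> B))"
    using assms(1) unfolding weakly_small_def by blast
  then have "countable (range p)" by (rule countable_subset[rotated]) (use p(1) in blast)
  then have "countable (UNIV :: (nat \<Rightarrow> bool) set)" using \<open>inj p\<close>
    by (rule countable_image_inj_on)
  then obtain f :: "(nat \<Rightarrow> bool) \<Rightarrow> nat" where f: "inj f" by (auto simp: countable_def)
  \<comment> \<open>The numbering \<open>f\<close> of the branches misses the diagonal branch.\<close>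
  define d where "d = (\<lambda>n. \<not> inv_into UNIV f n n)"
  have "inv_into UNIV f (f d) = d" using f by (rule inv_f_f)
  moreover have "d (f d) \<longleftrightarrow> \<not> inv_into UNIV f (f d) (f d)" by (rule fun_cong[OF d_def])
  ultimately have "d (f d) \<longleftrightarrow> \<not> d (f d)" by (simp only:)
  then show False by blast
qed

section \<open>Almost inclusion of subgroups\<close>

context abelian_group
begin

lemma additive_subgroup_iff:
  "additive_subgroup H G \<longleftrightarrow>
     H \<subseteq> carrier G \<and> \<zero> \<in> H \<and> (\<forall>x\<in>H. \<forall>y\<in>H. x \<oplus> y \<in> H) \<and> (\<forall>x\<in>H. \<ominus> x \<in> H)"
  unfolding additive_subgroup_def subgroup_def by (auto simp: a_inv_def)

lemma sg_carrier: "additive_subgroup H G \<Longrightarrow> x \<in> H \<Longrightarrow> x \<in> carrier G"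
  unfolding additive_subgroup_iff by blast

lemma sg_add: "additive_subgroup H G \<Longrightarrow> x \<in> H \<Longrightarrow> y \<in> H \<Longrightarrow> x \<oplus> y \<in> H"
  unfolding additive_subgroup_iff by blast

lemma sg_zero: "additive_subgroup H G \<Longrightarrow> \<zero> \<in> H"
  unfolding additive_subgroup_iff by blast

lemma sg_minus: "additive_subgroup H G \<Longrightarrow> x \<in> H \<Longrightarrow> y \<in> H \<Longrightarrow> x \<ominus> y \<in> H"
  unfolding additive_subgroup_iff a_minus_def by blast

lemma minus_add_minus:
  "x \<in> carrier G \<Longrightarrow> y \<in> carrier G \<Longrightarrow> z \<in> carrier G \<Longrightarrow> (x \<ominus> y) \<oplus> (y \<ominus> z) = x \<ominus> z"
  unfolding a_minus_def by (simp add: a_assoc r_neg1)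

lemma minus_minus_eq:
  "x \<in> carrier G \<Longrightarrow> y \<in> carrier G \<Longrightarrow> z \<in> carrier G \<Longrightarrow> (x \<ominus> y) \<ominus> z = x \<ominus> (y \<oplus> z)"
  unfolding a_minus_def by (simp add: minus_add a_assoc)

lemma add_minus_cancel: "x \<in> carrier G \<Longrightarrow> y \<in> carrier G \<Longrightarrow> (x \<oplus> y) \<ominus> x = y"
  unfolding a_minus_def by (simp add: a_comm[of x y] a_assoc r_neg)

lemma minus_add_cancel': "x \<in> carrier G \<Longrightarrow> y \<in> carrier G \<Longrightarrow> (x \<ominus> y) \<oplus> y = x"
  unfolding a_minus_def by (simp add: a_assoc l_neg)

lemma minus_minus_cancel:
  assumes "x \<in> carrier G" "y \<in> carrier G" "z \<in> carrier G"
  shows "(x \<ominus> z) \<ominus> (y \<ominus> z) = x \<ominus> y"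
proof -
  have "(x \<ominus> z) \<ominus> (y \<ominus> z) = x \<ominus> (z \<oplus> (y \<ominus> z))" using assms by (simp add: minus_minus_eq)
  also have "z \<oplus> (y \<ominus> z) = (y \<ominus> z) \<oplus> z" using assms by (simp add: a_comm)
  also have "\<dots> = y" using assms by (simp add: minus_add_cancel')
  finally show ?thesis .
qed

lemma minus_self: "x \<in> carrier G \<Longrightarrow> x \<ominus> x = \<zero>"
  unfolding a_minus_def by (simp add: r_neg)

definition translates :: "'a set \<Rightarrow> 'a set \<Rightarrow> 'a set" where
  "translates F K = {x \<in> carrier G. \<exists>f\<in>F. x \<ominus> f \<in> K}"

text \<open>For subgroups this says that \<open>H \<inter> K\<close> has finite index in \<open>H\<close>.\<close>

definition almost_sub :: "'a set \<Rightarrow> 'a set \<Rightarrow> bool" where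
  "almost_sub H K \<longleftrightarrow> (\<exists>F. finite F \<and> F \<subseteq> carrier G \<and> H \<subseteq> translates F K)"

lemma translates_mono: "F \<subseteq> F' \<Longrightarrow> K \<subseteq> K' \<Longrightarrow> translates F K \<subseteq> translates F' K'"
  unfolding translates_def by blast

lemma almost_subI: "finite F \<Longrightarrow> F \<subseteq> carrier G \<Longrightarrow> H \<subseteq> translates F K \<Longrightarrow> almost_sub H K"
  unfolding almost_sub_def by blast

lemma almost_subE:
  assumes "almost_sub H K"
  obtains F where "finite F" "F \<subseteq> carrier G" "H \<subseteq> translates F K"
  using assms unfolding almost_sub_def by blast

lemma almost_sub_mono:
  assumes "almost_sub H K" "H' \<subseteq> H" "K \<subseteq> K'"
  shows "almost_sub H' K'"
proof -
  obtain F where F: "finite F" "F \<subseteq> carrier G" "H \<subseteq> translates F K"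
    by (rule almost_subE[OF assms(1)])
  have "H' \<subseteq> translates F K'"
    using assms(2) F(3) translates_mono[OF subset_refl assms(3), of F] by simp
  then show ?thesis by (rule almost_subI[OF F(1,2)])
qed

lemma almost_sub_trans:
  assumes "almost_sub H K" "almost_sub K L"
  shows "almost_sub H L"
proof -
  obtain F where F: "finite F" "F \<subseteq> carrier G" "H \<subseteq> translates F K"
    using assms(1) unfolding almost_sub_def by blast
  obtain F' where F': "finite F'" "F' \<subseteq> carrier G" "K \<subseteq> translates F' L"
    using assms(2) unfolding almost_sub_def by blast
  let ?F = "(\<lambda>(f, g). f \<oplus> g) ` (F \<times> F')"
  have "H \<subseteq> translates ?F L"
  proof
    fix x assume "x \<in> H"
    then obtain f where f: "x \<in> carrier G" "f \<in> F" "x \<ominus> f \<in> K"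
      using F(3) unfolding translates_def by blast
    then obtain g where g: "g \<in> F'" "(x \<ominus> f) \<ominus> g \<in> L"
      using F'(3) unfolding translates_def by blast
    have "f \<in> carrier G" "g \<in> carrier G" using f g F(2) F'(2) by blast+
    then have "x \<ominus> (f \<oplus> g) \<in> L" using g f minus_minus_eq[of x f g] by simp
    moreover have "f \<oplus> g \<in> ?F" by (rule image_eqI[of _ _ "(f, g)"]) (use f(2) g(1) in simp_all)
    ultimately show "x \<in> translates ?F L" using f(1) unfolding translates_def by blast
  qed
  moreover have "finite ?F" "?F \<subseteq> carrier G" using F F' by auto
  ultimately show ?thesis by (intro almost_subI)
qed

lemma almost_sub_Int:
  assumes "almost_sub H K" "almost_sub H L" "additive_subgroup K G" "additive_subgroup L G"
  shows "almost_sub H (K \<inter> L)"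
proof -
  obtain F where F: "finite F" "F \<subseteq> carrier G" "H \<subseteq> translates F K"
    using assms(1) unfolding almost_sub_def by blast
  obtain F' where F': "finite F'" "F' \<subseteq> carrier G" "H \<subseteq> translates F' L"
    using assms(2) unfolding almost_sub_def by blast
  let ?P = "\<lambda>p c. c \<in> carrier G \<and> c \<ominus> fst p \<in> K \<and> c \<ominus> snd p \<in> L"
  define c where "c = (\<lambda>p. SOME c. ?P p c)"
  let ?C = "c ` {p \<in> F \<times> F'. \<exists>c. ?P p c}"
  have c: "?P p (c p)" if "\<exists>c. ?P p c" for p
    unfolding c_def using that by (rule someI_ex)
  have "H \<subseteq> translates ?C (K \<inter> L)"
  proof
    fix x assume "x \<in> H"
    then obtain f g where fg: "x \<in> carrier G" "f \<in> F" "x \<ominus> f \<in> K" "g \<in> F'" "x \<ominus> g \<in> L"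
      using F(3) F'(3) unfolding translates_def by blast
    then have ex: "\<exists>c. ?P (f, g) c" by auto
    let ?c = "c (f, g)"
    have "(x \<ominus> f) \<ominus> (?c \<ominus> f) \<in> K" "(x \<ominus> g) \<ominus> (?c \<ominus> g) \<in> L"
      using c[OF ex] fg sg_minus assms(3,4) by auto
    moreover have "f \<in> carrier G" "g \<in> carrier G" "?c \<in> carrier G"
      using fg(2,4) F(2) F'(2) c[OF ex] by blast+
    ultimately have "x \<ominus> ?c \<in> K \<inter> L"
      using minus_minus_cancel[of x ?c f] minus_minus_cancel[of x ?c g] fg(1) by simp
    moreover have "?c \<in> ?C" using ex fg(2,4) by blast
    ultimately show "x \<in> translates ?C (K \<inter> L)" using fg(1) unfolding translates_def by blast
  qed
  moreover have "finite ?C" using F(1) F'(1) by simp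
  moreover have "?C \<subseteq> carrier G" using c by blast
  ultimately show ?thesis by (intro almost_subI)
qed

lemma additive_subgroup_Inter:
  assumes "\<K> \<noteq> {}" "\<And>K. K \<in> \<K> \<Longrightarrow> additive_subgroup K G"
  shows "additive_subgroup (\<Inter>\<K>) G"
  using assms unfolding additive_subgroup_iff by blast

lemma almost_sub_Inter:
  assumes "finite \<K>" "\<K> \<noteq> {}"
    and "\<And>K. K \<in> \<K> \<Longrightarrow> almost_sub H K" "\<And>K. K \<in> \<K> \<Longrightarrow> additive_subgroup K G"
  shows "almost_sub H (\<Inter>\<K>)"
  using assms
proof (induction rule: finite_ne_induct)
  case (singleton K)
  then show ?case by simp
next
  case (insert K \<K>)
  have "almost_sub H (K \<inter> \<Inter>\<K>)"
    by (rule almost_sub_Int) (use insert additive_subgroup_Inter in auto)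
  then show ?case by simp
qed

text \<open>
  B. H. Neumann's lemma. If the cosets of \<open>K\<close> in the cover do not suffice, a coset of \<open>K\<close>
  outside of them is covered by cosets of the other subgroups, hence so is every coset of \<open>K\<close>,
  and \<open>K\<close> can be dropped.
\<close>

lemma neumann_cover:
  assumes "finite \<K>" "\<And>K. K \<in> \<K> \<Longrightarrow> additive_subgroup K G" "additive_subgroup H G"
    and "finite F" "F \<subseteq> carrier G" "H \<subseteq> (\<Union>K\<in>\<K>. translates F K)"
  shows "\<exists>K\<in>\<K>. almost_sub H K"
  using assms(1,2,4-6)
proof (induction \<K> arbitrary: F rule: finite_induct)
  case empty
  then show ?case using sg_zero[OF assms(3)] by blast
next
  case (insert K \<K>)
  have K: "additive_subgroup K G" using insert.prems(1) by blast
  note F = insert.prems(2,3)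
  show ?case
  proof (cases "almost_sub H K")
    case True
    then show ?thesis by blast
  next
    case False
    then obtain h where h: "h \<in> H" "h \<notin> translates F K"
      using F unfolding almost_sub_def by blast
    have hc: "h \<in> carrier G" using h(1) sg_carrier[OF assms(3)] by blast
    let ?P = "\<lambda>f c. c \<in> H \<and> c \<ominus> f \<in> K"
    define c where "c = (\<lambda>f. SOME c. ?P f c)"
    have c: "?P f (c f)" if "\<exists>c. ?P f c" for f
      unfolding c_def using that by (rule someI_ex)
    let ?C = "c ` {f \<in> F. \<exists>c. ?P f c}"
    have CH: "?C \<subseteq> H" using c by blast
    then have C: "finite ?C" "?C \<subseteq> carrier G" using F(1) sg_carrier[OF assms(3)] by auto
    let ?F = "F \<union> (\<lambda>(g, c). (g \<ominus> h) \<oplus> c) ` (F \<times> ?C)"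
    have "H \<subseteq> (\<Union>K\<in>\<K>. translates ?F K)"
    proof
      fix x assume x: "x \<in> H"
      then have xc: "x \<in> carrier G" by (rule sg_carrier[OF assms(3)])
      from x insert.prems(4) consider L where "L \<in> \<K>" "x \<in> translates F L" | "x \<in> translates F K"
        by blast
      then show "x \<in> (\<Union>K\<in>\<K>. translates ?F K)"
      proof cases
        case 1
        then show ?thesis using translates_mono[of F ?F L L] by blast
      next
        case 2
        then obtain f where f: "f \<in> F" "x \<ominus> f \<in> K" unfolding translates_def by blast
        then have ex: "\<exists>c. ?P f c" using x by blast
        let ?c = "c f"
        have c': "?c \<in> H" "?c \<ominus> f \<in> K" "?c \<in> ?C" "?c \<in> carrier G"
          using c[OF ex] ex f(1) C(2) by auto
        have "(x \<ominus> f) \<ominus> (?c \<ominus> f) \<in> K" by (rule sg_minus[OF K f(2) c'(2)])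
        moreover have "f \<in> carrier G" using f(1) F(2) by blast
        ultimately have xcK: "x \<ominus> ?c \<in> K" using minus_minus_cancel[of x ?c f] xc c'(4) by simp
        let ?y = "(x \<ominus> ?c) \<oplus> h"
        have y: "?y \<in> H" using sg_add[OF assms(3) sg_minus[OF assms(3) x c'(1)] h(1)] .
        have "?y \<notin> translates F K"
        proof
          assume "?y \<in> translates F K"
          then obtain g where g: "g \<in> F" "?y \<ominus> g \<in> K" unfolding translates_def by blast
          have "(?y \<ominus> g) \<ominus> (x \<ominus> ?c) \<in> K" by (rule sg_minus[OF K g(2) xcK])
          moreover have "(?y \<ominus> g) \<ominus> (x \<ominus> ?c) = h \<ominus> g"
          proof -
            have gc: "g \<in> carrier G" and xcc: "x \<ominus> ?c \<in> carrier G" using g(1) F(2) xc c'(4) by auto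
            have "?y \<ominus> g = (x \<ominus> ?c) \<oplus> (h \<ominus> g)"
              unfolding a_minus_def using xc c'(4) hc gc by (simp add: a_assoc)
            then show ?thesis using add_minus_cancel[OF xcc] hc gc by simp
          qed
          ultimately have "h \<ominus> g \<in> K" by simp
          then show False using h(2) g(1) hc unfolding translates_def by blast
        qed
        then obtain L where L: "L \<in> \<K>" "?y \<in> translates F L" using y insert.prems(4) by blast
        then obtain g where g: "g \<in> F" "?y \<ominus> g \<in> L" unfolding translates_def by blast
        have gc: "g \<in> carrier G" using g(1) F(2) by blast
        have "?y \<ominus> g = x \<ominus> ((g \<ominus> h) \<oplus> ?c)"
          unfolding a_minus_def using xc c'(4) hc gc by (simp add: minus_add a_ac)
        then have "x \<ominus> ((g \<ominus> h) \<oplus> ?c) \<in> L" using g(2) by simp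
        moreover have "(g \<ominus> h) \<oplus> ?c \<in> ?F"
          by (rule UnI2, rule image_eqI[of _ _ "(g, ?c)"]) (use g(1) c'(3) in simp_all)
        ultimately show ?thesis using L(1) xc unfolding translates_def by blast
      qed
    qed
    moreover have "finite ?F" using F(1) C(1) by simp
    moreover have "?F \<subseteq> carrier G"
    proof (rule Un_least[OF F(2)], rule image_subsetI)
      fix p assume "p \<in> F \<times> ?C"
      then have "fst p \<in> F" "snd p \<in> ?C" by (simp_all only: mem_Times_iff)
      then have "fst p \<in> carrier G" "snd p \<in> carrier G"
        using subsetD[OF F(2)] subsetD[OF C(2)] by simp_all
      then show "(case p of (g, c) \<Rightarrow> (g \<ominus> h) \<oplus> c) \<in> carrier G"
        using hc by (simp add: case_prod_unfold)
    qed
    ultimately have "\<exists>K\<in>\<K>. almost_sub H K" using insert.IH[of ?F] insert.prems(1) by simp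
    then show ?thesis by blast
  qed
qed

lemma neumann_avoid:
  assumes "finite \<K>" "\<And>K. K \<in> \<K> \<Longrightarrow> additive_subgroup K G \<and> \<not> almost_sub H K"
    and H: "additive_subgroup H G" and F: "finite F" "F \<subseteq> carrier G" and g: "g \<in> carrier G"
  obtains d where "d \<in> H" "\<forall>K\<in>\<K>. g \<oplus> d \<notin> translates F K"
proof -
  let ?F = "(\<lambda>f. f \<ominus> g) ` F"
  have "\<not> H \<subseteq> (\<Union>K\<in>\<K>. translates ?F K)"
    using neumann_cover[OF assms(1) _ H, of ?F] assms(2) F g by auto
  then obtain d where d: "d \<in> H" "\<forall>K\<in>\<K>. d \<notin> translates ?F K" by blast
  have dc: "d \<in> carrier G" by (rule sg_carrier[OF H d(1)])
  have "g \<oplus> d \<notin> translates F K" if "K \<in> \<K>" for K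
  proof
    assume "g \<oplus> d \<in> translates F K"
    then obtain f where f: "f \<in> F" "(g \<oplus> d) \<ominus> f \<in> K" unfolding translates_def by blast
    have "f \<in> carrier G" using f(1) F(2) by blast
    then have "(g \<oplus> d) \<ominus> f = d \<ominus> (f \<ominus> g)"
      unfolding a_minus_def using g dc by (simp add: minus_add a_ac)
    then have "d \<ominus> (f \<ominus> g) \<in> K" using f(2) by simp
    then have "d \<in> translates ?F K" using f(1) dc unfolding translates_def by blast
    then show False using d(2) that by blast
  qed
  then show thesis using that d(1) by blast
qed

text \<open>For subgroups, \<open>translates H K\<close> is the sum of \<open>H\<close> and \<open>K\<close>.\<close>

lemma additive_subgroup_sum:
  assumes H: "additive_subgroup H G" and K: "additive_subgroup K G"
  shows "additive_subgroup (translates H K) G"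
  unfolding additive_subgroup_iff
proof (intro conjI ballI)
  show "translates H K \<subseteq> carrier G" unfolding translates_def by blast
  show "\<zero> \<in> translates H K"
    using sg_zero[OF H] sg_zero[OF K] minus_self[of \<zero>] unfolding translates_def
    by (intro CollectI conjI bexI[of _ \<zero>]) simp_all
next
  fix x y assume "x \<in> translates H K" "y \<in> translates H K"
  then obtain h h' where h: "x \<in> carrier G" "h \<in> H" "x \<ominus> h \<in> K" "y \<in> carrier G" "h' \<in> H" "y \<ominus> h' \<in> K"
    unfolding translates_def by blast
  have hc: "h \<in> carrier G" "h' \<in> carrier G" using h sg_carrier[OF H] by blast+
  have "(x \<oplus> y) \<ominus> (h \<oplus> h') = (x \<ominus> h) \<oplus> (y \<ominus> h')"
    unfolding a_minus_def using h(1,4) hc by (simp add: minus_add a_ac)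
  then have "(x \<oplus> y) \<ominus> (h \<oplus> h') \<in> K" using sg_add[OF K h(3,6)] by simp
  then show "x \<oplus> y \<in> translates H K"
    using sg_add[OF H h(2,5)] h(1,4) unfolding translates_def by blast
next
  fix x assume "x \<in> translates H K"
  then obtain h where h: "x \<in> carrier G" "h \<in> H" "x \<ominus> h \<in> K" unfolding translates_def by blast
  have hc: "h \<in> carrier G" using h sg_carrier[OF H] by blast
  have "\<ominus> x \<ominus> \<ominus> h = \<ominus> (x \<ominus> h)"
    unfolding a_minus_def using h(1) hc by (simp add: minus_add)
  moreover have "\<ominus> (x \<ominus> h) \<in> K" "\<ominus> h \<in> H"
    using H K h unfolding additive_subgroup_iff by blast+
  ultimately show "\<ominus> x \<in> translates H K" using h(1) unfolding translates_def
    by (intro CollectI conjI bexI[of _ "\<ominus> h"]) simp_all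
qed

lemma almost_sub_sum:
  assumes "almost_sub H K" "H \<subseteq> carrier G" "additive_subgroup K G"
  shows "almost_sub (translates H K) K"
proof -
  obtain F where F: "finite F" "F \<subseteq> carrier G" "H \<subseteq> translates F K"
    using assms(1) unfolding almost_sub_def by blast
  have "translates H K \<subseteq> translates F K"
  proof
    fix x assume "x \<in> translates H K"
    then obtain h where h: "x \<in> carrier G" "h \<in> H" "x \<ominus> h \<in> K" unfolding translates_def by blast
    then obtain f where f: "f \<in> F" "h \<ominus> f \<in> K" using F(3) unfolding translates_def by blast
    have "(x \<ominus> h) \<oplus> (h \<ominus> f) \<in> K" by (rule sg_add[OF assms(3) h(3) f(2)])
    moreover have "h \<in> carrier G" "f \<in> carrier G" using h(2) f(1) F(2) assms(2) by blast+
    ultimately have "x \<ominus> f \<in> K" using minus_add_minus[of x h f] h(1) by simp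
    then show "x \<in> translates F K" using h(1) f(1) unfolding translates_def by blast
  qed
  then show ?thesis by (rule almost_subI[OF F(1,2)])
qed

end

section \<open>The chain condition\<close>

text \<open>
  An abelian group with a group of automorphisms and a Boolean algebra of subsets, to be thought
  of as the traces of the sets definable with parameters from the group. The last assumption
  expresses weak smallness: for a finite set \<open>B\<close>, the members that are invariant under the
  automorphisms fixing \<open>B\<close> pointwise contain no full binary tree. It says nothing about trees
  of arbitrary members, whose parameters may grow without bound.
\<close>

locale scattered_group = abelian_group G for G (structure) +
  fixes Aut :: "('a \<Rightarrow> 'a) set" and \<D> :: "'a set set"
  assumes aut_bij: "\<sigma> \<in> Aut \<Longrightarrow> bij_betw \<sigma> (carrier G) (carrier G)"
    and aut_add: "\<sigma> \<in> Aut \<Longrightarrow> x \<in> carrier G \<Longrightarrow> y \<in> carrier G \<Longrightarrow> \<sigma> (x \<oplus> y) = \<sigma> x \<oplus> \<sigma> y"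
    and aut_id: "(\<lambda>x. x) \<in> Aut"
    and aut_comp: "\<sigma> \<in> Aut \<Longrightarrow> \<tau> \<in> Aut \<Longrightarrow> (\<lambda>x. \<sigma> (\<tau> x)) \<in> Aut"
    and aut_inverse: "\<sigma> \<in> Aut \<Longrightarrow> \<exists>\<tau>\<in>Aut. \<forall>x\<in>carrier G. \<tau> (\<sigma> x) = x"
    and dset_subset: "D \<in> \<D> \<Longrightarrow> D \<subseteq> carrier G"
    and dset_carrier: "carrier G \<in> \<D>"
    and dset_Int: "D \<in> \<D> \<Longrightarrow> E \<in> \<D> \<Longrightarrow> D \<inter> E \<in> \<D>"
    and dset_compl: "D \<in> \<D> \<Longrightarrow> carrier G - D \<in> \<D>"
    and dset_translate: "D \<in> \<D> \<Longrightarrow> g \<in> carrier G \<Longrightarrow> {x \<in> carrier G. x \<ominus> g \<in> D} \<in> \<D>"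
    and dset_image: "D \<in> \<D> \<Longrightarrow> \<sigma> \<in> Aut \<Longrightarrow> \<sigma> ` D \<in> \<D>"
    and finite_dset_orbit: "D \<in> \<D> \<Longrightarrow> finite {\<sigma> ` D | \<sigma>. \<sigma> \<in> Aut}"
    and finite_orbit: "x \<in> carrier G \<Longrightarrow> finite {\<sigma> x | \<sigma>. \<sigma> \<in> Aut}"
    and dset_support: "D \<in> \<D> \<Longrightarrow>
      \<exists>B. finite B \<and> B \<subseteq> carrier G \<and> (\<forall>\<sigma>\<in>Aut. (\<forall>x\<in>B. \<sigma> x = x) \<longrightarrow> \<sigma> ` D = D)"
    and no_binary_tree: "\<lbrakk>finite B; B \<subseteq> carrier G; N \<subseteq> \<D>; {} \<notin> N;
      \<forall>E\<in>N. \<forall>\<sigma>\<in>Aut. (\<forall>x\<in>B. \<sigma> x = x) \<longrightarrow> \<sigma> ` E = E;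
      \<forall>E\<in>N. \<exists>Y\<in>N. \<exists>Z\<in>N. Y \<subseteq> E \<and> Z \<subseteq> E \<and> Y \<inter> Z = {}\<rbrakk> \<Longrightarrow> N = {}"
begin

lemma aut_closed: "\<sigma> \<in> Aut \<Longrightarrow> x \<in> carrier G \<Longrightarrow> \<sigma> x \<in> carrier G"
  using aut_bij by (auto simp: bij_betw_def)

lemma aut_inj: "\<sigma> \<in> Aut \<Longrightarrow> inj_on \<sigma> (carrier G)"
  using aut_bij by (simp add: bij_betw_def)

lemma aut_minus:
  assumes "\<sigma> \<in> Aut" "x \<in> carrier G" "y \<in> carrier G"
  shows "\<sigma> (x \<ominus> y) = \<sigma> x \<ominus> \<sigma> y"
proof -
  have c: "\<sigma> x \<in> carrier G" "\<sigma> y \<in> carrier G" "\<sigma> (x \<ominus> y) \<in> carrier G"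
    using assms aut_closed by auto
  have "\<sigma> x = \<sigma> (x \<ominus> y) \<oplus> \<sigma> y"
    using aut_add[OF assms(1), of "x \<ominus> y" y] assms minus_add_cancel'[of x y] by simp
  then have "\<sigma> x \<ominus> \<sigma> y = (\<sigma> y \<oplus> \<sigma> (x \<ominus> y)) \<ominus> \<sigma> y" using c a_comm by simp
  then show ?thesis using add_minus_cancel[OF c(2,3)] by simp
qed

lemma aut_translates:
  assumes "\<sigma> \<in> Aut" "F \<subseteq> carrier G" "K \<subseteq> carrier G"
  shows "\<sigma> ` translates F K = translates (\<sigma> ` F) (\<sigma> ` K)"
proof (intro equalityI subsetI)
  fix y assume "y \<in> \<sigma> ` translates F K"
  then obtain x f where x: "x \<in> carrier G" "f \<in> F" "x \<ominus> f \<in> K" "y = \<sigma> x"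
    unfolding translates_def by blast
  then have "f \<in> carrier G" using assms(2) by blast
  then have "y \<ominus> \<sigma> f = \<sigma> (x \<ominus> f)" using aut_minus[OF assms(1) x(1)] x(4) by simp
  then show "y \<in> translates (\<sigma> ` F) (\<sigma> ` K)"
    using x aut_closed[OF assms(1)] unfolding translates_def
    by (intro CollectI conjI bexI[of _ "\<sigma> f"]) simp_all
next
  fix y assume "y \<in> translates (\<sigma> ` F) (\<sigma> ` K)"
  then obtain f k where y: "y \<in> carrier G" "f \<in> F" "k \<in> K" "y \<ominus> \<sigma> f = \<sigma> k"
    unfolding translates_def by blast
  then obtain x where x: "x \<in> carrier G" "y = \<sigma> x"
    using aut_bij[OF assms(1)] by (auto simp: bij_betw_def)
  have fk: "f \<in> carrier G" "k \<in> carrier G" using y(2,3) assms(2,3) by blast+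
  then have "\<sigma> (x \<ominus> f) = \<sigma> k" using y(4) x aut_minus[OF assms(1) x(1), of f] by simp
  then have "x \<ominus> f = k"
    by (rule inj_onD[OF aut_inj[OF assms(1)]]) (use x(1) fk in simp_all)
  then show "y \<in> \<sigma> ` translates F K" using x y unfolding translates_def by blast
qed

lemma aut_subgroup:
  assumes "\<sigma> \<in> Aut" "additive_subgroup H G"
  shows "additive_subgroup (\<sigma> ` H) G"
proof -
  have H: "H \<subseteq> carrier G" using sg_carrier[OF assms(2)] by blast
  have z: "\<sigma> \<zero> = \<zero>" using aut_minus[OF assms(1), of \<zero> \<zero>] minus_self aut_closed[OF assms(1)] by simp
  have neg: "\<sigma> (\<ominus> x) = \<ominus> \<sigma> x" if "x \<in> carrier G" for x
    using aut_minus[OF assms(1), of \<zero> x] that z aut_closed[OF assms(1)] by (simp add: a_minus_def)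
  show ?thesis
    unfolding additive_subgroup_iff
  proof (intro conjI ballI)
    show "\<sigma> ` H \<subseteq> carrier G" using H aut_closed[OF assms(1)] by blast
    show "\<zero> \<in> \<sigma> ` H" using sg_zero[OF assms(2)] z by force
  next
    fix x y assume "x \<in> \<sigma> ` H" "y \<in> \<sigma> ` H"
    then obtain a b where "a \<in> H" "b \<in> H" "x = \<sigma> a" "y = \<sigma> b" by blast
    then show "x \<oplus> y \<in> \<sigma> ` H"
      using aut_add[OF assms(1), of a b] sg_add[OF assms(2)] H by (metis imageI subsetD)
  next
    fix x assume "x \<in> \<sigma> ` H"
    then obtain a where "a \<in> H" "x = \<sigma> a" by blast
    then show "\<ominus> x \<in> \<sigma> ` H"
      using neg[of a] assms(2) H unfolding additive_subgroup_iff by (metis imageI subsetD)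
  qed
qed

lemma aut_almost_sub:
  assumes "\<sigma> \<in> Aut" "almost_sub H K" "K \<subseteq> carrier G"
  shows "almost_sub (\<sigma> ` H) (\<sigma> ` K)"
proof -
  obtain F where F: "finite F" "F \<subseteq> carrier G" "H \<subseteq> translates F K"
    using assms(2) unfolding almost_sub_def by blast
  have "\<sigma> ` H \<subseteq> translates (\<sigma> ` F) (\<sigma> ` K)"
    using F(3) aut_translates[OF assms(1) F(2) assms(3)] by blast
  moreover have "\<sigma> ` F \<subseteq> carrier G" using F(2) aut_closed[OF assms(1)] by blast
  ultimately show ?thesis using F(1) by (intro almost_subI) auto
qed

lemma aut_funpow: "\<sigma> \<in> Aut \<Longrightarrow> (\<sigma> ^^ n) \<in> Aut"
proof (induction n)
  case 0
  then show ?case using aut_id by (simp add: id_def)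
next
  case (Suc n)
  then show ?case using aut_comp[of \<sigma> "\<sigma> ^^ n"] by (simp add: comp_def)
qed

lemma image_eq_iff:
  assumes "\<sigma> \<in> Aut" "D \<subseteq> carrier G" "E \<subseteq> carrier G"
  shows "\<sigma> ` D = \<sigma> ` E \<longleftrightarrow> D = E"
  using inj_on_image_eq_iff[OF aut_inj[OF assms(1)]] assms(2,3) by blast

text \<open>
  Iterating the conjugation leads back to \<open>H\<close>, because its orbit is finite. On the way \<open>H\<close> stays
  almost contained in the conjugates of \<open>K\<close>, and the last of them is \<open>K\<close> conjugated by an
  automorphism that fixes \<open>H\<close> as a set.
\<close>

lemma almost_sub_conjugate:
  assumes \<sigma>: "\<sigma> \<in> Aut" and H: "H \<in> \<D>" and K: "K \<subseteq> H" and le: "almost_sub H (\<sigma> ` K)"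
  shows "almost_sub H K"
proof -
  have Hc: "H \<subseteq> carrier G" "K \<subseteq> carrier G" using dset_subset[OF H] K by auto
  have "(\<lambda>n. (\<sigma> ^^ n) ` H) ` UNIV \<subseteq> {\<sigma> ` H | \<sigma>. \<sigma> \<in> Aut}"
    using aut_funpow[OF \<sigma>] by blast
  then have "finite ((\<lambda>n. (\<sigma> ^^ n) ` H) ` UNIV)"
    using finite_dset_orbit[OF H] finite_subset by blast
  then have "\<not> inj (\<lambda>n. (\<sigma> ^^ n) ` H)" using finite_imageD infinite_UNIV_nat by blast
  then obtain i j where "i \<noteq> j" "(\<sigma> ^^ i) ` H = (\<sigma> ^^ j) ` H" by (auto simp: inj_on_def)
  then obtain i j where ij: "i < j" "(\<sigma> ^^ i) ` H = (\<sigma> ^^ j) ` H"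
    by (metis linorder_neqE_nat)
  obtain p where p: "j = i + Suc p" using ij(1) less_imp_Suc_add by auto
  have "(\<sigma> ^^ i) ` ((\<sigma> ^^ Suc p) ` H) = (\<sigma> ^^ i) ` H"
    using ij(2) unfolding p funpow_add image_comp by simp
  moreover have "(\<sigma> ^^ Suc p) ` H \<subseteq> carrier G" using aut_closed[OF aut_funpow[OF \<sigma>]] Hc(1) by blast
  ultimately have per: "(\<sigma> ^^ Suc p) ` H = H"
    using image_eq_iff[OF aut_funpow[OF \<sigma>] _ Hc(1)] by simp
  have "almost_sub H ((\<sigma> ^^ Suc n) ` K)" for n
  proof (induction n)
    case 0
    then show ?case using le by simp
  next
    case (Suc n)
    have "\<sigma> ` K \<subseteq> carrier G" using Hc(2) aut_closed[OF \<sigma>] by blast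
    then have "almost_sub ((\<sigma> ^^ Suc n) ` H) ((\<sigma> ^^ Suc n) ` \<sigma> ` K)"
      by (rule aut_almost_sub[OF aut_funpow[OF \<sigma>] le])
    moreover have "(\<sigma> ^^ Suc n) ` \<sigma> ` K = (\<sigma> ^^ Suc (Suc n)) ` K"
      by (simp only: funpow_Suc_right image_comp)
    ultimately have "almost_sub ((\<sigma> ^^ Suc n) ` H) ((\<sigma> ^^ Suc (Suc n)) ` K)" by (simp only:)
    moreover have "almost_sub H ((\<sigma> ^^ Suc n) ` H)"
      by (rule almost_sub_mono[OF Suc.IH subset_refl image_mono[OF K]])
    ultimately show ?case by (rule almost_sub_trans[rotated])
  qed
  then have le': "almost_sub ((\<sigma> ^^ Suc p) ` H) ((\<sigma> ^^ Suc p) ` K)" using per by simp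
  obtain \<tau> where \<tau>: "\<tau> \<in> Aut" "\<forall>x\<in>carrier G. \<tau> ((\<sigma> ^^ Suc p) x) = x"
    using aut_inverse[OF aut_funpow[OF \<sigma>]] by blast
  have "(\<sigma> ^^ Suc p) ` K \<subseteq> carrier G" using aut_closed[OF aut_funpow[OF \<sigma>]] Hc(2) by blast
  from aut_almost_sub[OF \<tau>(1) le' this]
  have "almost_sub (\<tau> ` (\<sigma> ^^ Suc p) ` H) (\<tau> ` (\<sigma> ^^ Suc p) ` K)" .
  moreover have "\<tau> ` (\<sigma> ^^ Suc p) ` D = D" if "D \<subseteq> carrier G" for D
    using \<tau>(2) that unfolding image_image by force
  ultimately show ?thesis using Hc by simp
qed

lemma dset_Un: "D \<in> \<D> \<Longrightarrow> E \<in> \<D> \<Longrightarrow> D \<union> E \<in> \<D>"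
proof -
  assume a: "D \<in> \<D>" "E \<in> \<D>"
  have "D \<union> E = carrier G - ((carrier G - D) \<inter> (carrier G - E))"
    using dset_subset a by blast
  then show ?thesis using dset_compl dset_Int a by simp
qed

lemma dset_Union: "finite \<E> \<Longrightarrow> \<E> \<subseteq> \<D> \<Longrightarrow> \<Union>\<E> \<in> \<D>"
proof (induction rule: finite_induct)
  case empty
  then show ?case using dset_compl[OF dset_carrier] by simp
next
  case (insert E \<E>)
  then show ?case using dset_Un by simp
qed

lemma dset_Inter: "finite \<E> \<Longrightarrow> \<E> \<noteq> {} \<Longrightarrow> \<E> \<subseteq> \<D> \<Longrightarrow> \<Inter>\<E> \<in> \<D>"
proof (induction rule: finite_ne_induct)
  case (insert E \<E>)
  then show ?case using dset_Int by simp
qed simp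

lemma dset_translates:
  assumes "finite F" "F \<subseteq> carrier G" "D \<in> \<D>"
  shows "translates F D \<in> \<D>"
proof -
  have "translates F D = \<Union>((\<lambda>f. {x \<in> carrier G. x \<ominus> f \<in> D}) ` F)"
    unfolding translates_def by blast
  moreover have "(\<lambda>f. {x \<in> carrier G. x \<ominus> f \<in> D}) ` F \<subseteq> \<D>"
    using dset_translate[OF assms(3)] assms(2) by blast
  ultimately show ?thesis
    using dset_Union[of "(\<lambda>f. {x \<in> carrier G. x \<ominus> f \<in> D}) ` F"] assms(1) by simp
qed

lemma finite_set_eventually_decided:
  assumes "finite S" "\<And>i. H (Suc i) \<subseteq> (H i :: 'a set)"
  shows "\<exists>m\<ge>n. \<forall>d\<in>S. d \<in> H m \<longrightarrow> (\<forall>k. d \<in> H k)"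
  using assms(1)
proof (induction rule: finite_induct)
  case (insert d S)
  then obtain m where m: "m \<ge> n" "\<forall>d\<in>S. d \<in> H m \<longrightarrow> (\<forall>k. d \<in> H k)" by blast
  have anti: "H j \<subseteq> H i" if "i \<le> j" for i j
    using assms(2) that by (rule lift_Suc_antimono_le)
  show ?case
  proof (cases "\<forall>k. d \<in> H k")
    case True
    then show ?thesis using m by blast
  next
    case False
    then obtain k where "d \<notin> H k" by blast
    then have "d \<notin> H (max m k)" using anti[of k "max m k"] by auto
    moreover have "H (max m k) \<subseteq> H m" by (rule anti) simp
    ultimately show ?thesis using m by (intro exI[of _ "max m k"]) auto
  qed
qed auto

text \<open>
  For a strictly descending chain of subgroups invariant under the automorphisms fixing \<open>B\<close>,
  the finite unions of cosets of members of the chain with an invariant set of representatives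
  \<open>F\<close> form a binary tree: deep enough in the chain, the members do not separate the
  representatives any more, and then the union of the cosets splits off its translate by the
  orbit of an element that leaves the chain.
\<close>

lemma invariant_chain_stationary:
  assumes B: "finite B" "B \<subseteq> carrier G"
    and H: "\<And>n. H n \<in> \<D>" "\<And>n. additive_subgroup (H n) G" "\<And>n. H (Suc n) \<subseteq> H n"
    and inv: "\<And>n \<sigma>. \<sigma> \<in> Aut \<Longrightarrow> (\<forall>x\<in>B. \<sigma> x = x) \<Longrightarrow> \<sigma> ` H n = H n"
  shows "\<exists>m. \<forall>n\<ge>m. H n = H m"
proof (rule ccontr)
  assume neg: "\<not> ?thesis"
  have anti: "H j \<subseteq> H i" if "i \<le> j" for i j using H(3) that by (rule lift_Suc_antimono_le)
  have Hc: "H n \<subseteq> carrier G" for n using dset_subset[OF H(1)] .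
  let ?S = "{\<sigma> \<in> Aut. \<forall>x\<in>B. \<sigma> x = x}"
  let ?ok = "\<lambda>F. finite F \<and> F \<noteq> {} \<and> F \<subseteq> carrier G \<and> (\<forall>\<sigma>\<in>?S. \<sigma> ` F = F)"
  let ?N = "{translates F (H n) | F n. ?ok F}"
  have "?N = {}"
  proof (rule no_binary_tree[OF B])
    show "?N \<subseteq> \<D>" using dset_translates H(1) by auto
    show "{} \<notin> ?N"
    proof
      assume "{} \<in> ?N"
      then obtain F n where F: "{} = translates F (H n)" "?ok F" by blast
      then obtain f where "f \<in> F" "f \<in> carrier G" by blast
      then have "f \<in> translates F (H n)"
        using minus_self sg_zero[OF H(2)] unfolding translates_def
        by (intro CollectI conjI bexI[of _ f]) simp_all
      then show False using F(1) by blast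
    qed
    show "\<forall>E\<in>?N. \<forall>\<sigma>\<in>Aut. (\<forall>x\<in>B. \<sigma> x = x) \<longrightarrow> \<sigma> ` E = E"
    proof (intro ballI impI)
      fix E \<sigma> assume "E \<in> ?N" and \<sigma>: "\<sigma> \<in> Aut" "\<forall>x\<in>B. \<sigma> x = x"
      then obtain F n where F: "E = translates F (H n)" "?ok F" by blast
      then show "\<sigma> ` E = E"
        using aut_translates[OF \<sigma>(1) _ Hc] inv[OF \<sigma>] \<sigma> by simp
    qed
    show "\<forall>E\<in>?N. \<exists>Y\<in>?N. \<exists>Z\<in>?N. Y \<subseteq> E \<and> Z \<subseteq> E \<and> Y \<inter> Z = {}"
    proof
      fix E assume "E \<in> ?N"
      then obtain F n where F: "E = translates F (H n)" "?ok F" by blast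
      let ?D = "(\<lambda>(f, g). f \<ominus> g) ` (F \<times> F)"
      have "finite ?D" using F(2) by simp
      then obtain m where m: "m \<ge> n" "\<forall>d\<in>?D. d \<in> H m \<longrightarrow> (\<forall>k. d \<in> H k)"
        using finite_set_eventually_decided[of ?D H n] H(3) by blast
      obtain k where k: "k \<ge> m" "H k \<noteq> H m" using neg by blast
      then obtain g where g: "g \<in> H m" "g \<notin> H k" using anti[of m k] by blast
      define Ob where "Ob = {\<sigma> g | \<sigma>. \<sigma> \<in> ?S}"
      have gc: "g \<in> carrier G" using g(1) Hc by blast
      have Ofin: "finite Ob" unfolding Ob_def by (rule finite_subset[OF _ finite_orbit[OF gc]]) blast
      have OH: "x \<in> H m \<and> x \<notin> H k" if x: "x \<in> Ob" for x
      proof -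
        obtain \<sigma> where \<sigma>: "x = \<sigma> g" "\<sigma> \<in> Aut" "\<forall>x\<in>B. \<sigma> x = x"
          using x unfolding Ob_def by blast
        have "\<sigma> g \<in> \<sigma> ` H m" using g(1) by blast
        moreover have "\<sigma> g \<notin> \<sigma> ` H k"
          using inj_on_image_mem_iff[OF aut_inj[OF \<sigma>(2)] gc Hc] g(2) by simp
        ultimately show ?thesis using inv[OF \<sigma>(2,3)] \<sigma>(1) by simp
      qed
      have Onz: "Ob \<noteq> {}" unfolding Ob_def using aut_id by blast
      have Oinv: "\<sigma> ` Ob = Ob" if \<sigma>: "\<sigma> \<in> ?S" for \<sigma>
      proof (rule card_subset_eq[OF Ofin])
        show "\<sigma> ` Ob \<subseteq> Ob"
        proof
          fix y assume "y \<in> \<sigma> ` Ob"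
          then obtain \<tau> where \<tau>: "\<tau> \<in> ?S" "y = \<sigma> (\<tau> g)" unfolding Ob_def by blast
          then have "(\<lambda>x. \<sigma> (\<tau> x)) \<in> ?S" using aut_comp \<sigma> by simp
          then show "y \<in> Ob" unfolding Ob_def using \<tau>(2)
            by (intro CollectI exI[of _ "\<lambda>x. \<sigma> (\<tau> x)"]) simp
        qed
        have "Ob \<subseteq> carrier G" using OH Hc by blast
        then have "inj_on \<sigma> Ob" using aut_inj \<sigma> inj_on_subset by blast
        then show "card (\<sigma> ` Ob) = card Ob" by (rule card_image)
      qed
      let ?F' = "(\<lambda>(f, x). f \<oplus> x) ` (F \<times> Ob)"
      have Oc: "Ob \<subseteq> carrier G" using OH Hc by blast
      have ok': "?ok ?F'"
      proof (intro conjI ballI)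
        show "finite ?F'" using F(2) Ofin by simp
        show "?F' \<noteq> {}" using F(2) Onz by simp
        show "?F' \<subseteq> carrier G"
        proof (rule image_subsetI)
          fix p assume "p \<in> F \<times> Ob"
          then have "fst p \<in> carrier G" "snd p \<in> carrier G" using F(2) Oc by auto
          then show "(case p of (f, x) \<Rightarrow> f \<oplus> x) \<in> carrier G" by (simp add: case_prod_unfold)
        qed
        fix \<sigma> assume \<sigma>: "\<sigma> \<in> ?S"
        have "\<sigma> ` ?F' = (\<lambda>(f, x). \<sigma> f \<oplus> \<sigma> x) ` (F \<times> Ob)"
          unfolding image_image
        proof (rule image_cong[OF refl])
          fix p assume "p \<in> F \<times> Ob"
          then have "fst p \<in> carrier G" "snd p \<in> carrier G" using F(2) Oc by auto
          then show "\<sigma> (case p of (f, x) \<Rightarrow> f \<oplus> x) = (case p of (f, x) \<Rightarrow> \<sigma> f \<oplus> \<sigma> x)"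
            using \<sigma> aut_add by (simp add: case_prod_unfold)
        qed
        also have "\<dots> = (\<lambda>(f, x). f \<oplus> x) ` ((\<sigma> ` F) \<times> (\<sigma> ` Ob))"
        proof -
          have "(\<sigma> ` F) \<times> (\<sigma> ` Ob) = map_prod \<sigma> \<sigma> ` (F \<times> Ob)"
            by (rule map_prod_surj_on[OF refl refl, symmetric])
          then show ?thesis by (simp only: image_image case_prod_unfold fst_map_prod snd_map_prod)
        qed
        also have "\<dots> = ?F'" using Oinv[OF \<sigma>] F(2) \<sigma> by simp
        finally show "\<sigma> ` ?F' = ?F'" .
      qed
      have NY: "translates F (H k) \<in> ?N" using F(2) by blast
      have NZ: "translates ?F' (H k) \<in> ?N" using ok' by blast
      have YE: "translates F (H k) \<subseteq> E"
        unfolding F(1) by (rule translates_mono) (use anti m(1) k(1) in auto)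
      have ZE: "translates ?F' (H k) \<subseteq> E"
      proof
        fix x assume "x \<in> translates ?F' (H k)"
        then obtain f y where fy: "x \<in> carrier G" "f \<in> F" "y \<in> Ob" "x \<ominus> (f \<oplus> y) \<in> H k"
          unfolding translates_def by auto
        have c: "f \<in> carrier G" "y \<in> carrier G" using fy F(2) Oc by blast+
        have "(x \<ominus> f) \<ominus> y \<in> H n"
          using fy(4) minus_minus_eq[OF fy(1) c] anti[of n k] m(1) k(1) by auto
        moreover have "y \<in> H n" using OH[OF fy(3)] anti[OF m(1)] by blast
        ultimately have "((x \<ominus> f) \<ominus> y) \<oplus> y \<in> H n" by (rule sg_add[OF H(2)])
        then have "x \<ominus> f \<in> H n" using minus_add_cancel'[of "x \<ominus> f" y] fy(1) c by simp
        then show "x \<in> E" unfolding F(1) translates_def using fy(1,2) by blast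
      qed
      have dj: "translates F (H k) \<inter> translates ?F' (H k) = {}"
      proof (rule ccontr)
        assume "\<not> ?thesis"
        then obtain x where "x \<in> translates F (H k)" "x \<in> translates ?F' (H k)" by blast
        then obtain h f y where x: "x \<in> carrier G" "h \<in> F" "x \<ominus> h \<in> H k"
          "f \<in> F" "y \<in> Ob" "x \<ominus> (f \<oplus> y) \<in> H k"
          unfolding translates_def by auto
        have c: "f \<in> carrier G" "y \<in> carrier G" "h \<in> carrier G" using x F(2) Oc by blast+
        have "(x \<ominus> h) \<ominus> (x \<ominus> (f \<oplus> y)) \<in> H k" by (rule sg_minus[OF H(2) x(3,6)])
        moreover have "(x \<ominus> h) \<ominus> (x \<ominus> (f \<oplus> y)) = (f \<ominus> h) \<oplus> y"
        proof -
          have "(x \<ominus> h) \<ominus> (x \<ominus> (f \<oplus> y)) = (x \<oplus> \<ominus> x) \<oplus> ((f \<ominus> h) \<oplus> y)"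
            unfolding a_minus_def using x(1) c by (simp add: minus_add a_ac)
          then show ?thesis using x(1) c by (simp add: r_neg)
        qed
        ultimately have 1: "(f \<ominus> h) \<oplus> y \<in> H k" by simp
        have fh: "f \<ominus> h \<in> carrier G" using c by simp
        have "((f \<ominus> h) \<oplus> y) \<ominus> y \<in> H m"
          using sg_minus[OF H(2)] 1 anti[OF k(1)] OH[OF x(5)] by blast
        then have "f \<ominus> h \<in> H m"
          using add_minus_cancel[OF c(2) fh] a_comm[OF c(2) fh] by simp
        then have "f \<ominus> h \<in> H k" using m(2) x(2,4) by blast
        then have "((f \<ominus> h) \<oplus> y) \<ominus> (f \<ominus> h) \<in> H k" by (rule sg_minus[OF H(2) 1])
        then have "y \<in> H k" using add_minus_cancel[OF fh c(2)] by simp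
        then show False using OH[OF x(5)] by blast
      qed
      show "\<exists>Y\<in>?N. \<exists>Z\<in>?N. Y \<subseteq> E \<and> Z \<subseteq> E \<and> Y \<inter> Z = {}"
        by (rule bexI[OF _ NY], rule bexI[OF _ NZ]) (intro conjI YE ZE dj)
    qed
  qed
  moreover have "translates {\<zero>} (H 0) \<in> ?N"
  proof -
    have "\<sigma> \<zero> = \<zero>" if "\<sigma> \<in> ?S" for \<sigma>
      using aut_minus[of \<sigma> \<zero> \<zero>] that minus_self aut_closed by simp
    then have "?ok {\<zero>}" by simp
    then show ?thesis by blast
  qed
  ultimately show False by blast
qed


text \<open>
  The binary tree consists here of the invariant sets that contain a coset of some member of the
  chain up to finitely many cosets of subgroups of infinite index in that member. Such a set
  contains a coset of the next member, up to smaller pieces; the orbit of that coset splits the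
  set, since all its conjugates are still small compared with the original coset.
\<close>

lemma no_infinite_index_chain:
  assumes H: "\<And>n. H n \<in> \<D>" "\<And>n. additive_subgroup (H n) G" "\<And>n. H (Suc n) \<subseteq> H n"
    and idx: "\<And>n. \<not> almost_sub (H n) (H (Suc n))"
  shows False
proof -
  have Hc: "H n \<subseteq> carrier G" for n using dset_subset[OF H(1)] .
  let ?wit = "\<lambda>E n g \<K> F. g \<in> carrier G \<and> finite \<K> \<and>
    (\<forall>K\<in>\<K>. additive_subgroup K G \<and> \<not> almost_sub (H n) K) \<and> finite F \<and> F \<subseteq> carrier G \<and>
    (\<forall>d\<in>H n. (\<forall>K\<in>\<K>. g \<oplus> d \<notin> translates F K) \<longrightarrow> g \<oplus> d \<in> E)"
  let ?N = "{E \<in> \<D>. (\<forall>\<sigma>\<in>Aut. \<sigma> ` E = E) \<and> (\<exists>n g \<K> F. ?wit E n g \<K> F)}"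
  have "?N = {}"
  proof (rule no_binary_tree[of "{}"])
    show "?N \<subseteq> \<D>" by blast
    show "{} \<notin> ?N"
    proof
      assume "{} \<in> ?N"
      then obtain n g \<K> F where w: "?wit {} n g \<K> F" by blast
      then have "\<And>K. K \<in> \<K> \<Longrightarrow> additive_subgroup K G \<and> \<not> almost_sub (H n) K" by blast
      from neumann_avoid[of \<K>, OF _ this H(2), of F g] w
      obtain d where "d \<in> H n" "\<forall>K\<in>\<K>. g \<oplus> d \<notin> translates F K" by blast
      then show False using w by blast
    qed
    show "\<forall>E\<in>?N. \<forall>\<sigma>\<in>Aut. (\<forall>x\<in>{}. \<sigma> x = x) \<longrightarrow> \<sigma> ` E = E" by blast
    show "\<forall>E\<in>?N. \<exists>Y\<in>?N. \<exists>Z\<in>?N. Y \<subseteq> E \<and> Z \<subseteq> E \<and> Y \<inter> Z = {}"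
    proof
      fix E assume "E \<in> ?N"
      then obtain n g \<K> F where E: "E \<in> \<D>" "\<forall>\<sigma>\<in>Aut. \<sigma> ` E = E" and w: "?wit E n g \<K> F" by blast
      have g: "g \<in> carrier G" and F: "finite F" "F \<subseteq> carrier G" using w by blast+
      have \<K>: "finite \<K>" "\<And>K. K \<in> \<K> \<Longrightarrow> additive_subgroup K G"
        "\<And>K. K \<in> \<K> \<Longrightarrow> \<not> almost_sub (H n) K" using w by blast+
      have Ec: "E \<subseteq> carrier G" using dset_subset[OF E(1)] .
      \<comment> \<open>The subgroups of finite index in the next member must be avoided altogether.\<close>
      let ?K1 = "{K \<in> \<K>. almost_sub (H (Suc n)) K}" and ?K2 = "{K \<in> \<K>. \<not> almost_sub (H (Suc n)) K}"
      let ?S = "\<lambda>K. translates (H (Suc n)) K"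
      have S: "additive_subgroup K' G \<and> \<not> almost_sub (H n) K'" if "K' \<in> ?S ` ?K1" for K'
      proof -
        obtain K where K: "K \<in> \<K>" "almost_sub (H (Suc n)) K" "K' = ?S K" using \<open>K' \<in> ?S ` ?K1\<close> by blast
        have "almost_sub K' K" using almost_sub_sum[OF K(2) Hc \<K>(2)[OF K(1)]] K(3) by simp
        then show ?thesis
          using additive_subgroup_sum[OF H(2) \<K>(2)[OF K(1)]] K(3) almost_sub_trans \<K>(3)[OF K(1)] by blast
      qed
      have "finite (?S ` ?K1)" using \<K>(1) by simp
      then obtain d where d: "d \<in> H n" "\<forall>K'\<in>?S ` ?K1. g \<oplus> d \<notin> translates F K'"
        by (rule neumann_avoid[OF _ S H(2) F g])
      have dc: "d \<in> carrier G" using d(1) Hc by blast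
      have gd: "g \<oplus> d \<in> carrier G" using g dc by simp
      let ?Y = "{x \<in> carrier G. x \<ominus> (g \<oplus> d) \<in> H (Suc n)}"
      have Y: "?Y \<in> \<D>" by (rule dset_translate[OF H(1) gd])
      let ?U = "\<Union>{\<sigma> ` ?Y | \<sigma>. \<sigma> \<in> Aut}"
      have U: "?U \<in> \<D>" using dset_Union[OF finite_dset_orbit[OF Y]] dset_image[OF Y] by blast
      have Uc: "?U \<subseteq> carrier G" using dset_subset[OF U] .
      have Uinv: "\<tau> ` ?U = ?U" if \<tau>: "\<tau> \<in> Aut" for \<tau>
      proof
        show "\<tau> ` ?U \<subseteq> ?U"
        proof
          fix y assume "y \<in> \<tau> ` ?U"
          then obtain \<sigma> x where x: "\<sigma> \<in> Aut" "x \<in> ?Y" "y = \<tau> (\<sigma> x)" by blast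
          then have "y \<in> (\<lambda>x. \<tau> (\<sigma> x)) ` ?Y" by blast
          then show "y \<in> ?U" using aut_comp[OF \<tau> x(1)] by blast
        qed
        show "?U \<subseteq> \<tau> ` ?U"
        proof
          fix y assume y: "y \<in> ?U"
          then obtain \<sigma> x where x: "\<sigma> \<in> Aut" "x \<in> ?Y" "y = \<sigma> x" by blast
          obtain \<rho> where \<rho>: "\<rho> \<in> Aut" "\<forall>x\<in>carrier G. \<rho> (\<tau> x) = x" using aut_inverse[OF \<tau>] by blast
          obtain z where z: "z \<in> carrier G" "y = \<tau> z"
            using y Uc aut_bij[OF \<tau>] by (auto simp: bij_betw_def)
          have "z = \<rho> (\<sigma> x)" using \<rho>(2) z x(3) by simp
          then have "z \<in> (\<lambda>x. \<rho> (\<sigma> x)) ` ?Y" using x(2) by blast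
          then have "z \<in> ?U" using aut_comp[OF \<rho>(1) x(1)] by blast
          then show "y \<in> \<tau> ` ?U" using z(2) by blast
        qed
      qed
      have N1: "E \<inter> ?U \<in> ?N"
      proof -
        have inv: "\<sigma> ` (E \<inter> ?U) = E \<inter> ?U" if "\<sigma> \<in> Aut" for \<sigma>
          using inj_on_image_Int[OF aut_inj[OF that] Ec Uc] E(2) Uinv[OF that] that by simp
        have wt: "?wit (E \<inter> ?U) (Suc n) (g \<oplus> d) ?K2 F"
        proof (intro conjI ballI impI)
          show "g \<oplus> d \<in> carrier G" "finite ?K2" "finite F" "F \<subseteq> carrier G"
            using gd \<K>(1) F by simp_all
          fix K assume K: "K \<in> ?K2"
          show "additive_subgroup K G" using K \<K>(2) by blast
          show "\<not> almost_sub (H (Suc n)) K" using K by blast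
        next
          fix e assume e: "e \<in> H (Suc n)" and av: "\<forall>K\<in>?K2. g \<oplus> d \<oplus> e \<notin> translates F K"
          have ec: "e \<in> carrier G" using e Hc by blast
          have "d \<oplus> e \<in> H n" using sg_add[OF H(2) d(1)] e H(3) by blast
          moreover have "g \<oplus> (d \<oplus> e) \<notin> translates F K" if K: "K \<in> \<K>" for K
          proof (cases "K \<in> ?K2")
            case True
            then show ?thesis using av a_assoc[OF g dc ec] by simp
          next
            case False
            show ?thesis
            proof
              assume "g \<oplus> (d \<oplus> e) \<in> translates F K"
              then obtain f where f: "f \<in> F" "g \<oplus> (d \<oplus> e) \<ominus> f \<in> K" unfolding translates_def by blast
              have fc: "f \<in> carrier G" using f(1) F(2) by blast
              have "(g \<oplus> d \<ominus> f) \<ominus> \<ominus> e = g \<oplus> (d \<oplus> e) \<ominus> f"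
                unfolding a_minus_def using g dc ec fc by (simp add: a_ac)
              moreover have "\<ominus> e \<in> H (Suc n)" using e H(2) unfolding additive_subgroup_iff by blast
              ultimately have "g \<oplus> d \<ominus> f \<in> ?S K"
                using f(2) gd fc unfolding translates_def
                by (intro CollectI conjI bexI[of _ "\<ominus> e"]) simp_all
              then have "g \<oplus> d \<in> translates F (?S K)" using f(1) gd unfolding translates_def by blast
              moreover have "?S K \<in> ?S ` ?K1" using K False by blast
              ultimately show False using d(2) by blast
            qed
          qed
          ultimately have "g \<oplus> (d \<oplus> e) \<in> E" using w by blast
          then have "g \<oplus> d \<oplus> e \<in> E" using a_assoc[OF g dc ec] by simp
          moreover have "g \<oplus> d \<oplus> e \<in> ?Y" using add_minus_cancel[OF gd ec] gd ec e by simp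
          then have "g \<oplus> d \<oplus> e \<in> (\<lambda>x. x) ` ?Y" by simp
          then have "g \<oplus> d \<oplus> e \<in> ?U" using aut_id by blast
          ultimately show "g \<oplus> d \<oplus> e \<in> E \<inter> ?U" by blast
        qed
        show ?thesis
        proof (rule CollectI, intro conjI ballI)
          show "\<exists>n g \<K> F. ?wit (E \<inter> ?U) n g \<K> F"
            by (rule exI, rule exI, rule exI, rule exI, rule wt)
        qed (rule dset_Int[OF E(1) U], rule inv)
      qed
      have N2: "E - ?U \<in> ?N"
      proof -
        have diff: "E - ?U = E \<inter> (carrier G - ?U)" using Ec by blast
        have D: "E - ?U \<in> \<D>" unfolding diff by (rule dset_Int[OF E(1) dset_compl[OF U]])
        have inv: "\<sigma> ` (E - ?U) = E - ?U" if "\<sigma> \<in> Aut" for \<sigma>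
        proof -
          have "E - ?U \<subseteq> carrier G" using Ec by blast
          from inj_on_image_set_diff[OF aut_inj[OF that] this Uc]
          show ?thesis using E(2) Uinv[OF that] that by simp
        qed
        let ?K3 = "{\<sigma> ` H (Suc n) | \<sigma>. \<sigma> \<in> Aut}" and ?F3 = "{\<sigma> (g \<oplus> d) | \<sigma>. \<sigma> \<in> Aut}"
        have wt: "?wit (E - ?U) n g (\<K> \<union> ?K3) (F \<union> ?F3)"
        proof (intro conjI ballI impI)
          show "g \<in> carrier G" by (rule g)
          show "finite (\<K> \<union> ?K3)" using \<K>(1) finite_dset_orbit[OF H(1)] by simp
          show "finite (F \<union> ?F3)" using F(1) finite_orbit[OF gd] by simp
          show "F \<union> ?F3 \<subseteq> carrier G" using F(2) aut_closed[OF _ gd] by blast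
        next
          fix K assume K: "K \<in> \<K> \<union> ?K3"
          show "additive_subgroup K G" using K \<K>(2) aut_subgroup[OF _ H(2)] by blast
          show "\<not> almost_sub (H n) K"
          proof
            assume le: "almost_sub (H n) K"
            then have "K \<notin> \<K>" using \<K>(3) by blast
            then obtain \<sigma> where "\<sigma> \<in> Aut" "K = \<sigma> ` H (Suc n)" using K by blast
            then show False using almost_sub_conjugate[OF _ H(1) H(3)] le idx by blast
          qed
        next
          fix x assume x: "x \<in> H n" and av: "\<forall>K\<in>\<K> \<union> ?K3. g \<oplus> x \<notin> translates (F \<union> ?F3) K"
          have "g \<oplus> x \<notin> translates F K" if "K \<in> \<K>" for K
            using av that translates_mono[of F "F \<union> ?F3" K K] by blast
          then have "g \<oplus> x \<in> E" using w x by blast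
          moreover have "g \<oplus> x \<notin> ?U"
          proof
            assume "g \<oplus> x \<in> ?U"
            then obtain \<sigma> y where y: "\<sigma> \<in> Aut" "y \<in> ?Y" "g \<oplus> x = \<sigma> y" by blast
            have yc: "y \<in> carrier G" "y \<ominus> (g \<oplus> d) \<in> H (Suc n)" using y(2) by simp_all
            have "g \<oplus> x \<ominus> \<sigma> (g \<oplus> d) = \<sigma> (y \<ominus> (g \<oplus> d))"
              using aut_minus[OF y(1) yc(1) gd] y(3) by simp
            then have "g \<oplus> x \<ominus> \<sigma> (g \<oplus> d) \<in> \<sigma> ` H (Suc n)" using yc(2) by blast
            moreover have "\<sigma> (g \<oplus> d) \<in> F \<union> ?F3" "g \<oplus> x \<in> carrier G"
              using y aut_closed[OF y(1) yc(1)] by auto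
            ultimately have "g \<oplus> x \<in> translates (F \<union> ?F3) (\<sigma> ` H (Suc n))"
              unfolding translates_def by blast
            then show False using av y(1) by blast
          qed
          ultimately show "g \<oplus> x \<in> E - ?U" by blast
        qed
        show ?thesis
        proof (rule CollectI, intro conjI ballI)
          show "\<exists>n g \<K> F. ?wit (E - ?U) n g \<K> F"
            by (rule exI, rule exI, rule exI, rule exI, rule wt)
        qed (rule D, rule inv)
      qed
      show "\<exists>Y\<in>?N. \<exists>Z\<in>?N. Y \<subseteq> E \<and> Z \<subseteq> E \<and> Y \<inter> Z = {}"
        by (rule bexI[OF _ N1], rule bexI[OF _ N2]) (intro conjI; blast)
    qed
  qed simp_all
  moreover have "carrier G \<in> ?N"
  proof -
    have "\<sigma> ` carrier G = carrier G" if "\<sigma> \<in> Aut" for \<sigma>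
      using aut_bij[OF that] by (simp add: bij_betw_def)
    moreover have "?wit (carrier G) 0 \<zero> {} {}" using Hc[of 0] by auto
    then have "\<exists>n g \<K> F. ?wit (carrier G) n g \<K> F" by (intro exI)
    ultimately show ?thesis using dset_carrier by simp
  qed
  ultimately show False by blast
qed

text \<open>
  Every chain is eventually of finite index, and then the intersection of the conjugates of its
  members over the parameters of the first one is an invariant chain. Once the latter is
  stationary, only finitely many subgroups are left between its last member and the first
  member of the former.
\<close>

theorem chain_stationary:
  assumes H: "\<And>n. H n \<in> \<D>" "\<And>n. additive_subgroup (H n) G" "\<And>n. H (Suc n) \<subseteq> H n"
  shows "\<exists>m. \<forall>n\<ge>m. H n = H m"
proof -
  have anti: "H j \<subseteq> H i" if "i \<le> j" for i j using H(3) that by (rule lift_Suc_antimono_le)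
  have Hc: "H n \<subseteq> carrier G" for n using dset_subset[OF H(1)] .
  have "\<exists>m. \<forall>n\<ge>m. almost_sub (H m) (H n)"
  proof (rule ccontr)
    assume "\<not> ?thesis"
    then have "\<forall>m. \<exists>n. n \<ge> m \<and> \<not> almost_sub (H m) (H n)" by blast
    then obtain nx where nx: "\<And>m. nx m \<ge> m" "\<And>m. \<not> almost_sub (H m) (H (nx m))" by metis
    define s where "s = rec_nat 0 (\<lambda>_. nx)"
    have s: "s (Suc i) = nx (s i)" for i by (simp add: s_def)
    show False
    proof (rule no_infinite_index_chain[of "\<lambda>i. H (s i)"])
      show "H (s i) \<in> \<D>" "additive_subgroup (H (s i)) G" for i by (rule H)+
      show "H (s (Suc i)) \<subseteq> H (s i)" for i unfolding s by (rule anti[OF nx(1)])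
      show "\<not> almost_sub (H (s i)) (H (s (Suc i)))" for i unfolding s by (rule nx(2))
    qed
  qed
  then obtain m where m: "\<And>n. n \<ge> m \<Longrightarrow> almost_sub (H m) (H n)" by blast
  obtain B where B: "finite B" "B \<subseteq> carrier G"
    "\<And>\<sigma>. \<sigma> \<in> Aut \<Longrightarrow> \<forall>x\<in>B. \<sigma> x = x \<Longrightarrow> \<sigma> ` H m = H m"
    using dset_support[OF H(1)] by metis
  let ?S = "{\<sigma> \<in> Aut. \<forall>x\<in>B. \<sigma> x = x}"
  define L where "L = (\<lambda>n. \<Inter>\<sigma>\<in>?S. \<sigma> ` H (m + n))"
  have idS: "(\<lambda>x. x) \<in> ?S" using aut_id by simp
  have fin: "finite ((\<lambda>\<sigma>. \<sigma> ` H k) ` ?S)" for k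
    by (rule finite_subset[OF _ finite_dset_orbit[OF H(1)[of k]]]) blast
  have ne: "(\<lambda>\<sigma>. \<sigma> ` H k) ` ?S \<noteq> {}" for k using idS by blast
  have Lsub: "L n \<subseteq> H (m + n)" for n
  proof -
    have "L n \<subseteq> (\<lambda>x. x) ` H (m + n)" unfolding L_def by (rule INF_lower[OF idS])
    then show ?thesis by simp
  qed
  have LD: "L n \<in> \<D>" for n
    unfolding L_def by (rule dset_Inter[OF fin ne]) (use dset_image[OF H(1)] in blast)
  have Lsg: "additive_subgroup (L n) G" for n
    unfolding L_def by (rule additive_subgroup_Inter[OF ne]) (use aut_subgroup[OF _ H(2)] in blast)
  have Ldec: "L (Suc n) \<subseteq> L n" for n
  proof -
    have "H (m + Suc n) \<subseteq> H (m + n)" by (rule anti) simp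
    then show ?thesis unfolding L_def by blast
  qed
  have Linv: "\<tau> ` L n = L n" if \<tau>: "\<tau> \<in> Aut" "\<forall>x\<in>B. \<tau> x = x" for \<tau> n
  proof -
    have le: "\<rho> ` L n \<subseteq> L n" if \<rho>: "\<rho> \<in> ?S" for \<rho>
    proof
      fix y assume "y \<in> \<rho> ` L n"
      then obtain x where x: "x \<in> L n" "y = \<rho> x" by blast
      have xc: "x \<in> carrier G" using x(1) Lsub Hc by blast
      obtain \<rho>' where \<rho>': "\<rho>' \<in> Aut" "\<forall>x\<in>carrier G. \<rho>' (\<rho> x) = x" using aut_inverse \<rho> by blast
      have \<rho>'S: "\<rho>' z = z" if "z \<in> B" for z using \<rho>'(2) \<rho> that B(2) by (metis (mono_tags, lifting) mem_Collect_eq subsetD)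
      show "y \<in> L n"
        unfolding L_def
      proof (rule INT_I)
        fix \<sigma> assume \<sigma>: "\<sigma> \<in> ?S"
        then have "(\<lambda>x. \<rho>' (\<sigma> x)) \<in> ?S" using aut_comp[OF \<rho>'(1)] \<rho>'S by simp
        then have "x \<in> (\<lambda>x. \<rho>' (\<sigma> x)) ` H (m + n)" using x(1) unfolding L_def by blast
        then obtain h where h: "h \<in> H (m + n)" "x = \<rho>' (\<sigma> h)" by blast
        have "\<sigma> h \<in> carrier G" using \<sigma> h(1) Hc aut_closed by blast
        then obtain z where z: "z \<in> carrier G" "\<sigma> h = \<rho> z"
          using aut_bij[of \<rho>] \<rho> by (auto simp: bij_betw_def)
        then have "x = z" using h(2) \<rho>'(2) by simp
        then show "y \<in> \<sigma> ` H (m + n)" using x(2) z(2) h(1) by (metis imageI)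
      qed
    qed
    obtain \<tau>' where \<tau>': "\<tau>' \<in> Aut" "\<forall>x\<in>carrier G. \<tau>' (\<tau> x) = x" using aut_inverse \<tau>(1) by blast
    have "\<tau>' z = z" if "z \<in> B" for z using \<tau>'(2) \<tau>(2) that B(2) by (metis subsetD)
    then have 1: "\<tau>' ` L n \<subseteq> L n" using le \<tau>'(1) by blast
    have 2: "\<tau> ` L n \<subseteq> L n" using le \<tau> by blast
    have "y \<in> \<tau> ` L n" if y: "y \<in> L n" for y
    proof -
      have "y \<in> carrier G" using y Lsub Hc by blast
      then obtain z where z: "z \<in> carrier G" "y = \<tau> z" using aut_bij[OF \<tau>(1)] by (auto simp: bij_betw_def)
      then have "\<tau>' y = z" using \<tau>'(2) by simp
      then show ?thesis using 1 y z(2) by blast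
    qed
    then show ?thesis using 2 by blast
  qed
  obtain p where p: "\<And>n. n \<ge> p \<Longrightarrow> L n = L p"
    using invariant_chain_stationary[of B L, OF B(1,2) LD Lsg Ldec Linv] by blast
  have "almost_sub (H m) (L p)"
    unfolding L_def
  proof (rule almost_sub_Inter[OF fin ne])
    fix K assume "K \<in> (\<lambda>\<sigma>. \<sigma> ` H (m + p)) ` ?S"
    then obtain \<sigma> where \<sigma>: "\<sigma> \<in> ?S" "K = \<sigma> ` H (m + p)" by blast
    then show "additive_subgroup K G" using aut_subgroup[OF _ H(2)] by blast
    have "almost_sub (\<sigma> ` H m) (\<sigma> ` H (m + p))"
      by (rule aut_almost_sub[OF _ m Hc]) (use \<sigma>(1) in simp_all)
    then show "almost_sub (H m) K" using B(3)[of \<sigma>] \<sigma> by simp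
  qed
  then obtain F where F: "finite F" "F \<subseteq> carrier G" "H m \<subseteq> translates F (L p)" by (rule almost_subE)
  have dec: "H (m + n) = translates (F \<inter> H (m + n)) (L p)" if n: "n \<ge> p" for n
  proof
    have LH: "L p \<subseteq> H (m + n)" using Lsub[of n] p[OF n] by simp
    show "H (m + n) \<subseteq> translates (F \<inter> H (m + n)) (L p)"
    proof
      fix x assume x: "x \<in> H (m + n)"
      then have xc: "x \<in> carrier G" using Hc by blast
      have "x \<in> H m" using x anti[of m "m + n"] by auto
      then obtain f where f: "f \<in> F" "x \<ominus> f \<in> L p" using F(3) unfolding translates_def by blast
      have fc: "f \<in> carrier G" using f(1) F(2) by blast
      have "x \<ominus> (x \<ominus> f) \<in> H (m + n)" using sg_minus[OF H(2) x] f(2) LH by blast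
      moreover have "x \<ominus> (x \<ominus> f) = (x \<oplus> \<ominus> x) \<oplus> f"
        unfolding a_minus_def using xc fc by (simp add: minus_add a_ac)
      then have "x \<ominus> (x \<ominus> f) = f" using xc fc by (simp add: r_neg)
      ultimately have "f \<in> H (m + n)" by simp
      then show "x \<in> translates (F \<inter> H (m + n)) (L p)"
        using f xc unfolding translates_def by blast
    qed
    show "translates (F \<inter> H (m + n)) (L p) \<subseteq> H (m + n)"
    proof
      fix x assume "x \<in> translates (F \<inter> H (m + n)) (L p)"
      then obtain f where f: "x \<in> carrier G" "f \<in> F" "f \<in> H (m + n)" "x \<ominus> f \<in> L p"
        unfolding translates_def by blast
      then have "(x \<ominus> f) \<oplus> f \<in> H (m + n)" using sg_add[OF H(2)] LH by blast
      moreover have "f \<in> carrier G" using f(2) F(2) by blast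
      ultimately show "x \<in> H (m + n)" using minus_add_cancel'[OF f(1)] by simp
    qed
  qed
  obtain q where q: "q \<ge> p" "\<And>n. n \<ge> p \<Longrightarrow> card (F \<inter> H (m + q)) \<le> card (F \<inter> H (m + n))"
    using ex_has_least_nat[of "\<lambda>n. n \<ge> p" p "\<lambda>n. card (F \<inter> H (m + n))"] by blast
  have "H n = H (m + q)" if n: "n \<ge> m + q" for n
  proof -
    obtain k where k: "n = m + k" "k \<ge> q" using n by (metis add_le_cancel_left le_Suc_ex le_add1 le_trans)
    have "F \<inter> H (m + k) \<subseteq> F \<inter> H (m + q)" using anti[of "m + q" "m + k"] k(2) by auto
    moreover have "card (F \<inter> H (m + q)) \<le> card (F \<inter> H (m + k))" using q(1) k(2) by (intro q(2)) simp
    ultimately have "F \<inter> H (m + k) = F \<inter> H (m + q)"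
      using F(1) by (intro card_seteq) simp_all
    then show ?thesis using dec[of k] dec[of q] q(1) k by simp
  qed
  then show ?thesis by blast
qed

end

section \<open>Idempotents and the radical of pi-regular rings\<close>

context rng
begin

lemma rng_r_null: "x \<in> carrier R \<Longrightarrow> x \<otimes> \<zero> = \<zero>"
proof -
  assume x: "x \<in> carrier R"
  have "x \<otimes> \<zero> \<oplus> x \<otimes> \<zero> = x \<otimes> \<zero> \<oplus> \<zero>"
    using x rng_r_distr[of \<zero> \<zero> x] by (simp add: rng_m_closed)
  then show ?thesis using x by (simp add: rng_m_closed)
qed

lemma rng_l_minus: "x \<in> carrier R \<Longrightarrow> y \<in> carrier R \<Longrightarrow> (\<ominus> x) \<otimes> y = \<ominus> (x \<otimes> y)"
proof -
  assume c: "x \<in> carrier R" "y \<in> carrier R"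
  have "(\<ominus> x) \<otimes> y \<oplus> x \<otimes> y = (\<ominus> x \<oplus> x) \<otimes> y" using c by (simp add: rng_l_distr)
  also have "\<dots> = \<zero>" using c by (simp add: l_neg rng_l_null)
  finally show ?thesis using c by (simp add: minus_equality rng_m_closed)
qed

lemma rng_r_minus: "x \<in> carrier R \<Longrightarrow> y \<in> carrier R \<Longrightarrow> x \<otimes> (\<ominus> y) = \<ominus> (x \<otimes> y)"
proof -
  assume c: "x \<in> carrier R" "y \<in> carrier R"
  have "x \<otimes> (\<ominus> y) \<oplus> x \<otimes> y = x \<otimes> (\<ominus> y \<oplus> y)" using c by (simp add: rng_r_distr)
  also have "\<dots> = \<zero>" using c by (simp add: l_neg rng_r_null)
  finally show ?thesis using c by (simp add: minus_equality rng_m_closed)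
qed

lemma rng_l_diff:
  "x \<in> carrier R \<Longrightarrow> y \<in> carrier R \<Longrightarrow> z \<in> carrier R \<Longrightarrow> (x \<ominus> y) \<otimes> z = x \<otimes> z \<ominus> y \<otimes> z"
  by (simp add: a_minus_def rng_l_distr rng_l_minus)

lemma rng_r_diff:
  "x \<in> carrier R \<Longrightarrow> y \<in> carrier R \<Longrightarrow> z \<in> carrier R \<Longrightarrow> z \<otimes> (x \<ominus> y) = z \<otimes> x \<ominus> z \<otimes> y"
  by (simp add: a_minus_def rng_r_distr rng_r_minus)

lemma diff_zero: "x \<in> carrier R \<Longrightarrow> x \<ominus> \<zero> = x"
  by (simp add: a_minus_def)

text \<open>Makes a known product available inside right-associated normal forms.\<close>

lemma contract:
  assumes "a \<otimes> b = c" "a \<in> carrier R" "b \<in> carrier R" "z \<in> carrier R"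
  shows "a \<otimes> (b \<otimes> z) = c \<otimes> z"
  using assms rng_m_assoc by metis

abbreviation iter_square :: "nat \<Rightarrow> 'a \<Rightarrow> 'a" where
  "iter_square n a \<equiv> ((\<lambda>x. x \<otimes> x) ^^ n) a"

lemma iter_square_closed: "a \<in> carrier R \<Longrightarrow> iter_square n a \<in> carrier R"
  by (induction n) (simp_all add: rng_m_closed)

text \<open>\<open>(1 + r)(1 - r) = 1 - r\<^sup>2\<close> reduces the quasi-inverse of \<open>r\<close> to that of \<open>- r\<^sup>2\<close>.\<close>

lemma nilpotent_right_quasi_regular:
  assumes "r \<in> carrier R" "iter_square n r = \<zero>"
  shows "right_quasi_regular R r"
  using assms
proof (induction n arbitrary: r)
  case 0
  then show ?case unfolding right_quasi_regular_def by (auto simp: rng_l_null intro!: bexI[of _ \<zero>])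
next
  case (Suc n)
  let ?q = "\<ominus> (r \<otimes> r)"
  have r: "r \<in> carrier R" by (rule Suc.prems(1))
  have q: "?q \<in> carrier R" using r by (simp add: rng_m_closed)
  have sq: "iter_square n (r \<otimes> r) = \<zero>" using Suc.prems(2) by (simp only: funpow_Suc_right o_apply)
  have "iter_square n ?q = \<zero>"
  proof (cases n)
    case 0
    then show ?thesis using sq by simp
  next
    case (Suc k)
    have "?q \<otimes> ?q = (r \<otimes> r) \<otimes> (r \<otimes> r)"
      using r by (simp add: rng_l_minus rng_r_minus rng_m_closed)
    then show ?thesis using sq unfolding Suc by (simp only: funpow_Suc_right o_apply)
  qed
  from Suc.IH[OF q this] obtain t where t: "t \<in> carrier R" "?q \<oplus> t \<oplus> ?q \<otimes> t = \<zero>"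
    unfolding right_quasi_regular_def by blast
  let ?s = "\<ominus> r \<oplus> (t \<oplus> \<ominus> (r \<otimes> t))"
  have rt: "r \<otimes> t \<in> carrier R" and rr: "r \<otimes> r \<in> carrier R" and rrt: "r \<otimes> (r \<otimes> t) \<in> carrier R"
    using r t(1) by (simp_all add: rng_m_closed)
  have "r \<otimes> ?s = ?q \<oplus> (r \<otimes> t \<oplus> \<ominus> (r \<otimes> (r \<otimes> t)))"
    using r t(1) rt by (simp add: rng_r_distr rng_r_minus)
  then have "r \<oplus> ?s \<oplus> r \<otimes> ?s = (r \<oplus> \<ominus> r) \<oplus> ((r \<otimes> t \<oplus> \<ominus> (r \<otimes> t)) \<oplus> (?q \<oplus> t \<oplus> \<ominus> (r \<otimes> (r \<otimes> t))))"
    using r t(1) rt rr rrt by (simp add: a_ac)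
  also have "\<dots> = ?q \<oplus> t \<oplus> \<ominus> (r \<otimes> (r \<otimes> t))"
    using r t(1) rt rr rrt by (simp add: r_neg)
  also have "\<ominus> (r \<otimes> (r \<otimes> t)) = ?q \<otimes> t"
    using r t(1) rr by (simp add: rng_l_minus rng_m_assoc)
  finally have "r \<oplus> ?s \<oplus> r \<otimes> ?s = \<zero>" using t(2) by simp
  moreover have "?s \<in> carrier R" using r t(1) rt by simp
  ultimately show ?case unfolding right_quasi_regular_def by blast
qed

abbreviation "J \<equiv> jacobson_radical R"

lemma jacobson_radical_quasi_regular: "quasi_regular_right_ideal J R"
  using theI'[OF jacobson_radical_ex1] unfolding jacobson_radical_def by blast

lemma quasi_regular_subset_radical:
  assumes K: "quasi_regular_right_ideal K R"
  shows "K \<subseteq> J"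
proof -
  let ?S = "{a \<oplus> b | a b. a \<in> J \<and> b \<in> K}"
  have rJ: "right_ideal J R" and rK: "right_ideal K R"
    using jacobson_radical_quasi_regular K unfolding quasi_regular_right_ideal_def by auto
  have z: "\<zero> \<in> J" "\<zero> \<in> K" and c: "J \<subseteq> carrier R" "K \<subseteq> carrier R"
    using rJ rK unfolding right_ideal_iff by auto
  have "quasi_regular_right_ideal ?S R"
    by (rule quasi_regular_right_ideal_sum[OF jacobson_radical_quasi_regular K])
  moreover have "J \<subseteq> ?S"
  proof
    fix x assume "x \<in> J"
    then have "x = x \<oplus> \<zero>" using c by auto
    then show "x \<in> ?S" using \<open>x \<in> J\<close> z by blast
  qed
  ultimately have "?S = J"
    using theI'[OF jacobson_radical_ex1] unfolding jacobson_radical_def by blast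
  moreover have "K \<subseteq> ?S"
  proof
    fix x assume "x \<in> K"
    then have "x = \<zero> \<oplus> x" using c by auto
    then show "x \<in> ?S" using \<open>x \<in> K\<close> z by blast
  qed
  ultimately show ?thesis by simp
qed

lemma right_ideal_radical: "right_ideal J R"
  using jacobson_radical_quasi_regular unfolding quasi_regular_right_ideal_def by blast

lemma radical_closed: "x \<in> J \<Longrightarrow> x \<in> carrier R"
  using right_ideal_radical unfolding right_ideal_iff by blast

lemma radical_r_mult: "x \<in> J \<Longrightarrow> r \<in> carrier R \<Longrightarrow> x \<otimes> r \<in> J"
  using right_ideal_radical unfolding right_ideal_iff by blast

definition idem :: "'a \<Rightarrow> bool" where
  "idem e \<longleftrightarrow> e \<in> carrier R \<and> e \<otimes> e = e"

lemma idem_radical: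
  assumes "idem g" "g \<in> J"
  shows "g = \<zero>"
proof -
  have g: "g \<in> carrier R" "g \<otimes> g = g" using assms(1) unfolding idem_def by auto
  have "\<ominus> g \<in> J" using assms(2) right_ideal_radical unfolding right_ideal_iff by blast
  then obtain s where s: "s \<in> carrier R" "\<ominus> g \<oplus> s \<oplus> (\<ominus> g) \<otimes> s = \<zero>"
    using jacobson_radical_quasi_regular
    unfolding quasi_regular_right_ideal_def right_quasi_regular_def by blast
  have gs: "g \<otimes> s \<in> carrier R" using g s(1) by (simp add: rng_m_closed)
  have "\<zero> = g \<otimes> (\<ominus> g \<oplus> s \<oplus> (\<ominus> g) \<otimes> s)" using s(2) g(1) by (simp add: rng_r_null)
  also have "\<dots> = \<ominus> g \<oplus> g \<otimes> s \<oplus> \<ominus> (g \<otimes> s)"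
    using g s(1) gs contract[OF g(2) g(1) g(1) s(1)]
    by (simp add: rng_r_distr rng_r_minus rng_l_minus rng_m_closed)
  also have "\<dots> = \<ominus> g" using g gs by (simp add: a_assoc r_neg)
  finally have "\<ominus> g = \<zero>" by simp
  then have "\<ominus> g \<oplus> g = \<zero> \<oplus> g" by simp
  then show ?thesis using g(1) by (simp add: l_neg)
qed

definition idem_le :: "'a \<Rightarrow> 'a \<Rightarrow> bool" where
  "idem_le e f \<longleftrightarrow> e \<otimes> f = e \<and> f \<otimes> e = e"

definition idem_less :: "('a \<times> 'a) set" where
  "idem_less = {(e, f). idem e \<and> idem f \<and> idem_le e f \<and> e \<noteq> f}"

definition primitive_idem :: "'a \<Rightarrow> bool" where
  "primitive_idem e \<longleftrightarrow> idem e \<and> e \<noteq> \<zero> \<and> (\<forall>g. idem g \<longrightarrow> idem_le g e \<longrightarrow> g = \<zero> \<or> g = e)"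

lemma idem_le_trans:
  assumes "idem e" "idem f" "idem g" "idem_le e f" "idem_le f g"
  shows "idem_le e g"
proof -
  have c: "e \<in> carrier R" "f \<in> carrier R" "g \<in> carrier R" using assms(1-3) unfolding idem_def by auto
  have h: "e \<otimes> f = e" "f \<otimes> e = e" "f \<otimes> g = f" "g \<otimes> f = f"
    using assms(4,5) unfolding idem_le_def by auto
  show ?thesis
    unfolding idem_le_def
    using rng_m_assoc[OF c(1,2,3)] rng_m_assoc[OF c(3,2,1)] h by simp
qed

lemma finsum_l_distr:
  assumes "finite S" "f \<in> S \<rightarrow> carrier R" "x \<in> carrier R"
  shows "(\<Oplus>i\<in>S. f i) \<otimes> x = (\<Oplus>i\<in>S. f i \<otimes> x)"
  using assms(1,2)
proof (induction rule: finite_induct)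
  case empty
  then show ?case using assms(3) by (simp add: rng_l_null)
next
  case (insert a S)
  have c: "f a \<in> carrier R" "f \<in> S \<rightarrow> carrier R" "(\<lambda>i. f i \<otimes> x) \<in> S \<rightarrow> carrier R" "f a \<otimes> x \<in> carrier R"
    using insert.prems assms(3) rng_m_closed by auto
  then show ?case
    using insert.hyps insert.IH assms(3) by (simp add: finsum_insert rng_l_distr finsum_closed)
qed

lemma finsum_r_distr:
  assumes "finite S" "f \<in> S \<rightarrow> carrier R" "x \<in> carrier R"
  shows "x \<otimes> (\<Oplus>i\<in>S. f i) = (\<Oplus>i\<in>S. x \<otimes> f i)"
  using assms(1,2)
proof (induction rule: finite_induct)
  case empty
  then show ?case using assms(3) by (simp add: rng_r_null)
next
  case (insert a S)
  have c: "f a \<in> carrier R" "f \<in> S \<rightarrow> carrier R" "(\<lambda>i. x \<otimes> f i) \<in> S \<rightarrow> carrier R" "x \<otimes> f a \<in> carrier R"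
    using insert.prems assms(3) rng_m_closed by auto
  then show ?case
    using insert.hyps insert.IH assms(3) by (simp add: finsum_insert rng_r_distr finsum_closed)
qed

end

text \<open>
  Pi-regularity says that some power of each element is von Neumann regular. The powers are
  iterated squares, which avoids the zeroth power. The chain conditions on idempotents exclude
  infinite families of orthogonal idempotents.
\<close>

locale pi_regular_rng = rng R for R (structure) +
  assumes pi_regular: "a \<in> carrier R \<Longrightarrow> \<exists>n. \<exists>c\<in>carrier R.
      iter_square n a \<otimes> c \<otimes> iter_square n a = iter_square n a"
    and idem_descending: "\<not> (\<exists>f. \<forall>i::nat. (f (Suc i), f i) \<in> idem_less)"
    and idem_ascending: "\<not> (\<exists>f. \<forall>i::nat. (f i, f (Suc i)) \<in> idem_less)"
begin

text \<open>If \<open>b c b = b\<close>, then \<open>b c\<close> is an idempotent, and it vanishes only if \<open>b\<close> does.\<close>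

lemma right_ideal_without_idem:
  assumes I: "right_ideal I R" and no: "\<And>g. g \<in> I \<Longrightarrow> idem g \<Longrightarrow> g = \<zero>"
  shows "I \<subseteq> J"
proof (rule quasi_regular_subset_radical)
  have sub: "I \<subseteq> carrier R" "\<And>x r. x \<in> I \<Longrightarrow> r \<in> carrier R \<Longrightarrow> x \<otimes> r \<in> I"
    using I unfolding right_ideal_iff by auto
  have "right_quasi_regular R a" if a: "a \<in> I" for a
  proof -
    have ac: "a \<in> carrier R" using a sub by blast
    obtain n c where c: "c \<in> carrier R"
      "iter_square n a \<otimes> c \<otimes> iter_square n a = iter_square n a"
      using pi_regular[OF ac] by blast
    let ?b = "iter_square n a"
    have b: "?b \<in> carrier R" using iter_square_closed[OF ac] .
    have bI: "?b \<in> I"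
    proof (induction n)
      case 0
      then show ?case using a by simp
    next
      case (Suc n)
      then show ?case using sub by auto
    qed
    have "idem (?b \<otimes> c)"
      unfolding idem_def
    proof
      show "?b \<otimes> c \<in> carrier R" using b c(1) by (simp add: rng_m_closed)
      have "?b \<otimes> c \<otimes> (?b \<otimes> c) = (?b \<otimes> c \<otimes> ?b) \<otimes> c"
        using b c(1) by (simp add: rng_m_assoc rng_m_closed)
      then show "?b \<otimes> c \<otimes> (?b \<otimes> c) = ?b \<otimes> c" using c(2) by simp
    qed
    then have "?b \<otimes> c = \<zero>" using no sub(2)[OF bI c(1)] by blast
    then have "?b = \<zero>" using c(2) b by (simp add: rng_l_null)
    then show ?thesis using nilpotent_right_quasi_regular[OF ac] by blast
  qed
  then show "quasi_regular_right_ideal I R" using I unfolding quasi_regular_right_ideal_def by blast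
qed

text \<open>
  An element outside the radical generates a right ideal with a nonzero idempotent. To have that
  idempotent among the right multiples of the element, the right ideal of all elements whose
  right multiples are right multiples of \<open>x\<close> is used.
\<close>

lemma idem_multiple:
  assumes x: "x \<in> carrier R" "x \<notin> J"
  obtains r where "r \<in> carrier R" "idem (x \<otimes> r)" "x \<otimes> r \<noteq> \<zero>"
proof -
  let ?I = "{z \<in> carrier R. \<forall>r\<in>carrier R. \<exists>s\<in>carrier R. z \<otimes> r = x \<otimes> s}"
  have "right_ideal ?I R"
    unfolding right_ideal_iff
  proof (intro conjI ballI)
    show "?I \<subseteq> carrier R" by blast
    show "\<zero> \<in> ?I" using x(1) by (auto simp: rng_l_null rng_r_null intro!: bexI[of _ \<zero>])
  next
    fix y z assume yz: "y \<in> ?I" "z \<in> ?I"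
    have "\<exists>s\<in>carrier R. (y \<oplus> z) \<otimes> r = x \<otimes> s" if r: "r \<in> carrier R" for r
    proof -
      obtain s t where "s \<in> carrier R" "y \<otimes> r = x \<otimes> s" "t \<in> carrier R" "z \<otimes> r = x \<otimes> t"
        using yz r by blast
      then show ?thesis using yz r x(1) by (intro bexI[of _ "s \<oplus> t"]) (simp_all add: rng_l_distr rng_r_distr)
    qed
    then show "y \<oplus> z \<in> ?I" using yz by simp
  next
    fix y assume y: "y \<in> ?I"
    have "\<exists>s\<in>carrier R. (\<ominus> y) \<otimes> r = x \<otimes> s" if r: "r \<in> carrier R" for r
    proof -
      obtain s where "s \<in> carrier R" "y \<otimes> r = x \<otimes> s" using y r by blast
      then show ?thesis using y r x(1) by (intro bexI[of _ "\<ominus> s"]) (simp_all add: rng_l_minus rng_r_minus)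
    qed
    then show "\<ominus> y \<in> ?I" using y by simp
  next
    fix y q assume y: "y \<in> ?I" and q: "q \<in> carrier R"
    have "\<exists>s\<in>carrier R. (y \<otimes> q) \<otimes> r = x \<otimes> s" if r: "r \<in> carrier R" for r
    proof -
      obtain s where "s \<in> carrier R" "y \<otimes> (q \<otimes> r) = x \<otimes> s" using y q r rng_m_closed by blast
      then show ?thesis using y q r by (intro bexI[of _ s]) (simp_all add: rng_m_assoc)
    qed
    then show "y \<otimes> q \<in> ?I" using y q by (simp add: rng_m_closed)
  qed
  moreover have "x \<in> ?I" using x(1) by blast
  ultimately obtain g where g: "g \<in> ?I" "idem g" "g \<noteq> \<zero>"
    using right_ideal_without_idem x(2) by blast
  then obtain s where "s \<in> carrier R" "g \<otimes> g = x \<otimes> s" unfolding idem_def by blast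
  then show thesis using that g(2,3) unfolding idem_def by metis
qed

text \<open>
  An idempotent \<open>g = y x r\<close> outside the radical would be isomorphic to the idempotent \<open>x r g y\<close>
  inside it.
\<close>

lemma radical_l_mult:
  assumes "x \<in> J" "y \<in> carrier R"
  shows "y \<otimes> x \<in> J"
proof (rule ccontr)
  assume n: "y \<otimes> x \<notin> J"
  have x: "x \<in> carrier R" using assms(1) by (rule radical_closed)
  obtain r where r: "r \<in> carrier R" "idem (y \<otimes> x \<otimes> r)" "y \<otimes> x \<otimes> r \<noteq> \<zero>"
    by (rule idem_multiple[OF rng_m_closed[OF assms(2) x] n])
  define g where "g = y \<otimes> x \<otimes> r"
  have g: "g \<in> carrier R" "g \<otimes> g = g" "g \<noteq> \<zero>" using r unfolding g_def idem_def by auto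
  have gg: "y \<otimes> (x \<otimes> r) = g" unfolding g_def using x r(1) assms(2) by (simp add: rng_m_assoc)
  let ?h = "x \<otimes> (r \<otimes> (g \<otimes> y))"
  note cl = x r(1) assms(2) g(1) rng_m_closed
  have yxr: "y \<otimes> (x \<otimes> (r \<otimes> z)) = g \<otimes> z" if "z \<in> carrier R" for z
    using contract[OF gg _ _ that] cl that by (simp add: rng_m_assoc)
  have hJ: "?h \<in> J" by (rule radical_r_mult[OF assms(1)]) (simp add: cl)
  have "?h \<otimes> ?h = ?h"
    using cl yxr contract[OF g(2) g(1) g(1)] by (simp add: rng_m_assoc)
  then have "idem ?h" unfolding idem_def using cl by simp
  then have "?h = \<zero>" using idem_radical hJ by blast
  then have "y \<otimes> (?h \<otimes> (x \<otimes> r)) = \<zero>" using cl by (simp add: rng_l_null rng_r_null)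
  moreover have "y \<otimes> (?h \<otimes> (x \<otimes> r)) = g"
    using cl yxr contract[OF g(2) g(1) g(1)] gg g(2) by (simp add: rng_m_assoc)
  ultimately show False using g(3) by simp
qed

text \<open>
  Some multiple \<open>g\<close> of \<open>x\<close> is a nonzero idempotent, and primitivity of \<open>e\<close> forces \<open>g e = e\<close>. Modulo
  the radical, this makes the right ideal of \<open>e\<close> simple.
\<close>

lemma primitive_idem_unit:
  assumes e: "primitive_idem e" and x: "x \<in> carrier R" "e \<otimes> x = x" "x \<notin> J"
  shows "\<exists>r\<in>carrier R. x \<otimes> r = e"
proof -
  have ec: "e \<in> carrier R" "e \<otimes> e = e" using e unfolding primitive_idem_def idem_def by auto
  obtain r where r: "r \<in> carrier R" "idem (x \<otimes> r)" "x \<otimes> r \<noteq> \<zero>" by (rule idem_multiple[OF x(1,3)])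
  define g where "g = x \<otimes> r"
  have g: "g \<in> carrier R" "g \<otimes> g = g" "g \<noteq> \<zero>" using r unfolding g_def idem_def by auto
  have eg: "e \<otimes> g = g" unfolding g_def using contract[OF x(2) ec(1) x(1) r(1)] .
  let ?h = "g \<otimes> e"
  have h: "?h \<in> carrier R" using g ec by (simp add: rng_m_closed)
  have "?h \<otimes> ?h = ?h"
    using g ec contract[OF eg ec(1) g(1) ec(1)] contract[OF g(2) g(1) g(1) ec(1)]
    by (simp add: rng_m_assoc rng_m_closed)
  then have "idem ?h" using h unfolding idem_def by simp
  moreover have "idem_le ?h e"
    unfolding idem_le_def using g ec contract[OF eg ec(1) g(1) ec(1)] by (simp add: rng_m_assoc)
  moreover have "?h \<noteq> \<zero>"
  proof
    assume "?h = \<zero>"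
    then have "?h \<otimes> g = \<zero>" using g(1) by (simp add: rng_l_null)
    moreover have "?h \<otimes> g = g" using g ec eg by (simp add: rng_m_assoc)
    ultimately show False using g(3) by simp
  qed
  ultimately have "?h = e" using e unfolding primitive_idem_def by blast
  then have "x \<otimes> (r \<otimes> e) = e" unfolding g_def using x(1) r(1) ec(1) by (simp add: rng_m_assoc)
  then show ?thesis using r(1) ec(1) rng_m_closed by blast
qed

lemma primitive_idem_below:
  assumes "idem e" "e \<noteq> \<zero>"
  obtains p where "primitive_idem p" "idem_le p e"
proof -
  have "wf idem_less"
    using idem_descending unfolding wf_iff_no_infinite_down_chain by blast
  moreover have "e \<in> {g. idem g \<and> g \<noteq> \<zero> \<and> idem_le g e}"
    using assms unfolding idem_le_def idem_def by simp
  ultimately obtain p where p: "p \<in> {g. idem g \<and> g \<noteq> \<zero> \<and> idem_le g e}"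
    "\<And>g. (g, p) \<in> idem_less \<Longrightarrow> g \<notin> {g. idem g \<and> g \<noteq> \<zero> \<and> idem_le g e}"
    by (rule wfE_min) blast
  have "g = \<zero> \<or> g = p" if g: "idem g" "idem_le g p" for g
  proof (rule ccontr)
    assume n: "\<not> ?thesis"
    then have "(g, p) \<in> idem_less" using g p(1) unfolding idem_less_def by blast
    moreover have "idem_le g e" using idem_le_trans[of g p e] g p(1) assms(1) by blast
    ultimately show False using p(2) g(1) n by blast
  qed
  then have "primitive_idem p" using p(1) unfolding primitive_idem_def by blast
  then show thesis using that p(1) by blast
qed

definition orthogonal_primitives :: "nat \<Rightarrow> (nat \<Rightarrow> 'a) \<Rightarrow> bool" where
  "orthogonal_primitives N e \<longleftrightarrow> (\<forall>i<N. primitive_idem (e i)) \<and>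
     (\<forall>i<N. \<forall>j<N. i \<noteq> j \<longrightarrow> e i \<otimes> e j = \<zero>)"

lemma orthogonal_sum_mult:
  assumes "orthogonal_primitives N e" "j < N"
  shows "(\<Oplus>i\<in>{..<N}. e i) \<otimes> e j = e j" "e j \<otimes> (\<Oplus>i\<in>{..<N}. e i) = e j"
proof -
  have e: "\<And>i. i < N \<Longrightarrow> e i \<in> carrier R \<and> e i \<otimes> e i = e i"
    "\<And>i k. i < N \<Longrightarrow> k < N \<Longrightarrow> i \<noteq> k \<Longrightarrow> e i \<otimes> e k = \<zero>"
    using assms(1) unfolding orthogonal_primitives_def primitive_idem_def idem_def by auto
  have ec: "e \<in> {..<N} \<rightarrow> carrier R" using e by auto
  have s: "(\<Oplus>i\<in>{..<N}. if j = i then e i else \<zero>) = e j"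
    by (rule finsum_singleton) (use assms(2) ec in auto)
  have "(\<Oplus>i\<in>{..<N}. e i \<otimes> e j) = (\<Oplus>i\<in>{..<N}. if j = i then e i else \<zero>)"
    by (rule finsum_cong') (use e assms(2) in auto)
  then show "(\<Oplus>i\<in>{..<N}. e i) \<otimes> e j = e j"
    using finsum_l_distr[of "{..<N}" e "e j"] ec s e(1)[OF assms(2)] by simp
  have "(\<Oplus>i\<in>{..<N}. e j \<otimes> e i) = (\<Oplus>i\<in>{..<N}. if j = i then e i else \<zero>)"
    by (rule finsum_cong') (use e assms(2) in auto)
  then show "e j \<otimes> (\<Oplus>i\<in>{..<N}. e i) = e j"
    using finsum_r_distr[of "{..<N}" e "e j"] ec s e(1)[OF assms(2)] by simp
qed

lemma orthogonal_sum_idem: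
  assumes "orthogonal_primitives N e"
  shows "idem (\<Oplus>i\<in>{..<N}. e i)"
proof -
  have ec: "e \<in> {..<N} \<rightarrow> carrier R"
    using assms unfolding orthogonal_primitives_def primitive_idem_def idem_def by auto
  let ?f = "\<Oplus>i\<in>{..<N}. e i"
  have f: "?f \<in> carrier R" using ec by (rule finsum_closed)
  have "?f \<otimes> ?f = (\<Oplus>i\<in>{..<N}. e i \<otimes> ?f)" by (rule finsum_l_distr) (use ec f in auto)
  also have "\<dots> = ?f"
    by (rule finsum_cong') (use ec orthogonal_sum_mult[OF assms] in auto)
  finally show ?thesis using f unfolding idem_def by simp
qed

text \<open>
  The ascending chain condition yields a family of orthogonal primitive idempotents with a
  largest sum \<open>f\<close>, and no nonzero idempotent is orthogonal to \<open>f\<close>.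
\<close>

lemma maximal_orthogonal_primitives:
  obtains N e where "orthogonal_primitives N e"
    and "\<And>g. idem g \<Longrightarrow> g \<otimes> (\<Oplus>i\<in>{..<N}. e i) = \<zero> \<Longrightarrow> (\<Oplus>i\<in>{..<N}. e i) \<otimes> g = \<zero> \<Longrightarrow> g = \<zero>"
proof -
  let ?Q = "{\<Oplus>i\<in>{..<N}. e i | N e. orthogonal_primitives N e}"
  have "wf (idem_less\<inverse>)"
    using idem_ascending unfolding wf_iff_no_infinite_down_chain by simp
  moreover have "orthogonal_primitives 0 (\<lambda>_. \<zero>)" unfolding orthogonal_primitives_def by simp
  then have "(\<Oplus>i\<in>{..<0::nat}. \<zero>) \<in> ?Q" by blast
  ultimately obtain f where f: "f \<in> ?Q" "\<And>g. (g, f) \<in> idem_less\<inverse> \<Longrightarrow> g \<notin> ?Q"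
    by (rule wfE_min) blast
  then obtain N e where e: "f = (\<Oplus>i\<in>{..<N}. e i)" "orthogonal_primitives N e" by blast
  have fi: "idem f" using orthogonal_sum_idem[OF e(2)] e(1) by simp
  then have fc: "f \<in> carrier R" "f \<otimes> f = f" unfolding idem_def by auto
  have ei: "e i \<in> carrier R" if "i < N" for i
    using e(2) that unfolding orthogonal_primitives_def primitive_idem_def idem_def by auto
  have "g = \<zero>" if g: "idem g" "g \<otimes> f = \<zero>" "f \<otimes> g = \<zero>" for g
  proof (rule ccontr)
    assume "g \<noteq> \<zero>"
    then obtain p where p: "primitive_idem p" "idem_le p g" by (rule primitive_idem_below[OF g(1)])
    have pc: "p \<in> carrier R" "p \<otimes> p = p" "p \<noteq> \<zero>" "p \<otimes> g = p" "g \<otimes> p = p"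
      using p unfolding primitive_idem_def idem_def idem_le_def by auto
    have gc: "g \<in> carrier R" using g(1) unfolding idem_def by blast
    have pf: "p \<otimes> f = \<zero>" using rng_m_assoc[OF pc(1) gc fc(1)] pc(4) g(2) rng_r_null[OF pc(1)] by simp
    have fp: "f \<otimes> p = \<zero>" using rng_m_assoc[OF fc(1) gc pc(1)] pc(5) g(3) rng_l_null[OF pc(1)] by simp
    let ?e = "e(N := p)"
    have pe: "p \<otimes> e i = \<zero>" "e i \<otimes> p = \<zero>" if "i < N" for i
    proof -
      have "f \<otimes> e i = e i" "e i \<otimes> f = e i" using orthogonal_sum_mult[OF e(2) that] e(1) by auto
      then show "p \<otimes> e i = \<zero>" "e i \<otimes> p = \<zero>"
        using rng_m_assoc[OF pc(1) fc(1) ei[OF that]] rng_m_assoc[OF ei[OF that] fc(1) pc(1)] pf fp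
          rng_l_null[OF ei[OF that]] rng_r_null[OF ei[OF that]] by simp_all
    qed
    have "orthogonal_primitives (Suc N) ?e"
      using e(2) p(1) pe unfolding orthogonal_primitives_def by (auto simp: less_Suc_eq)
    then have Q: "(\<Oplus>i\<in>{..<Suc N}. ?e i) \<in> ?Q" by blast
    have sum: "(\<Oplus>i\<in>{..<Suc N}. ?e i) = p \<oplus> f"
    proof -
      have "(\<Oplus>i\<in>insert N {..<N}. ?e i) = ?e N \<oplus> (\<Oplus>i\<in>{..<N}. ?e i)"
        by (rule finsum_insert) (use ei pc(1) in auto)
      moreover have "(\<Oplus>i\<in>{..<N}. ?e i) = f"
        unfolding e(1) by (rule finsum_cong') (use ei in auto)
      ultimately show ?thesis by (simp add: lessThan_Suc)
    qed
    have less: "(p \<oplus> f, f) \<in> idem_less\<inverse>"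
    proof -
      have "idem (p \<oplus> f)"
        using pc fc pf fp unfolding idem_def by (simp add: rng_l_distr rng_r_distr)
      moreover have "idem_le f (p \<oplus> f)"
        using pc fc pf fp unfolding idem_le_def by (simp add: rng_l_distr rng_r_distr)
      moreover have "p \<oplus> f \<noteq> f" using pc fc by simp
      ultimately show ?thesis using fi unfolding idem_less_def by auto
    qed
    show False using f(2)[OF less] Q unfolding sum by (rule notE)
  qed
  then show thesis using that[OF e(2)] e(1) by blast
qed

text \<open>
  Such a sum \<open>f\<close> is a unit modulo the radical: an idempotent multiple of \<open>(1 - f) x\<close> or of
  \<open>x (1 - f)\<close> would give an idempotent orthogonal to \<open>f\<close>.
\<close>

lemma maximal_idem_unit_mod_radical:
  assumes f: "idem f" and max: "\<And>g. idem g \<Longrightarrow> g \<otimes> f = \<zero> \<Longrightarrow> f \<otimes> g = \<zero> \<Longrightarrow> g = \<zero>"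
    and x: "x \<in> carrier R"
  shows "x \<ominus> f \<otimes> x \<in> J" "x \<ominus> x \<otimes> f \<in> J"
proof -
  have fc: "f \<in> carrier R" "f \<otimes> f = f" using f unfolding idem_def by auto
  show "x \<ominus> f \<otimes> x \<in> J"
  proof (rule ccontr)
    let ?y = "x \<ominus> f \<otimes> x"
    assume n: "?y \<notin> J"
    have yc: "?y \<in> carrier R" using x fc by (simp add: rng_m_closed)
    have fy: "f \<otimes> ?y = \<zero>"
      using x fc contract[OF fc(2) fc(1) fc(1) x] by (simp add: rng_r_diff rng_m_closed minus_self)
    obtain r where r: "r \<in> carrier R" "idem (?y \<otimes> r)" "?y \<otimes> r \<noteq> \<zero>" by (rule idem_multiple[OF yc n])
    define g where "g = ?y \<otimes> r"
    have g: "g \<in> carrier R" "g \<otimes> g = g" "g \<noteq> \<zero>" using r unfolding g_def idem_def by auto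
    have fg: "f \<otimes> g = \<zero>" unfolding g_def using contract[OF fy fc(1) yc r(1)] r(1) by (simp add: rng_l_null)
    let ?h = "g \<ominus> g \<otimes> f"
    have gf: "g \<otimes> f \<in> carrier R" using g fc by (simp add: rng_m_closed)
    have hg: "?h \<otimes> g = g"
      using g fc gf fg by (simp add: rng_l_diff rng_m_assoc rng_r_null diff_zero)
    have hf: "?h \<otimes> f = \<zero>"
      using g fc gf by (simp add: rng_l_diff rng_m_assoc minus_self)
    have fh: "f \<otimes> ?h = \<zero>"
      using g fc gf fg contract[OF fg fc(1) g(1) fc(1)]
      by (simp add: rng_r_diff rng_l_null minus_self)
    have hc: "?h \<in> carrier R" using g gf by simp
    have "?h \<otimes> ?h = (?h \<otimes> g) \<ominus> (?h \<otimes> g) \<otimes> f"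
      using rng_r_diff[OF g(1) gf hc] rng_m_assoc[OF hc g(1) fc(1)] by simp
    then have "?h \<otimes> ?h = ?h" using hg by simp
    then have "?h = \<zero>" using max[OF _ hf fh] hc unfolding idem_def by blast
    then show False using hg g rng_l_null by simp
  qed
  show "x \<ominus> x \<otimes> f \<in> J"
  proof (rule ccontr)
    let ?y = "x \<ominus> x \<otimes> f"
    assume n: "?y \<notin> J"
    have yc: "?y \<in> carrier R" using x fc by (simp add: rng_m_closed)
    have yf: "?y \<otimes> f = \<zero>"
      using x fc by (simp add: rng_l_diff rng_m_assoc rng_m_closed minus_self)
    obtain r where r: "r \<in> carrier R" "idem (?y \<otimes> r)" "?y \<otimes> r \<noteq> \<zero>" by (rule idem_multiple[OF yc n])
    define y where "y = ?y"
    define g where "g = y \<otimes> r"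
    have yc: "y \<in> carrier R" and yf: "y \<otimes> f = \<zero>" using yc yf unfolding y_def by auto
    have g: "g \<in> carrier R" "g \<otimes> g = g" "g \<noteq> \<zero>" using r unfolding g_def y_def idem_def by auto
    define h where "h = r \<otimes> (g \<otimes> y)"
    have hc: "h \<in> carrier R" unfolding h_def using r g yc by (simp add: rng_m_closed)
    have yr: "y \<otimes> (r \<otimes> z) = g \<otimes> z" if "z \<in> carrier R" for z
      using contract[OF g_def[symmetric] yc r(1) that] .
    have hh: "h \<otimes> h = h"
      unfolding h_def using r(1) g yc yr contract[OF g(2) g(1) g(1)]
      by (simp add: rng_m_assoc rng_m_closed)
    have hf: "h \<otimes> f = \<zero>"
      unfolding h_def using r(1) g yc fc yf by (simp add: rng_m_assoc rng_m_closed rng_r_null)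
    have hnz: "h \<noteq> \<zero>"
    proof
      assume "h = \<zero>"
      then have "y \<otimes> (h \<otimes> r) = \<zero>" using yc r(1) by (simp add: rng_l_null rng_r_null)
      moreover have "y \<otimes> (h \<otimes> r) = g"
        unfolding h_def using r(1) g yc yr g_def[symmetric] contract[OF g(2) g(1) g(1)]
        by (simp add: rng_m_assoc rng_m_closed)
      ultimately show False using g(3) by simp
    qed
    let ?k = "h \<ominus> f \<otimes> h"
    have fhc: "f \<otimes> h \<in> carrier R" using fc hc by (simp add: rng_m_closed)
    have kc: "?k \<in> carrier R" using hc fhc by simp
    have hk: "h \<otimes> ?k = h"
      using rng_r_diff[OF hc fhc hc] contract[OF hf hc fc(1) hc] hh rng_l_null[OF hc] diff_zero[OF hc] by simp
    have "?k \<otimes> ?k = (h \<otimes> ?k) \<ominus> f \<otimes> (h \<otimes> ?k)"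
      using rng_l_diff[OF hc fhc kc] rng_m_assoc[OF fc(1) hc kc] by simp
    then have "?k \<otimes> ?k = ?k" using hk by simp
    moreover have "?k \<otimes> f = \<zero>"
      using rng_l_diff[OF hc fhc fc(1)] rng_m_assoc[OF fc(1) hc fc(1)] hf rng_r_null[OF fc(1)]
        minus_self by simp
    moreover have "f \<otimes> ?k = \<zero>"
      using rng_r_diff[OF hc fhc fc(1)] contract[OF fc(2) fc(1) fc(1) hc] minus_self[OF fhc] by simp
    ultimately have "?k = \<zero>" using max kc unfolding idem_def by blast
    then show False using hk hnz hc rng_r_null by simp
  qed
qed

end

section \<open>Matrix decomposition of semisimple rings\<close>

lemma RDirProd_list_Cons_ops:
  assumes "a \<in> carrier Q" "as \<in> carrier (RDirProd_list Qs)" "b \<in> carrier Q" "bs \<in> carrier (RDirProd_list Qs)"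
  shows "(a # as) \<oplus>\<^bsub>RDirProd_list (Q # Qs)\<^esub> (b # bs) = (a \<oplus>\<^bsub>Q\<^esub> b) # (as \<oplus>\<^bsub>RDirProd_list Qs\<^esub> bs)"
    and "(a # as) \<otimes>\<^bsub>RDirProd_list (Q # Qs)\<^esub> (b # bs) = (a \<otimes>\<^bsub>Q\<^esub> b) # (as \<otimes>\<^bsub>RDirProd_list Qs\<^esub> bs)"
proof -
  have c: "(a, as) \<in> carrier (RDirProd Q (RDirProd_list Qs))" "(b, bs) \<in> carrier (RDirProd Q (RDirProd_list Qs))"
    using assms by (simp_all add: RDirProd_carrier)
  show "(a # as) \<oplus>\<^bsub>RDirProd_list (Q # Qs)\<^esub> (b # bs) = (a \<oplus>\<^bsub>Q\<^esub> b) # (as \<oplus>\<^bsub>RDirProd_list Qs\<^esub> bs)"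
    using ring_hom_add[OF RDirProd_list_hom1 c] by (simp add: RDirProd_def DirProd_def monoid.defs)
  show "(a # as) \<otimes>\<^bsub>RDirProd_list (Q # Qs)\<^esub> (b # bs) = (a \<otimes>\<^bsub>Q\<^esub> b) # (as \<otimes>\<^bsub>RDirProd_list Qs\<^esub> bs)"
    using ring_hom_mult[OF RDirProd_list_hom1 c] by (simp add: RDirProd_def DirProd_def monoid.defs)
qed

lemma RDirProd_list_family:
  assumes "\<And>q. q \<in> set qs \<Longrightarrow> h q x \<in> carrier (Q q) \<and> h q y \<in> carrier (Q q)"
  shows "map (\<lambda>q. h q x) qs \<in> carrier (RDirProd_list (map Q qs))"
    and "map (\<lambda>q. h q x) qs \<oplus>\<^bsub>RDirProd_list (map Q qs)\<^esub> map (\<lambda>q. h q y) qs =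
      map (\<lambda>q. h q x \<oplus>\<^bsub>Q q\<^esub> h q y) qs"
    and "map (\<lambda>q. h q x) qs \<otimes>\<^bsub>RDirProd_list (map Q qs)\<^esub> map (\<lambda>q. h q y) qs =
      map (\<lambda>q. h q x \<otimes>\<^bsub>Q q\<^esub> h q y) qs"
proof -
  have mem: "map (\<lambda>q. h q z) qs \<in> carrier (RDirProd_list (map Q qs))"
    if "\<And>q. q \<in> set qs \<Longrightarrow> h q z \<in> carrier (Q q)" for z qs
    by (rule RDirProd_list_carrier_memI) (use that in auto)
  show "map (\<lambda>q. h q x) qs \<in> carrier (RDirProd_list (map Q qs))" by (rule mem) (use assms in blast)
  show "map (\<lambda>q. h q x) qs \<oplus>\<^bsub>RDirProd_list (map Q qs)\<^esub> map (\<lambda>q. h q y) qs =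
      map (\<lambda>q. h q x \<oplus>\<^bsub>Q q\<^esub> h q y) qs"
    using assms
  proof (induction qs)
    case (Cons q qs)
    then show ?case using mem[of qs x] mem[of qs y] by (simp add: RDirProd_list_Cons_ops(1))
  qed (simp add: monoid.defs)
  show "map (\<lambda>q. h q x) qs \<otimes>\<^bsub>RDirProd_list (map Q qs)\<^esub> map (\<lambda>q. h q y) qs =
      map (\<lambda>q. h q x \<otimes>\<^bsub>Q q\<^esub> h q y) qs"
    using assms
  proof (induction qs)
    case (Cons q qs)
    then show ?case using mem[of qs x] mem[of qs y] by (simp add: RDirProd_list_Cons_ops(2))
  qed (simp add: monoid.defs)
qed

text \<open>
  The decomposition of a semisimple ring, as a module over itself, into simple right ideals
  \<open>e i S\<close>, in terms of idempotents. The ring is not presented with a unit, so the sum of the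
  idempotents is required to act as one.
\<close>

locale simple_decomposition = rng S for S (structure) +
  fixes N :: nat and e :: "nat \<Rightarrow> 'a"
  assumes e_closed: "i < N \<Longrightarrow> e i \<in> carrier S"
    and e_idem: "i < N \<Longrightarrow> e i \<otimes> e i = e i"
    and e_nonzero: "i < N \<Longrightarrow> e i \<noteq> \<zero>"
    and e_orthogonal: "i < N \<Longrightarrow> j < N \<Longrightarrow> i \<noteq> j \<Longrightarrow> e i \<otimes> e j = \<zero>"
    and sum_left: "x \<in> carrier S \<Longrightarrow> (\<Oplus>i\<in>{..<N}. e i) \<otimes> x = x"
    and sum_right: "x \<in> carrier S \<Longrightarrow> x \<otimes> (\<Oplus>i\<in>{..<N}. e i) = x"
    and simple: "i < N \<Longrightarrow> x \<in> carrier S \<Longrightarrow> e i \<otimes> x = x \<Longrightarrow> x \<noteq> \<zero> \<Longrightarrow> \<exists>r\<in>carrier S. x \<otimes> r = e i"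
begin

definition corner :: "nat \<Rightarrow> nat \<Rightarrow> 'a set" where
  "corner i j = {x \<in> carrier S. e i \<otimes> x = x \<and> x \<otimes> e j = x}"

text \<open>Left multiplications by \<open>v\<close> and \<open>u\<close> are inverse isomorphisms between \<open>e i S\<close> and \<open>e j S\<close>.\<close>

definition link :: "nat \<Rightarrow> nat \<Rightarrow> 'a \<Rightarrow> 'a \<Rightarrow> bool" where
  "link i j u v \<longleftrightarrow> u \<in> corner i j \<and> v \<in> corner j i \<and> u \<otimes> v = e i \<and> v \<otimes> u = e j"

lemma cornerI: "x \<in> carrier S \<Longrightarrow> e i \<otimes> x = x \<Longrightarrow> x \<otimes> e j = x \<Longrightarrow> x \<in> corner i j"
  by (simp add: corner_def)

lemma cornerD: "x \<in> corner i j \<Longrightarrow> x \<in> carrier S" "x \<in> corner i j \<Longrightarrow> e i \<otimes> x = x"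
  "x \<in> corner i j \<Longrightarrow> x \<otimes> e j = x"
  by (simp_all add: corner_def)

lemma corner_sandwich:
  assumes "i < N" "j < N" "x \<in> carrier S"
  shows "e i \<otimes> (x \<otimes> e j) \<in> corner i j"
proof (rule cornerI)
  note c = e_closed[OF assms(1)] e_closed[OF assms(2)] assms(3)
  show "e i \<otimes> (x \<otimes> e j) \<in> carrier S" using c by (simp add: rng_m_closed)
  show "e i \<otimes> (e i \<otimes> (x \<otimes> e j)) = e i \<otimes> (x \<otimes> e j)"
    using contract[OF e_idem[OF assms(1)] c(1) c(1)] c by (simp add: rng_m_closed)
  show "e i \<otimes> (x \<otimes> e j) \<otimes> e j = e i \<otimes> (x \<otimes> e j)"
    using c e_idem[OF assms(2)] by (simp add: rng_m_closed rng_m_assoc)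
qed

lemma corner_mult:
  assumes "x \<in> corner i j" "y \<in> corner j k" "i < N" "k < N"
  shows "x \<otimes> y \<in> corner i k"
proof (rule cornerI)
  note c = cornerD(1)[OF assms(1)] cornerD(1)[OF assms(2)] e_closed[OF assms(3)] e_closed[OF assms(4)]
  show "x \<otimes> y \<in> carrier S" using c by (simp add: rng_m_closed)
  show "e i \<otimes> (x \<otimes> y) = x \<otimes> y" by (rule contract[OF cornerD(2)[OF assms(1)] c(3,1,2)])
  show "x \<otimes> y \<otimes> e k = x \<otimes> y" using rng_m_assoc[OF c(1,2,4)] cornerD(3)[OF assms(2)] by simp
qed

lemma corner_right_inverse:
  assumes "i < N" "j < N" "x \<in> corner i j" "x \<noteq> \<zero>"
  shows "\<exists>y\<in>corner j i. x \<otimes> y = e i \<and> y \<noteq> \<zero>"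
proof -
  note x = cornerD[OF assms(3)] and c = e_closed[OF assms(1)] e_closed[OF assms(2)]
  obtain r where r: "r \<in> carrier S" "x \<otimes> r = e i" using simple[OF assms(1) x(1,2) assms(4)] by blast
  let ?y = "e j \<otimes> (r \<otimes> e i)"
  have y: "?y \<in> corner j i" by (rule corner_sandwich[OF assms(2,1) r(1)])
  have "x \<otimes> ?y = x \<otimes> (r \<otimes> e i)"
    using contract[OF x(3) x(1) c(2)] r(1) c by (simp add: rng_m_closed)
  also have "\<dots> = e i"
    using contract[OF r(2) x(1) r(1) c(1)] e_idem[OF assms(1)] by simp
  finally have xy: "x \<otimes> ?y = e i" .
  moreover have "?y \<noteq> \<zero>"
    using xy e_nonzero[OF assms(1)] rng_r_null[OF x(1)] by metis
  ultimately show ?thesis using y by blast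
qed

text \<open>Schur's lemma: a nonzero homomorphism between simple right ideals is invertible.\<close>

lemma link_of_corner:
  assumes "i < N" "j < N" "x \<in> corner i j" "x \<noteq> \<zero>"
  shows "\<exists>y. link i j x y"
proof -
  obtain y where y: "y \<in> corner j i" "x \<otimes> y = e i" "y \<noteq> \<zero>"
    using corner_right_inverse[OF assms] by blast
  obtain z where z: "z \<in> corner i j" "y \<otimes> z = e j"
    using corner_right_inverse[OF assms(2,1) y(1,3)] by blast
  note xc = cornerD[OF assms(3)] and yc = cornerD[OF y(1)] and zc = cornerD[OF z(1)]
  have "z = (x \<otimes> y) \<otimes> z" using y(2) zc(2) by simp
  also have "\<dots> = x \<otimes> (y \<otimes> z)" using xc(1) yc(1) zc(1) by (simp add: rng_m_assoc)
  also have "\<dots> = x" using z(2) xc(3) by simp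
  finally have "y \<otimes> x = e j" using z(2) by simp
  then show ?thesis using assms(3) y unfolding link_def by blast
qed

lemma link_refl: "i < N \<Longrightarrow> link i i (e i) (e i)"
  using e_closed e_idem by (simp add: link_def corner_def)

lemma link_sym: "link i j u v \<Longrightarrow> link j i v u"
  by (simp add: link_def)

lemma link_trans:
  assumes "link i j u v" "link j k u' v'" "i < N" "j < N" "k < N"
  shows "link i k (u \<otimes> u') (v' \<otimes> v)"
proof -
  have l: "u \<in> corner i j" "v \<in> corner j i" "u \<otimes> v = e i" "v \<otimes> u = e j"
    "u' \<in> corner j k" "v' \<in> corner k j" "u' \<otimes> v' = e j" "v' \<otimes> u' = e k"
    using assms(1,2) unfolding link_def by auto
  note c = cornerD(1)[OF l(1)] cornerD(1)[OF l(2)] cornerD(1)[OF l(5)] cornerD(1)[OF l(6)]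
  have "u \<otimes> u' \<otimes> (v' \<otimes> v) = u \<otimes> (u' \<otimes> (v' \<otimes> v))" using c by (simp add: rng_m_assoc rng_m_closed)
  also have "\<dots> = u \<otimes> v" using contract[OF l(7) c(3,4,2)] cornerD(2)[OF l(2)] by simp
  finally have 1: "u \<otimes> u' \<otimes> (v' \<otimes> v) = e i" using l(3) by simp
  have "v' \<otimes> v \<otimes> (u \<otimes> u') = v' \<otimes> (v \<otimes> (u \<otimes> u'))" using c by (simp add: rng_m_assoc rng_m_closed)
  also have "\<dots> = v' \<otimes> u'" using contract[OF l(4) c(2,1,3)] cornerD(2)[OF l(5)] by simp
  finally have 2: "v' \<otimes> v \<otimes> (u \<otimes> u') = e k" using l(8) by simp
  show ?thesis
    unfolding link_def using corner_mult[OF l(1,5) assms(3,5)] corner_mult[OF l(6,2) assms(5,3)] 1 2 by blast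
qed

definition rep :: "nat \<Rightarrow> nat" where
  "rep i = (LEAST j. j < N \<and> (\<exists>u v. link j i u v))"

lemma rep_link:
  assumes "i < N"
  shows "rep i < N" "\<exists>u v. link (rep i) i u v"
proof -
  have "i < N \<and> (\<exists>u v. link i i u v)" using link_refl assms by blast
  from LeastI[where P = "\<lambda>j. j < N \<and> (\<exists>u v. link j i u v)", OF this]
  show "rep i < N" "\<exists>u v. link (rep i) i u v" unfolding rep_def by blast+
qed

lemma rep_eq:
  assumes "i < N" "j < N" "link i j u v"
  shows "rep i = rep j"
proof -
  have "(\<exists>u v. link k i u v) \<longleftrightarrow> (\<exists>u v. link k j u v)" if "k < N" for k
    using link_trans[OF _ assms(3)] link_trans[OF _ link_sym[OF assms(3)]] that assms(1,2) by blast
  then have "(\<lambda>k. k < N \<and> (\<exists>u v. link k i u v)) = (\<lambda>k. k < N \<and> (\<exists>u v. link k j u v))" by blast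
  then show ?thesis unfolding rep_def by simp
qed

lemma rep_rep: "i < N \<Longrightarrow> rep (rep i) = rep i"
  using rep_link rep_eq by metis

lemma corner_trivial:
  assumes "i < N" "j < N" "rep i \<noteq> rep j" "x \<in> carrier S"
  shows "e i \<otimes> (x \<otimes> e j) = \<zero>"
proof (rule ccontr)
  assume "e i \<otimes> (x \<otimes> e j) \<noteq> \<zero>"
  from link_of_corner[OF assms(1,2) corner_sandwich[OF assms(1,2,4)] this]
  show False using rep_eq[OF assms(1,2)] assms(3) by blast
qed

text \<open>The matrix units in the row and in the column of the representative of \<open>i\<close>.\<close>

definition lu :: "nat \<Rightarrow> 'a" where "lu i = (SOME u. \<exists>v. link (rep i) i u v)"
definition lv :: "nat \<Rightarrow> 'a" where "lv i = (SOME v. link (rep i) i (lu i) v)"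

lemma link_lu_lv:
  assumes "i < N"
  shows "link (rep i) i (lu i) (lv i)"
proof -
  have "\<exists>v. link (rep i) i (lu i) v"
    unfolding lu_def using rep_link(2)[OF assms] by (rule someI_ex)
  then show ?thesis unfolding lv_def by (rule someI_ex)
qed

lemma lu_lv:
  assumes "i < N"
  shows "lu i \<in> corner (rep i) i" "lv i \<in> corner i (rep i)" "lu i \<otimes> lv i = e (rep i)" "lv i \<otimes> lu i = e i"
    "lu i \<in> carrier S" "lv i \<in> carrier S"
  using link_lu_lv[OF assms] unfolding link_def by (auto dest: cornerD(1))

definition cls :: "nat \<Rightarrow> nat list" where "cls r = filter (\<lambda>i. rep i = r) [0..<N]"

lemma cls_distinct: "distinct (cls r)" and set_cls: "set (cls r) = {i. i < N \<and> rep i = r}"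
  by (auto simp: cls_def)

lemma cls_nth: "k < length (cls r) \<Longrightarrow> cls r ! k < N \<and> rep (cls r ! k) = r"
  using nth_mem[of k "cls r"] set_cls[of r] by auto

definition corner_at :: "nat \<Rightarrow> 'a ring" where
  "corner_at r = \<lparr>carrier = corner r r, monoid.mult = (\<otimes>), one = e r, ring.zero = \<zero>, add = (\<oplus>)\<rparr>"

lemma corner_at_simps [simp]:
  "carrier (corner_at r) = corner r r" "monoid.mult (corner_at r) = (\<otimes>)" "one (corner_at r) = e r"
  "ring.zero (corner_at r) = \<zero>" "add (corner_at r) = (\<oplus>)"
  by (simp_all add: corner_at_def)

lemma corner_add: "i < N \<Longrightarrow> j < N \<Longrightarrow> x \<in> corner i j \<Longrightarrow> y \<in> corner i j \<Longrightarrow> x \<oplus> y \<in> corner i j"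
  using e_closed by (simp add: corner_def rng_l_distr rng_r_distr)

lemma corner_uminus: "i < N \<Longrightarrow> j < N \<Longrightarrow> x \<in> corner i j \<Longrightarrow> \<ominus> x \<in> corner i j"
  using e_closed by (simp add: corner_def rng_l_minus rng_r_minus)

lemma corner_zero: "i < N \<Longrightarrow> j < N \<Longrightarrow> \<zero> \<in> corner i j"
  using e_closed by (simp add: corner_def rng_l_null rng_r_null)

lemma corner_abelian_group:
  assumes "r < N"
  shows "abelian_group (corner_at r)"
proof (rule abelian_groupI)
  fix x assume "x \<in> carrier (corner_at r)"
  then have x: "x \<in> corner r r" by simp
  show "\<exists>y\<in>carrier (corner_at r). y \<oplus>\<^bsub>corner_at r\<^esub> x = \<zero>\<^bsub>corner_at r\<^esub>"
    using corner_uminus[OF assms assms x] cornerD(1)[OF x] by (intro bexI[of _ "\<ominus> x"]) (simp_all add: l_neg)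
qed (use corner_add[OF assms assms] corner_zero assms cornerD(1)[of _ r r] in \<open>simp_all add: a_ac\<close>)

lemma corner_ring:
  assumes "r < N"
  shows "ring (corner_at r)"
proof (rule ringI)
  show "abelian_group (corner_at r)" by (rule corner_abelian_group[OF assms])
  show "monoid (corner_at r)"
    by (rule monoidI)
      (use corner_mult link_refl[OF assms] assms cornerD in \<open>simp_all add: rng_m_assoc link_def\<close>)
qed (use cornerD(1) in \<open>simp_all add: rng_l_distr rng_r_distr\<close>)

lemma corner_division_ring:
  assumes "r < N"
  shows "division_ring (corner_at r)"
proof -
  have "Units (corner_at r) = carrier (corner_at r) - {\<zero>\<^bsub>corner_at r\<^esub>}"
  proof (intro equalityI subsetI)
    fix x assume x: "x \<in> Units (corner_at r)"
    then have xc: "x \<in> corner r r" by (simp add: Units_def)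
    have "x \<noteq> \<zero>"
    proof
      assume "x = \<zero>"
      then obtain y where "y \<in> corner r r" "y \<otimes> \<zero> = e r" using x by (auto simp: Units_def)
      then show False using rng_r_null[OF cornerD(1)] e_nonzero[OF assms] by metis
    qed
    then show "x \<in> carrier (corner_at r) - {\<zero>\<^bsub>corner_at r\<^esub>}" using xc by simp
  next
    fix x assume "x \<in> carrier (corner_at r) - {\<zero>\<^bsub>corner_at r\<^esub>}"
    then obtain y where "link r r x y" using link_of_corner[OF assms assms] by auto
    then show "x \<in> Units (corner_at r)" unfolding Units_def link_def by auto
  qed
  then show ?thesis
    unfolding division_ring_def using corner_ring[OF assms] e_nonzero[OF assms] by simp
qed

lemma corner_finsum:
  assumes "r < N" "\<And>k. k < (n::nat) \<Longrightarrow> f k \<in> corner r r"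
  shows "finsum (corner_at r) f {..<n} = (\<Oplus>k\<in>{..<n}. f k)"
  using assms(2)
proof (induction n)
  interpret D: abelian_group "corner_at r" by (rule corner_abelian_group[OF assms(1)])
  case 0
  then show ?case by (simp add: D.finsum_empty)
next
  interpret D: abelian_group "corner_at r" by (rule corner_abelian_group[OF assms(1)])
  case (Suc n)
  have "finsum (corner_at r) f (insert n {..<n}) = f n \<oplus>\<^bsub>corner_at r\<^esub> finsum (corner_at r) f {..<n}"
    by (rule D.finsum_insert) (use Suc.prems in auto)
  moreover have "finsum S f (insert n {..<n}) = f n \<oplus> finsum S f {..<n}"
    by (rule finsum_insert) (use Suc.prems cornerD(1)[of _ r r] in auto)
  ultimately show ?case using Suc.IH Suc.prems by (simp add: lessThan_Suc)
qed

text \<open>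
  The entry \<open>e i x e j\<close> of \<open>x\<close> lies in a corner of its own; the matrix units move it to the
  corner at \<open>r\<close>, where all entries of the block can be multiplied.
\<close>

definition block :: "nat \<Rightarrow> 'a \<Rightarrow> nat \<times> nat \<Rightarrow> 'a" where
  "block r x = (\<lambda>(k, l)\<in>{..<length (cls r)} \<times> {..<length (cls r)}.
     lu (cls r ! k) \<otimes> (x \<otimes> lv (cls r ! l)))"

lemma entry_corner:
  assumes "i < N" "j < N" "rep i = r" "rep j = r" "x \<in> carrier S"
  shows "lu i \<otimes> (x \<otimes> lv j) \<in> corner r r"
proof (rule cornerI)
  have r: "r < N" using rep_link(1)[OF assms(1)] assms(3) by simp
  note c = lu_lv(5)[OF assms(1)] lu_lv(6)[OF assms(2)] assms(5) e_closed[OF r]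
  show "lu i \<otimes> (x \<otimes> lv j) \<in> carrier S" using c by (simp add: rng_m_closed)
  show "e r \<otimes> (lu i \<otimes> (x \<otimes> lv j)) = lu i \<otimes> (x \<otimes> lv j)"
    using contract[of "e r" "lu i" "lu i" "x \<otimes> lv j"] cornerD(2)[OF lu_lv(1)[OF assms(1)]] c assms(3)
    by (simp add: rng_m_closed)
  show "lu i \<otimes> (x \<otimes> lv j) \<otimes> e r = lu i \<otimes> (x \<otimes> lv j)"
    using cornerD(3)[OF lu_lv(2)[OF assms(2)]] c assms(4) by (simp add: rng_m_assoc rng_m_closed)
qed

lemma block_carrier:
  assumes "x \<in> carrier S"
  shows "block r x \<in> carrier (matrix_ring (length (cls r)) (corner_at r))"
  unfolding matrix_ring_def block_def using entry_corner cls_nth assms by auto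

lemma block_add:
  assumes "x \<in> carrier S" "y \<in> carrier S"
  shows "block r (x \<oplus> y) = block r x \<oplus>\<^bsub>matrix_ring (length (cls r)) (corner_at r)\<^esub> block r y"
  unfolding matrix_ring_def block_def
  by (auto simp: fun_eq_iff restrict_def assms rng_l_distr rng_r_distr rng_m_closed lu_lv cls_nth)

text \<open>
  The matrix product sums over one class of idempotents only. The remaining idempotents
  contribute nothing, so that the sum may be taken over all of them, which is the unit.
\<close>

lemma entry_mult:
  assumes "i < N" "j < N" "rep i = r" "x \<in> carrier S" "y \<in> carrier S"
  shows "(\<Oplus>k\<in>{..<length (cls r)}. (lu i \<otimes> (x \<otimes> lv (cls r ! k))) \<otimes> (lu (cls r ! k) \<otimes> (y \<otimes> lv j)))
    = lu i \<otimes> (x \<otimes> (y \<otimes> lv j))"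
proof -
  let ?a = "lu i \<otimes> x" and ?b = "y \<otimes> lv j"
  let ?g = "\<lambda>m. ?a \<otimes> (e m \<otimes> ?b)"
  have a: "?a \<in> carrier S" and b: "?b \<in> carrier S"
    using lu_lv(5)[OF assms(1)] lu_lv(6)[OF assms(2)] assms(4,5) by (simp_all add: rng_m_closed)
  have g: "?g m \<in> carrier S" if "m < N" for m using a b e_closed[OF that] by (simp add: rng_m_closed)
  have "(lu i \<otimes> (x \<otimes> lv m)) \<otimes> (lu m \<otimes> ?b) = ?g m" if m: "m < N" for m
    using lu_lv(5)[OF assms(1)] assms(4) b lu_lv(5,6)[OF m] contract[OF lu_lv(4)[OF m] lu_lv(6,5)[OF m] b]
      e_closed[OF m] by (simp add: rng_m_assoc rng_m_closed)
  then have "(\<Oplus>k\<in>{..<length (cls r)}. (lu i \<otimes> (x \<otimes> lv (cls r ! k))) \<otimes> (lu (cls r ! k) \<otimes> ?b))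
      = (\<Oplus>k\<in>{..<length (cls r)}. ?g (cls r ! k))"
    by (intro finsum_cong') (use cls_nth g in auto)
  also have "\<dots> = (\<Oplus>m\<in>(!) (cls r) ` {..<length (cls r)}. ?g m)"
  proof (rule finsum_reindex[symmetric])
    show "?g \<in> (!) (cls r) ` {..<length (cls r)} \<rightarrow> carrier S" using cls_nth g by auto
    show "inj_on ((!) (cls r)) {..<length (cls r)}" by (rule inj_on_nth[OF cls_distinct]) simp
  qed
  also have "(!) (cls r) ` {..<length (cls r)} = {m. m < N \<and> rep m = r}"
    using nth_image[of "length (cls r)" "cls r"] set_cls[of r] by (simp add: atLeast0LessThan)
  also have "(\<Oplus>m\<in>{m. m < N \<and> rep m = r}. ?g m) = (\<Oplus>m\<in>{..<N}. ?g m)"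
  proof (rule add.finprod_mono_neutral_cong_left)
    fix m assume "m \<in> {..<N} - {m. m < N \<and> rep m = r}"
    then have m: "m < N" "rep i \<noteq> rep m" using assms(3) by auto
    have "?a \<otimes> e m = lu i \<otimes> (e i \<otimes> (x \<otimes> e m))"
      using contract[OF cornerD(3)[OF lu_lv(1)[OF assms(1)]] lu_lv(5)[OF assms(1)] e_closed[OF assms(1)],
          of "x \<otimes> e m"] lu_lv(5)[OF assms(1)] assms(4) e_closed[OF m(1)]
      by (simp add: rng_m_assoc rng_m_closed)
    also have "\<dots> = \<zero>" using corner_trivial[OF assms(1) m assms(4)] rng_r_null lu_lv(5)[OF assms(1)] by simp
    finally show "?g m = \<zero>" using contract[OF _ a e_closed[OF m(1)] b] rng_l_null[OF b] by simp
  qed (use g in auto)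
  also have "\<dots> = ?a \<otimes> (\<Oplus>m\<in>{..<N}. e m \<otimes> ?b)"
    by (rule finsum_r_distr[symmetric]) (use a b e_closed rng_m_closed in auto)
  also have "(\<Oplus>m\<in>{..<N}. e m \<otimes> ?b) = (\<Oplus>m\<in>{..<N}. e m) \<otimes> ?b"
    by (rule finsum_l_distr[symmetric]) (use b e_closed in auto)
  also have "\<dots> = ?b" by (rule sum_left[OF b])
  also have "?a \<otimes> ?b = lu i \<otimes> (x \<otimes> (y \<otimes> lv j))"
    using lu_lv(5)[OF assms(1)] assms(4) b by (simp add: rng_m_assoc)
  finally show ?thesis .
qed

lemma block_mult:
  assumes "x \<in> carrier S" "y \<in> carrier S" "r < N"
  shows "block r (x \<otimes> y) = block r x \<otimes>\<^bsub>matrix_ring (length (cls r)) (corner_at r)\<^esub> block r y"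
proof
  fix p :: "nat \<times> nat"
  let ?n = "length (cls r)"
  obtain k l where p: "p = (k, l)" by (cases p)
  show "block r (x \<otimes> y) p = (block r x \<otimes>\<^bsub>matrix_ring ?n (corner_at r)\<^esub> block r y) p"
  proof (cases "k < ?n \<and> l < ?n")
    case False
    then show ?thesis unfolding p matrix_ring_def block_def by auto
  next
    case True
    let ?i = "cls r ! k" and ?j = "cls r ! l"
    have ij: "?i < N" "?j < N" "rep ?i = r" "rep ?j = r" using cls_nth True by auto
    have "(block r x \<otimes>\<^bsub>matrix_ring ?n (corner_at r)\<^esub> block r y) p =
        (\<Oplus>\<^bsub>corner_at r\<^esub>m\<in>{..<?n}. block r x (k, m) \<otimes> block r y (m, l))"
      unfolding p matrix_ring_def using True by simp
    also have "\<dots> = (\<Oplus>m\<in>{..<?n}. block r x (k, m) \<otimes> block r y (m, l))"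
    proof (rule corner_finsum[OF assms(3)])
      fix m assume m: "m < ?n"
      have "block r x (k, m) \<in> corner r r" "block r y (m, l) \<in> corner r r"
        using True m entry_corner[OF ij(1) _ ij(3)] entry_corner[OF _ ij(2) _ ij(4)] cls_nth[OF m] assms
        unfolding block_def by simp_all
      then show "block r x (k, m) \<otimes> block r y (m, l) \<in> corner r r"
        by (rule corner_mult[OF _ _ assms(3) assms(3)])
    qed
    also have "\<dots> = (\<Oplus>m\<in>{..<?n}. (lu ?i \<otimes> (x \<otimes> lv (cls r ! m))) \<otimes> (lu (cls r ! m) \<otimes> (y \<otimes> lv ?j)))"
      by (rule finsum_cong') (use True cls_nth ij assms lu_lv in \<open>auto simp: block_def rng_m_closed\<close>)
    also have "\<dots> = lu ?i \<otimes> (x \<otimes> (y \<otimes> lv ?j))"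
      by (rule entry_mult[OF ij(1,2,3) assms(1,2)])
    also have "\<dots> = block r (x \<otimes> y) p"
      unfolding p block_def using True assms lu_lv(6)[OF ij(2)] by (simp add: rng_m_assoc)
    finally show ?thesis by simp
  qed
qed

definition reps :: "nat list" where "reps = filter (\<lambda>i. rep i = i) [0..<N]"

lemma reps_distinct: "distinct reps" and set_reps: "set reps = {r. r < N \<and> rep r = r}"
  by (auto simp: reps_def)

lemma cls_nonempty: "r \<in> set reps \<Longrightarrow> length (cls r) \<ge> 1"
  using set_cls[of r] set_reps by (cases "cls r") auto

lemma double_sum:
  assumes "x \<in> carrier S"
  shows "(\<Oplus>i\<in>{..<N}. \<Oplus>j\<in>{..<N}. e i \<otimes> (x \<otimes> e j)) = x"
proof -
  have c: "e i \<otimes> (x \<otimes> e j) \<in> carrier S" if "i < N" "j < N" for i j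
    using e_closed that assms by (simp add: rng_m_closed)
  have "(\<Oplus>j\<in>{..<N}. e i \<otimes> (x \<otimes> e j)) = e i \<otimes> x" if i: "i < N" for i
  proof -
    have "(\<Oplus>j\<in>{..<N}. e i \<otimes> (x \<otimes> e j)) = e i \<otimes> (\<Oplus>j\<in>{..<N}. x \<otimes> e j)"
      by (rule finsum_r_distr[symmetric]) (use e_closed i assms rng_m_closed in auto)
    also have "(\<Oplus>j\<in>{..<N}. x \<otimes> e j) = x \<otimes> (\<Oplus>j\<in>{..<N}. e j)"
      by (rule finsum_r_distr[symmetric]) (use e_closed assms in auto)
    finally show ?thesis using sum_right[OF assms] by simp
  qed
  then have "(\<Oplus>i\<in>{..<N}. \<Oplus>j\<in>{..<N}. e i \<otimes> (x \<otimes> e j)) = (\<Oplus>i\<in>{..<N}. e i \<otimes> x)"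
    by (intro finsum_cong') (use e_closed assms rng_m_closed in auto)
  also have "\<dots> = (\<Oplus>i\<in>{..<N}. e i) \<otimes> x"
    by (rule finsum_l_distr[symmetric]) (use e_closed assms in auto)
  finally show ?thesis using sum_left[OF assms] by simp
qed

lemma block_determines:
  assumes "x \<in> carrier S" "y \<in> carrier S" "\<And>r. r \<in> set reps \<Longrightarrow> block r x = block r y"
  shows "x = y"
proof -
  have "e i \<otimes> (x \<otimes> e j) = e i \<otimes> (y \<otimes> e j)" if ij: "i < N" "j < N" for i j
  proof (cases "rep i = rep j")
    case False
    then show ?thesis using corner_trivial ij assms(1,2) by simp
  next
    case True
    let ?r = "rep i"
    have r: "?r \<in> set reps" using set_reps rep_link(1) rep_rep ij by simp
    have "i \<in> set (cls ?r)" "j \<in> set (cls ?r)" using set_cls ij True by auto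
    then obtain k l where kl: "k < length (cls ?r)" "cls ?r ! k = i" "l < length (cls ?r)" "cls ?r ! l = j"
      by (auto simp: in_set_conv_nth)
    have "lu i \<otimes> (x \<otimes> lv j) = lu i \<otimes> (y \<otimes> lv j)"
      using fun_cong[OF assms(3)[OF r], of "(k, l)"] kl unfolding block_def by simp
    moreover have "lv i \<otimes> ((lu i \<otimes> (z \<otimes> lv j)) \<otimes> lu j) = e i \<otimes> (z \<otimes> e j)" if z: "z \<in> carrier S" for z
      using contract[OF lu_lv(4)[OF ij(1)] lu_lv(6,5)[OF ij(1)], of "z \<otimes> e j"] lu_lv[OF ij(1)] lu_lv[OF ij(2)]
        z e_closed[OF ij(2)] by (simp add: rng_m_assoc rng_m_closed)
    ultimately show ?thesis using assms(1,2) by metis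
  qed
  then have "(\<Oplus>i\<in>{..<N}. \<Oplus>j\<in>{..<N}. e i \<otimes> (x \<otimes> e j)) = (\<Oplus>i\<in>{..<N}. \<Oplus>j\<in>{..<N}. e i \<otimes> (y \<otimes> e j))"
    by (intro finsum_cong' refl) (use e_closed assms(2) rng_m_closed in auto)
  then show ?thesis using double_sum assms(1,2) by simp
qed

text \<open>The element is the sum of the prescribed entries, moved back to \<open>e i S e j\<close>.\<close>

lemma block_surj:
  assumes "\<And>i j. i < N \<Longrightarrow> j < N \<Longrightarrow> rep i = rep j \<Longrightarrow> a i j \<in> corner (rep i) (rep i)"
  shows "\<exists>x\<in>carrier S. \<forall>i<N. \<forall>j<N. rep i = rep j \<longrightarrow> lu i \<otimes> (x \<otimes> lv j) = a i j"
proof -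
  define b where "b = (\<lambda>i j. if rep i = rep j then lv i \<otimes> (a i j \<otimes> lu j) else \<zero>)"
  have b: "b i j \<in> corner i j" if ij: "i < N" "j < N" for i j
  proof (cases "rep i = rep j")
    case True
    have "a i j \<otimes> lu j \<in> corner (rep i) j"
      using corner_mult[OF assms[OF ij True]] lu_lv(1)[OF ij(2)] True rep_link(1)[OF ij(1)] ij(2) by simp
    then have "lv i \<otimes> (a i j \<otimes> lu j) \<in> corner i j"
      by (rule corner_mult[OF lu_lv(2)[OF ij(1)] _ ij])
    then show ?thesis using True by (simp add: b_def)
  qed (simp add: b_def corner_zero ij)
  have bc: "b i j \<in> carrier S" if "i < N" "j < N" for i j using b[OF that] by (rule cornerD(1))
  let ?x = "\<Oplus>i\<in>{..<N}. \<Oplus>j\<in>{..<N}. b i j"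
  have sc: "(\<Oplus>j\<in>{..<N}. b i j) \<in> carrier S" if "i < N" for i by (rule finsum_closed) (use bc that in auto)
  have x: "?x \<in> carrier S" by (rule finsum_closed) (use sc in auto)
  have "lu p \<otimes> (?x \<otimes> lv q) = a p q" if pq: "p < N" "q < N" "rep p = rep q" for p q
  proof -
    have row: "lu p \<otimes> b i j = (if p = i then lu p \<otimes> b p j else \<zero>)" if ij: "i < N" "j < N" for i j
    proof (cases "p = i")
      case False
      have "lu p \<otimes> b i j = (lu p \<otimes> e p) \<otimes> (e i \<otimes> b i j)"
        using cornerD(3)[OF lu_lv(1)[OF pq(1)]] cornerD(2)[OF b[OF ij]] by simp
      also have "\<dots> = lu p \<otimes> (e p \<otimes> (e i \<otimes> b i j))"
        using lu_lv(5)[OF pq(1)] e_closed[OF pq(1)] e_closed[OF ij(1)] bc[OF ij] by (simp add: rng_m_assoc rng_m_closed)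
      also have "e p \<otimes> (e i \<otimes> b i j) = \<zero>"
        using contract[OF e_orthogonal[OF pq(1) ij(1) False] e_closed[OF pq(1)] e_closed[OF ij(1)] bc[OF ij]]
          rng_l_null[OF bc[OF ij]] by simp
      finally show ?thesis using False rng_r_null[OF lu_lv(5)[OF pq(1)]] by simp
    qed simp
    have "lu p \<otimes> ?x = (\<Oplus>i\<in>{..<N}. lu p \<otimes> (\<Oplus>j\<in>{..<N}. b i j))"
      by (rule finsum_r_distr) (use sc lu_lv(5)[OF pq(1)] in auto)
    also have "\<dots> = (\<Oplus>i\<in>{..<N}. if p = i then (\<Oplus>j\<in>{..<N}. lu p \<otimes> b i j) else \<zero>)"
    proof (rule finsum_cong')
      fix i assume "i \<in> {..<N}"
      then have i: "i < N" by simp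
      have "lu p \<otimes> (\<Oplus>j\<in>{..<N}. b i j) = (\<Oplus>j\<in>{..<N}. lu p \<otimes> b i j)"
        by (rule finsum_r_distr) (use bc i lu_lv(5)[OF pq(1)] in auto)
      moreover have "(\<Oplus>j\<in>{..<N}. lu p \<otimes> b i j) = \<zero>" if "p \<noteq> i"
      proof -
        have "(\<Oplus>j\<in>{..<N}. lu p \<otimes> b i j) = (\<Oplus>j\<in>{..<N}. \<zero>)"
          by (rule finsum_cong') (use row i that in auto)
        then show ?thesis by (simp add: finsum_zero)
      qed
      ultimately show "lu p \<otimes> (\<Oplus>j\<in>{..<N}. b i j) = (if p = i then (\<Oplus>j\<in>{..<N}. lu p \<otimes> b i j) else \<zero>)"
        by simp
    qed (use bc lu_lv(5)[OF pq(1)] rng_m_closed in \<open>auto intro!: finsum_closed\<close>)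
    also have "\<dots> = (\<Oplus>j\<in>{..<N}. lu p \<otimes> b p j)"
      by (rule finsum_singleton) (use pq bc lu_lv(5)[OF pq(1)] rng_m_closed in \<open>auto intro!: finsum_closed\<close>)
    finally have 1: "lu p \<otimes> ?x = (\<Oplus>j\<in>{..<N}. lu p \<otimes> b p j)" .
    have pbc: "lu p \<otimes> b p j \<in> carrier S" if "j < N" for j
      using bc[OF pq(1) that] lu_lv(5)[OF pq(1)] by (simp add: rng_m_closed)
    have "lu p \<otimes> (?x \<otimes> lv q) = (lu p \<otimes> ?x) \<otimes> lv q"
      using lu_lv(5)[OF pq(1)] lu_lv(6)[OF pq(2)] x by (simp add: rng_m_assoc)
    also have "\<dots> = (\<Oplus>j\<in>{..<N}. (lu p \<otimes> b p j) \<otimes> lv q)"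
      unfolding 1 by (rule finsum_l_distr) (use pbc lu_lv(6)[OF pq(2)] in auto)
    also have "\<dots> = (\<Oplus>j\<in>{..<N}. if q = j then (lu p \<otimes> b p j) \<otimes> lv q else \<zero>)"
    proof (rule finsum_cong')
      fix j assume "j \<in> {..<N}"
      then have j: "j < N" by simp
      have "(lu p \<otimes> b p j) \<otimes> lv q = \<zero>" if ne: "q \<noteq> j"
      proof -
        have "(lu p \<otimes> b p j) \<otimes> lv q = (lu p \<otimes> (b p j \<otimes> e j)) \<otimes> (e q \<otimes> lv q)"
          using cornerD(3)[OF b[OF pq(1) j]] cornerD(2)[OF lu_lv(2)[OF pq(2)]] by simp
        also have "\<dots> = lu p \<otimes> (b p j \<otimes> (e j \<otimes> (e q \<otimes> lv q)))"
          using lu_lv(5)[OF pq(1)] lu_lv(6)[OF pq(2)] bc[OF pq(1) j] e_closed[OF j] e_closed[OF pq(2)]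
          by (simp add: rng_m_assoc rng_m_closed)
        also have "e j \<otimes> (e q \<otimes> lv q) = \<zero>"
          using contract[OF e_orthogonal[OF j pq(2) ne[symmetric]] e_closed[OF j] e_closed[OF pq(2)]
              lu_lv(6)[OF pq(2)]] rng_l_null[OF lu_lv(6)[OF pq(2)]] by simp
        finally show ?thesis using rng_r_null lu_lv(5)[OF pq(1)] bc[OF pq(1) j] by simp
      qed
      then show "(lu p \<otimes> b p j) \<otimes> lv q = (if q = j then (lu p \<otimes> b p j) \<otimes> lv q else \<zero>)" by simp
    qed (use pbc lu_lv(6)[OF pq(2)] rng_m_closed in auto)
    also have "\<dots> = (lu p \<otimes> b p q) \<otimes> lv q"
      by (rule finsum_singleton) (use pq pbc lu_lv(6)[OF pq(2)] rng_m_closed in auto)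
    also have "\<dots> = a p q"
    proof -
      have ac: "a p q \<in> carrier S" "e (rep p) \<otimes> a p q = a p q" "a p q \<otimes> e (rep p) = a p q"
        using cornerD[OF assms[OF pq]] by auto
      note c = lu_lv(5,6)[OF pq(1)] lu_lv(5,6)[OF pq(2)]
      have "(lu p \<otimes> b p q) \<otimes> lv q = lu p \<otimes> (lv p \<otimes> (a p q \<otimes> (lu q \<otimes> lv q)))"
        unfolding b_def using pq(3) c ac(1) by (simp add: rng_m_assoc rng_m_closed)
      also have "lu q \<otimes> lv q = e (rep p)" using lu_lv(3)[OF pq(2)] pq(3) by simp
      also have "lu p \<otimes> (lv p \<otimes> (a p q \<otimes> e (rep p))) = a p q"
        using contract[OF lu_lv(3)[OF pq(1)] c(1,2) ac(1)] ac by simp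
      finally show ?thesis .
    qed
    finally show ?thesis .
  qed
  then show ?thesis using x by blast
qed

theorem matrix_decomposition:
  "\<exists>Ds :: ('a ring \<times> nat) list. (\<forall>(D, n)\<in>set Ds. division_ring D \<and> n \<ge> 1) \<and>
     rng_isomorphic S (RDirProd_list (map (\<lambda>(D, n). matrix_ring n D) Ds))"
proof -
  let ?Ds = "map (\<lambda>r. (corner_at r, length (cls r))) reps"
  let ?Q = "\<lambda>r. matrix_ring (length (cls r)) (corner_at r)"
  let ?P = "RDirProd_list (map ?Q reps)"
  let ?h = "\<lambda>x. map (\<lambda>r. block r x) reps"
  have eq: "map (\<lambda>(D, n). matrix_ring n D) ?Ds = map ?Q reps" by simp
  have "\<forall>(D, n)\<in>set ?Ds. division_ring D \<and> n \<ge> 1"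
    using corner_division_ring cls_nonempty set_reps by auto
  moreover have "rng_isomorphic S ?P"
    unfolding rng_isomorphic_def
  proof (intro exI[of _ ?h] conjI ballI)
    fix x y assume xy: "x \<in> carrier S" "y \<in> carrier S"
    note fam = RDirProd_list_family[of reps block x ?Q y, OF conjI[OF block_carrier[OF xy(1)] block_carrier[OF xy(2)]]]
    have "?h (x \<oplus> y) = map (\<lambda>r. block r x \<oplus>\<^bsub>?Q r\<^esub> block r y) reps"
      by (rule map_cong[OF refl]) (rule block_add[OF xy])
    then show "?h (x \<oplus> y) = ?h x \<oplus>\<^bsub>?P\<^esub> ?h y" using fam(2) by simp
    have "?h (x \<otimes> y) = map (\<lambda>r. block r x \<otimes>\<^bsub>?Q r\<^esub> block r y) reps"
      by (rule map_cong[OF refl]) (use block_mult[OF xy] set_reps in blast)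
    then show "?h (x \<otimes> y) = ?h x \<otimes>\<^bsub>?P\<^esub> ?h y" using fam(3) by simp
  next
    show "bij_betw ?h (carrier S) (carrier ?P)"
      unfolding bij_betw_def
    proof
      show "inj_on ?h (carrier S)"
      proof (rule inj_onI)
        fix x y assume xy: "x \<in> carrier S" "y \<in> carrier S" "?h x = ?h y"
        have "block r x = block r y" if "r \<in> set reps" for r using xy(3) that by simp
        then show "x = y" by (rule block_determines[OF xy(1,2)])
      qed
      show "?h ` carrier S = carrier ?P"
      proof (intro equalityI subsetI)
        fix z assume "z \<in> ?h ` carrier S"
        then obtain x where x: "x \<in> carrier S" "z = ?h x" by blast
        then show "z \<in> carrier ?P"
          using RDirProd_list_family(1)[of reps block x ?Q x] block_carrier by simp
      next
        fix z assume z: "z \<in> carrier ?P"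
        have len: "length z = length reps" using RDirProd_list_carrier_mem(1)[OF z] by simp
        have zc: "z ! t \<in> carrier (?Q (reps ! t))" if "t < length reps" for t
          using RDirProd_list_carrier_mem(2)[OF z, of t] that by simp
        have "\<exists>t k. t < length reps \<and> reps ! t = rep i \<and> k < length (cls (rep i)) \<and> cls (rep i) ! k = i"
          if i: "i < N" for i
        proof -
          have "rep i \<in> set reps" "i \<in> set (cls (rep i))"
            using set_reps set_cls rep_link(1)[OF i] rep_rep[OF i] i by auto
          then show ?thesis by (simp add: in_set_conv_nth)
        qed
        then obtain t k where tk: "\<And>i. i < N \<Longrightarrow> t i < length reps" "\<And>i. i < N \<Longrightarrow> reps ! t i = rep i"
          "\<And>i. i < N \<Longrightarrow> k i < length (cls (rep i))" "\<And>i. i < N \<Longrightarrow> cls (rep i) ! k i = i"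
          by metis
        define a where "a = (\<lambda>i j. (z ! t i) (k i, k j))"
        have "a i j \<in> corner (rep i) (rep i)" if ij: "i < N" "j < N" "rep i = rep j" for i j
          using zc[OF tk(1)[OF ij(1)]] tk(2,3)[OF ij(1)] tk(3)[OF ij(2)] ij(3)
          unfolding a_def matrix_ring_def by (auto simp: PiE_def Pi_def)
        then obtain x where x: "x \<in> carrier S"
          "\<And>i j. i < N \<Longrightarrow> j < N \<Longrightarrow> rep i = rep j \<Longrightarrow> lu i \<otimes> (x \<otimes> lv j) = a i j"
          using block_surj[of a] by blast
        have "?h x = z"
        proof (rule nth_equalityI)
          fix s assume "s < length (?h x)"
          then have s: "s < length reps" by simp
          let ?r = "reps ! s"
          let ?n = "length (cls ?r)"
          have "block ?r x (i, j) = (z ! s) (i, j)" for i j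
          proof (cases "i < ?n \<and> j < ?n")
            case True
            let ?i = "cls ?r ! i" and ?j = "cls ?r ! j"
            have ij: "?i < N" "rep ?i = ?r" "?j < N" "rep ?j = ?r" using cls_nth True by auto
            have "t ?i = s"
              using tk(1,2)[OF ij(1)] ij(2) s nth_eq_iff_index_eq[OF reps_distinct] by metis
            moreover have "k ?i = i" "k ?j = j"
              using tk(3,4)[OF ij(1)] tk(3,4)[OF ij(3)] ij(2,4) True nth_eq_iff_index_eq[OF cls_distinct]
              by metis+
            ultimately have "lu ?i \<otimes> (x \<otimes> lv ?j) = (z ! s) (i, j)" using x(2)[OF ij(1,3)] ij(2,4) by (simp add: a_def)
            then show ?thesis unfolding block_def using True by simp
          next
            case False
            then have "(i, j) \<notin> {..<?n} \<times> {..<?n}" by auto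
            then show ?thesis
              using zc[OF s] unfolding block_def matrix_ring_def by (auto simp: PiE_def extensional_def)
          qed
          then show "?h x ! s = z ! s" using s by (auto simp: fun_eq_iff)
        qed (simp add: len)
        then show "z \<in> ?h ` carrier S" using x(1) by blast
      qed
    qed
  qed
  ultimately show ?thesis unfolding eq[symmetric] by blast
qed

end

section \<open>The quotient by the radical\<close>

context pi_regular_rng
begin

sublocale radical: abelian_subgroup J R
  by (rule abelian_subgroupI3)
    (use right_ideal_radical in \<open>simp_all add: right_ideal_def abelian_group_axioms\<close>)

abbreviation "coset x \<equiv> J +> x"

lemma coset_eq_iff:
  assumes "x \<in> carrier R" "y \<in> carrier R"
  shows "coset x = coset y \<longleftrightarrow> x \<ominus> y \<in> J"
proof
  assume "coset x = coset y"
  then have "x \<in> coset y" using radical.a_rcos_self[OF assms(1)] by simp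
  then show "x \<ominus> y \<in> J" using radical.a_rcos_module[OF assms(2,1)] by (simp add: a_minus_def)
next
  assume "x \<ominus> y \<in> J"
  then have "x \<in> coset y" using radical.a_rcos_module[OF assms(2,1)] by (simp add: a_minus_def)
  from a_repr_independence[OF this assms(2) radical.a_subgroup] show "coset x = coset y" by simp
qed

lemma coset_zero: "coset \<zero> = J" "x \<in> carrier R \<Longrightarrow> coset x = J \<longleftrightarrow> x \<in> J"
proof -
  show z: "coset \<zero> = J" by (rule radical.a_rcos_const[OF radical.zero_closed])
  show "coset x = J \<longleftrightarrow> x \<in> J" if "x \<in> carrier R"
    using coset_eq_iff[OF that zero_closed] z diff_zero[OF that] by simp
qed

abbreviation "Q \<equiv> R Quot J"

lemma quotient_carrier: "V \<in> carrier Q \<longleftrightarrow> (\<exists>x\<in>carrier R. V = coset x)"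
  by (auto simp: FactRing_def A_RCOSETS_def')

lemma quotientE:
  assumes "V \<in> carrier Q"
  obtains x where "x \<in> carrier R" "V = coset x"
  using assms unfolding quotient_carrier by blast

lemma coset_closed: "x \<in> carrier R \<Longrightarrow> coset x \<in> carrier Q"
  using quotient_carrier by blast

lemma quotient_add: "x \<in> carrier R \<Longrightarrow> y \<in> carrier R \<Longrightarrow> coset x \<oplus>\<^bsub>Q\<^esub> coset y = coset (x \<oplus> y)"
  using radical.a_rcos_sum by (simp add: FactRing_def)

lemma quotient_zero: "\<zero>\<^bsub>Q\<^esub> = J"
  by (simp add: FactRing_def)

lemma quotient_mult:
  assumes "x \<in> carrier R" "y \<in> carrier R"
  shows "coset x \<otimes>\<^bsub>Q\<^esub> coset y = coset (x \<otimes> y)"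
proof -
  have "coset (a \<otimes> b) = coset (x \<otimes> y)" if a: "a \<in> coset x" and b: "b \<in> coset y" for a b
  proof -
    have c: "a \<in> carrier R" "b \<in> carrier R"
      using a b a_r_coset_subset_G[OF radical.a_subset] assms by blast+
    have "a \<ominus> x \<in> J" "b \<ominus> y \<in> J"
      using radical.a_rcos_module[OF assms(1) c(1)] radical.a_rcos_module[OF assms(2) c(2)] a b
      by (simp_all add: a_minus_def)
    then have "(a \<ominus> x) \<otimes> b \<oplus> x \<otimes> (b \<ominus> y) \<in> J"
      using radical_r_mult radical_l_mult c assms by simp
    moreover have "(a \<ominus> x) \<otimes> b \<oplus> x \<otimes> (b \<ominus> y) = a \<otimes> b \<ominus> x \<otimes> y"
      using c assms minus_add_minus[of "a \<otimes> b" "x \<otimes> b" "x \<otimes> y"]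
      by (simp add: rng_l_diff rng_r_diff rng_m_closed)
    ultimately show ?thesis using coset_eq_iff c assms by (simp add: rng_m_closed)
  qed
  moreover have "x \<in> coset x" "y \<in> coset y" using radical.a_rcos_self assms by auto
  ultimately have "(\<Union>a\<in>coset x. \<Union>b\<in>coset y. coset (a \<otimes> b)) = coset (x \<otimes> y)" by blast
  then show ?thesis by (simp add: FactRing_def rcoset_mult_def)
qed

lemma rng_quotient: "rng Q"
proof (intro rng.intro rng_axioms.intro abelian_groupI)
  fix V assume "V \<in> carrier Q"
  then obtain x where x: "x \<in> carrier R" "V = coset x" by (rule quotientE)
  show "\<zero>\<^bsub>Q\<^esub> \<oplus>\<^bsub>Q\<^esub> V = V"
    using quotient_add[OF zero_closed x(1)] x coset_zero(1) quotient_zero by simp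
  have "coset (\<ominus> x) \<oplus>\<^bsub>Q\<^esub> V = \<zero>\<^bsub>Q\<^esub>"
    using quotient_add[of "\<ominus> x" x] x coset_zero(1) quotient_zero by (simp add: l_neg)
  then show "\<exists>Y\<in>carrier Q. Y \<oplus>\<^bsub>Q\<^esub> V = \<zero>\<^bsub>Q\<^esub>" using coset_closed[OF a_inv_closed[OF x(1)]] by (rule bexI)
next
  show "\<zero>\<^bsub>Q\<^esub> \<in> carrier Q" using coset_closed[OF zero_closed] quotient_zero coset_zero(1) by simp
next
  fix V Y assume V: "V \<in> carrier Q" and Y: "Y \<in> carrier Q"
  obtain x where x: "x \<in> carrier R" "V = coset x" by (rule quotientE[OF V])
  obtain y where y: "y \<in> carrier R" "Y = coset y" by (rule quotientE[OF Y])
  show "V \<oplus>\<^bsub>Q\<^esub> Y \<in> carrier Q" using x y by (simp add: quotient_add coset_closed)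
  show "V \<otimes>\<^bsub>Q\<^esub> Y \<in> carrier Q" using x y by (simp add: quotient_mult coset_closed rng_m_closed)
  show "V \<oplus>\<^bsub>Q\<^esub> Y = Y \<oplus>\<^bsub>Q\<^esub> V" using x y by (simp add: quotient_add a_comm)
next
  fix V Y Z assume V: "V \<in> carrier Q" and Y: "Y \<in> carrier Q" and Z: "Z \<in> carrier Q"
  obtain x where x: "x \<in> carrier R" "V = coset x" by (rule quotientE[OF V])
  obtain y where y: "y \<in> carrier R" "Y = coset y" by (rule quotientE[OF Y])
  obtain z where z: "z \<in> carrier R" "Z = coset z" by (rule quotientE[OF Z])
  show "V \<oplus>\<^bsub>Q\<^esub> Y \<oplus>\<^bsub>Q\<^esub> Z = V \<oplus>\<^bsub>Q\<^esub> (Y \<oplus>\<^bsub>Q\<^esub> Z)" using x y z by (simp add: quotient_add a_assoc)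
  show "V \<otimes>\<^bsub>Q\<^esub> Y \<otimes>\<^bsub>Q\<^esub> Z = V \<otimes>\<^bsub>Q\<^esub> (Y \<otimes>\<^bsub>Q\<^esub> Z)"
    using x y z by (simp add: quotient_mult rng_m_closed rng_m_assoc)
  show "(V \<oplus>\<^bsub>Q\<^esub> Y) \<otimes>\<^bsub>Q\<^esub> Z = V \<otimes>\<^bsub>Q\<^esub> Z \<oplus>\<^bsub>Q\<^esub> Y \<otimes>\<^bsub>Q\<^esub> Z"
    using x y z by (simp add: quotient_mult quotient_add rng_m_closed rng_l_distr)
  show "Z \<otimes>\<^bsub>Q\<^esub> (V \<oplus>\<^bsub>Q\<^esub> Y) = Z \<otimes>\<^bsub>Q\<^esub> V \<oplus>\<^bsub>Q\<^esub> Z \<otimes>\<^bsub>Q\<^esub> Y"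
    using x y z by (simp add: quotient_mult quotient_add rng_m_closed rng_r_distr)
qed

lemma quotient_finsum:
  assumes "\<And>i. i < (N::nat) \<Longrightarrow> f i \<in> carrier R"
  shows "(\<Oplus>\<^bsub>Q\<^esub>i\<in>{..<N}. coset (f i)) = coset (\<Oplus>i\<in>{..<N}. f i)"
proof -
  interpret Q: rng Q by (rule rng_quotient)
  show ?thesis
    using assms
  proof (induction N)
    case 0
    then show ?case using coset_zero(1) quotient_zero by (simp add: Q.finsum_empty)
  next
    case (Suc n)
    have "(\<Oplus>\<^bsub>Q\<^esub>i\<in>insert n {..<n}. coset (f i)) = coset (f n) \<oplus>\<^bsub>Q\<^esub> (\<Oplus>\<^bsub>Q\<^esub>i\<in>{..<n}. coset (f i))"
    proof (rule Q.finsum_insert)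
      have "coset (f i) \<in> carrier Q" if "i < Suc n" for i by (rule coset_closed[OF Suc.prems[OF that]])
      then show "(\<lambda>i. coset (f i)) \<in> {..<n} \<rightarrow> carrier Q" "coset (f n) \<in> carrier Q" by auto
    qed simp_all
    moreover have "(\<Oplus>i\<in>insert n {..<n}. f i) = f n \<oplus> (\<Oplus>i\<in>{..<n}. f i)"
      by (rule finsum_insert) (use Suc.prems in auto)
    moreover have "(\<Oplus>i\<in>{..<n}. f i) \<in> carrier R" by (rule finsum_closed) (use Suc.prems in auto)
    ultimately show ?case using Suc.IH Suc.prems quotient_add by (simp add: lessThan_Suc)
  qed
qed

theorem quotient_matrix_decomposition:
  "\<exists>Ds :: ('a set ring \<times> nat) list. (\<forall>(D, n)\<in>set Ds. division_ring D \<and> n \<ge> 1) \<and>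
     rng_isomorphic Q (RDirProd_list (map (\<lambda>(D, n). matrix_ring n D) Ds))"
proof -
  obtain N e where e: "orthogonal_primitives N e"
    and max: "\<And>g. idem g \<Longrightarrow> g \<otimes> (\<Oplus>i\<in>{..<N}. e i) = \<zero> \<Longrightarrow> (\<Oplus>i\<in>{..<N}. e i) \<otimes> g = \<zero> \<Longrightarrow> g = \<zero>"
    using maximal_orthogonal_primitives by blast
  let ?f = "\<Oplus>i\<in>{..<N}. e i"
  have prim: "primitive_idem (e i)" if "i < N" for i using e that unfolding orthogonal_primitives_def by blast
  have ec: "e i \<in> carrier R" "e i \<otimes> e i = e i" "e i \<noteq> \<zero>" "idem (e i)" if "i < N" for i
    using prim[OF that] unfolding primitive_idem_def idem_def by auto
  have fi: "idem ?f" by (rule orthogonal_sum_idem[OF e])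
  then have fc: "?f \<in> carrier R" unfolding idem_def by blast
  have sum: "(\<Oplus>\<^bsub>Q\<^esub>i\<in>{..<N}. coset (e i)) = coset ?f" by (rule quotient_finsum[OF ec(1)])
  have "simple_decomposition Q N (\<lambda>i. coset (e i))"
  proof (intro simple_decomposition.intro rng_quotient simple_decomposition_axioms.intro)
    fix i assume i: "i < N"
    show "coset (e i) \<in> carrier Q" by (rule coset_closed[OF ec(1)[OF i]])
    show "coset (e i) \<otimes>\<^bsub>Q\<^esub> coset (e i) = coset (e i)" using quotient_mult ec(1,2)[OF i] by simp
    have "e i \<notin> J" using idem_radical ec(3,4)[OF i] by blast
    then show "coset (e i) \<noteq> \<zero>\<^bsub>Q\<^esub>" using coset_zero(2)[OF ec(1)[OF i]] quotient_zero by simp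
  next
    fix i j assume ij: "i < N" "j < N" "i \<noteq> j"
    then have "e i \<otimes> e j = \<zero>" using e unfolding orthogonal_primitives_def by blast
    then show "coset (e i) \<otimes>\<^bsub>Q\<^esub> coset (e j) = \<zero>\<^bsub>Q\<^esub>"
      using quotient_mult[OF ec(1)[OF ij(1)] ec(1)[OF ij(2)]] coset_zero(1) quotient_zero by simp
  next
    fix V assume "V \<in> carrier Q"
    then obtain x where x: "x \<in> carrier R" "V = coset x" by (rule quotientE)
    have "x \<ominus> ?f \<otimes> x \<in> J"
      by (rule maximal_idem_unit_mod_radical(1)[OF fi _ x(1)]) (rule max)
    then have l: "coset x = coset (?f \<otimes> x)" using coset_eq_iff[OF x(1) rng_m_closed[OF fc x(1)]] by simp
    have "x \<ominus> x \<otimes> ?f \<in> J"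
      by (rule maximal_idem_unit_mod_radical(2)[OF fi _ x(1)]) (rule max)
    then have r: "coset x = coset (x \<otimes> ?f)" using coset_eq_iff[OF x(1) rng_m_closed[OF x(1) fc]] by simp
    show "(\<Oplus>\<^bsub>Q\<^esub>i\<in>{..<N}. coset (e i)) \<otimes>\<^bsub>Q\<^esub> V = V" "V \<otimes>\<^bsub>Q\<^esub> (\<Oplus>\<^bsub>Q\<^esub>i\<in>{..<N}. coset (e i)) = V"
      unfolding sum x(2) using quotient_mult[OF fc x(1)] quotient_mult[OF x(1) fc] l r by simp_all
  next
    fix i V assume i: "i < N" and VQ: "V \<in> carrier Q" and V: "coset (e i) \<otimes>\<^bsub>Q\<^esub> V = V" "V \<noteq> \<zero>\<^bsub>Q\<^esub>"
    obtain x where x: "x \<in> carrier R" "V = coset x" by (rule quotientE[OF VQ])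
    let ?y = "e i \<otimes> x"
    have y: "?y \<in> carrier R" using ec(1)[OF i] x(1) by (simp add: rng_m_closed)
    have Xy: "V = coset ?y" using V(1) quotient_mult[OF ec(1)[OF i] x(1)] x(2) by simp
    have "?y \<notin> J" using V(2) coset_zero(2)[OF y] quotient_zero Xy by simp
    moreover have "e i \<otimes> ?y = ?y" using contract[OF ec(2)[OF i] ec(1)[OF i] ec(1)[OF i] x(1)] .
    ultimately obtain r where r: "r \<in> carrier R" "?y \<otimes> r = e i" using primitive_idem_unit[OF prim[OF i] y] by blast
    then have "V \<otimes>\<^bsub>Q\<^esub> coset r = coset (e i)" using quotient_mult[OF y r(1)] Xy by simp
    then show "\<exists>Z\<in>carrier Q. V \<otimes>\<^bsub>Q\<^esub> Z = coset (e i)" using coset_closed[OF r(1)] by (rule bexI)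
  qed
  then show ?thesis by (rule simple_decomposition.matrix_decomposition)
qed

end

section \<open>Weakly small rings\<close>

locale weakly_small_rng = R: rng R + structure_over L M A
  for R :: "('a, 'm) ring_scheme" (structure)
    and L :: "('f, 'r) language" and M :: "('f, 'r, 'a) fo_structure" and A :: "'a set" +
  assumes expands: "expands_rng L M R" and ws: "weakly_small L M"
    and A_finite: "finite A" and A_subset: "A \<subseteq> carrier R"
begin

lemma univ_eq: "univ M = carrier R"
  using expands unfolding expands_rng_def by blast

lemma definable_add:
  assumes "i < k" "j < k" "l < k"
  shows "definable k (\<lambda>xs. xs ! i \<oplus> xs ! j = xs ! l)"
proof -
  obtain p where p: "p \<in> funs L" "fun_arity L p = 2"
    "\<And>x y. x \<in> carrier R \<Longrightarrow> y \<in> carrier R \<Longrightarrow> fun_interp M p [x, y] = x \<oplus> y"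
    using expands unfolding expands_rng_def by blast
  show ?thesis
  proof (rule definableI[of "Equal (Fn p [Var i, Var j]) (Var l)"])
    fix xs assume "xs \<in> tuples k"
    then have "xs ! i \<in> carrier R" "xs ! j \<in> carrier R"
      using assms nth_mem unfolding tuples_def univ_eq by auto
    then show "xs ! i \<oplus> xs ! j = xs ! l \<longleftrightarrow> sat M ((!) xs) (Equal (Fn p [Var i, Var j]) (Var l))"
      using p(3) by simp
  qed (use p assms in auto)
qed

lemma definable_mult:
  assumes "i < k" "j < k" "l < k"
  shows "definable k (\<lambda>xs. xs ! i \<otimes> xs ! j = xs ! l)"
proof -
  obtain t where t: "t \<in> funs L" "fun_arity L t = 2"
    "\<And>x y. x \<in> carrier R \<Longrightarrow> y \<in> carrier R \<Longrightarrow> fun_interp M t [x, y] = x \<otimes> y"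
    using expands unfolding expands_rng_def by blast
  show ?thesis
  proof (rule definableI[of "Equal (Fn t [Var i, Var j]) (Var l)"])
    fix xs assume "xs \<in> tuples k"
    then have "xs ! i \<in> carrier R" "xs ! j \<in> carrier R"
      using assms nth_mem unfolding tuples_def univ_eq by auto
    then show "xs ! i \<otimes> xs ! j = xs ! l \<longleftrightarrow> sat M ((!) xs) (Equal (Fn t [Var i, Var j]) (Var l))"
      using t(3) by simp
  qed (use t assms in auto)
qed

lemma definable_zero:
  assumes "i < k"
  shows "definable k (\<lambda>xs. xs ! i = \<zero>)"
proof -
  obtain z where z: "z \<in> funs L" "fun_arity L z = 0" "fun_interp M z [] = \<zero>"
    using expands unfolding expands_rng_def by blast
  show ?thesis
    by (rule definableI[of "Equal (Var i) (Fn z [])"]) (use z assms in auto)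
qed

abbreviation "\<Gamma> \<equiv> acl L M A"
abbreviation "G \<equiv> R\<lparr>carrier := \<Gamma>\<rparr>"

lemma acl_closed: "x \<in> \<Gamma> \<Longrightarrow> x \<in> carrier R"
  using acl_subset_univ univ_eq by blast

lemma acl_add:
  assumes "x \<in> \<Gamma>" "y \<in> \<Gamma>"
  shows "x \<oplus> y \<in> \<Gamma>"
proof (rule unique_solution_algebraic[of "[x, y]" "\<lambda>xs. xs ! 0 \<oplus> xs ! 1 = xs ! 2"])
  show "definable (Suc (length [x, y])) (\<lambda>xs. xs ! 0 \<oplus> xs ! 1 = xs ! 2)" by (rule definable_add) auto
qed (use assms acl_closed univ_eq in auto)

lemma acl_mult:
  assumes "x \<in> \<Gamma>" "y \<in> \<Gamma>"
  shows "x \<otimes> y \<in> \<Gamma>"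
proof (rule unique_solution_algebraic[of "[x, y]" "\<lambda>xs. xs ! 0 \<otimes> xs ! 1 = xs ! 2"])
  show "definable (Suc (length [x, y])) (\<lambda>xs. xs ! 0 \<otimes> xs ! 1 = xs ! 2)" by (rule definable_mult) auto
qed (use assms acl_closed univ_eq R.rng_m_closed in auto)

lemma acl_zero: "\<zero> \<in> \<Gamma>"
proof (rule unique_solution_algebraic[of "[]" "\<lambda>xs. xs ! 0 = \<zero>"])
  show "definable (Suc (length [])) (\<lambda>xs. xs ! 0 = \<zero>)" by (rule definable_zero) simp
qed (use univ_eq in auto)

lemma acl_uminus:
  assumes "x \<in> \<Gamma>"
  shows "\<ominus> x \<in> \<Gamma>"
proof (rule unique_solution_algebraic[of "[x, \<zero>]" "\<lambda>xs. xs ! 2 \<oplus> xs ! 0 = xs ! 1"])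
  show "definable (Suc (length [x, \<zero>])) (\<lambda>xs. xs ! 2 \<oplus> xs ! 0 = xs ! 1)" by (rule definable_add) auto
  fix y assume y: "y \<in> univ M"
  have "y \<oplus> x = \<zero> \<longleftrightarrow> y = \<ominus> x"
    using R.minus_equality y assms acl_closed univ_eq by (auto simp: R.l_neg)
  then show "([x, \<zero>] @ [y]) ! 2 \<oplus> ([x, \<zero>] @ [y]) ! 0 = ([x, \<zero>] @ [y]) ! 1 \<longleftrightarrow> y = \<ominus> x" by simp
qed (use assms acl_closed acl_zero univ_eq in auto)

lemma rng_acl: "rng G"
proof (intro rng.intro rng_axioms.intro abelian_groupI)
  fix x assume x: "x \<in> carrier G"
  show "\<exists>y\<in>carrier G. y \<oplus>\<^bsub>G\<^esub> x = \<zero>\<^bsub>G\<^esub>"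
    using acl_uminus[of x] x acl_closed by (auto simp: R.l_neg intro!: bexI[of _ "\<ominus> x"])
qed (use acl_add acl_mult acl_zero acl_closed in
    \<open>simp_all add: R.a_ac R.rng_m_assoc R.rng_l_distr R.rng_r_distr\<close>)

sublocale G: rng G
  rewrites "carrier G = \<Gamma>" and "add G = add R" and "monoid.mult G = monoid.mult R" and "ring.zero G = \<zero>"
  by (rule rng_acl) simp_all

lemma uminus_acl: "x \<in> \<Gamma> \<Longrightarrow> \<ominus>\<^bsub>G\<^esub> x = \<ominus> x"
  using G.minus_equality[of "\<ominus> x" x] acl_uminus acl_closed by (simp add: R.l_neg)

lemma minus_acl: "x \<in> \<Gamma> \<Longrightarrow> y \<in> \<Gamma> \<Longrightarrow> x \<ominus>\<^bsub>G\<^esub> y = x \<ominus> y"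
  by (simp add: a_minus_def uminus_acl)

lemma aut_add_acl:
  assumes "\<sigma> \<in> Aut" "x \<in> \<Gamma>" "y \<in> \<Gamma>"
  shows "\<sigma> (x \<oplus> y) = \<sigma> x \<oplus> \<sigma> y"
proof -
  have st: "same_type [x, y, x \<oplus> y] (map \<sigma> [x, y, x \<oplus> y])"
    by (rule AutD[OF assms(1)]) (use assms(2,3) acl_add in simp)
  have "definable (length [x, y, x \<oplus> y]) (\<lambda>xs. xs ! 0 \<oplus> xs ! 1 = xs ! 2)"
    by (rule definable_add) auto
  from same_typeD[OF st this] show ?thesis by simp
qed

lemma trace_translate:
  assumes "D \<in> traces" "g \<in> \<Gamma>"
  shows "{x \<in> \<Gamma>. x \<ominus>\<^bsub>G\<^esub> g \<in> D} \<in> traces"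
proof -
  obtain b P where b: "set b \<subseteq> \<Gamma>" "definable (Suc (length b)) P" "D = {x \<in> \<Gamma>. P (b @ [x])}"
    by (rule tracesE[OF assms(1)])
  let ?n = "length b"
  let ?is = "[0..<?n] @ [Suc (Suc ?n)]"
  let ?T = "\<lambda>zs. P (map ((!) zs) ?is) \<and> zs ! Suc (Suc ?n) \<oplus> zs ! ?n = zs ! Suc ?n"
  have "definable (Suc (Suc (Suc ?n))) ?T"
    by (rule definable_conj[OF definable_rename[OF b(2)] definable_add]) auto
  then have "definable (Suc (length (b @ [g]))) (\<lambda>zs. \<exists>y\<in>univ M. ?T (zs @ [y]))"
    using definable_ex by simp
  from tracesI[OF _ this] have "{x \<in> \<Gamma>. \<exists>y\<in>univ M. ?T (((b @ [g]) @ [x]) @ [y])} \<in> traces"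
    using b(1) assms(2) by simp
  moreover have "(\<exists>y\<in>univ M. ?T (((b @ [g]) @ [x]) @ [y])) \<longleftrightarrow> x \<ominus>\<^bsub>G\<^esub> g \<in> D" if x: "x \<in> \<Gamma>" for x
  proof -
    have m: "map ((!) (((b @ [g]) @ [x]) @ [y])) ?is = b @ [y]" for y
      by (rule nth_equalityI) (auto simp: nth_append)
    have n: "(((b @ [g]) @ [x]) @ [y]) ! Suc (Suc ?n) = y" "(((b @ [g]) @ [x]) @ [y]) ! ?n = g"
      "(((b @ [g]) @ [x]) @ [y]) ! Suc ?n = x" for y by (simp_all add: nth_append)
    have xg: "x \<ominus> g \<in> \<Gamma>" using x assms(2) acl_add acl_uminus by (simp add: a_minus_def)
    have "y \<oplus> g = x \<longleftrightarrow> y = x \<ominus> g" if "y \<in> univ M" for y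
      using that x assms(2) acl_closed univ_eq R.minus_add_cancel'[of x g] R.add_minus_cancel[of g y]
        R.a_comm[of g y] by auto
    then have "(\<exists>y\<in>univ M. P (b @ [y]) \<and> y \<oplus> g = x) \<longleftrightarrow> P (b @ [x \<ominus> g])"
      using xg acl_subset_univ by auto
    then show ?thesis unfolding m n b(3) using xg minus_acl[OF x assms(2)] by simp
  qed
  then have "{x \<in> \<Gamma>. \<exists>y\<in>univ M. ?T (((b @ [g]) @ [x]) @ [y])} = {x \<in> \<Gamma>. x \<ominus>\<^bsub>G\<^esub> g \<in> D}" by blast
  ultimately show ?thesis by simp
qed

lemma scattered_acl: "scattered_group G Aut traces"
proof (intro scattered_group.intro G.abelian_group_axioms scattered_group_axioms.intro)
  fix \<sigma> assume \<sigma>: "\<sigma> \<in> Aut"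
  show "bij_betw \<sigma> (carrier G) (carrier G)" using Aut_bij[OF \<sigma>] by simp
  show "\<exists>\<tau>\<in>Aut. \<forall>x\<in>carrier G. \<tau> (\<sigma> x) = x" using Aut_inverse[OF \<sigma>] by simp
  fix \<tau> assume "\<tau> \<in> Aut"
  with \<sigma> show "(\<lambda>x. \<sigma> (\<tau> x)) \<in> Aut" by (rule Aut_comp)
next
  fix \<sigma> x y assume "\<sigma> \<in> Aut" "x \<in> carrier G" "y \<in> carrier G"
  then show "\<sigma> (x \<oplus>\<^bsub>G\<^esub> y) = \<sigma> x \<oplus>\<^bsub>G\<^esub> \<sigma> y" using aut_add_acl by simp
next
  show "(\<lambda>x. x) \<in> Aut" by (rule Aut_id)
  have "definable (Suc (length [])) (\<lambda>xs. xs ! 0 = xs ! 0)" by (rule definable_eq) auto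
  from tracesI[OF _ this] show "carrier G \<in> traces" by simp
next
  fix D assume D: "D \<in> traces"
  show "D \<subseteq> carrier G" using traces_subset[OF D] by simp
  show "carrier G - D \<in> traces" using traces_compl[OF D] by simp
  show "finite {\<sigma> ` D | \<sigma>. \<sigma> \<in> Aut}" by (rule finite_trace_orbit[OF D])
  show "\<exists>B. finite B \<and> B \<subseteq> carrier G \<and> (\<forall>\<sigma>\<in>Aut. (\<forall>x\<in>B. \<sigma> x = x) \<longrightarrow> \<sigma> ` D = D)"
    using trace_support[OF D] by simp
next
  fix D E assume "D \<in> traces" "E \<in> traces"
  then show "D \<inter> E \<in> traces" by (rule traces_Int)
next
  fix D g assume "D \<in> traces" "g \<in> carrier G"
  then show "{x \<in> carrier G. x \<ominus>\<^bsub>G\<^esub> g \<in> D} \<in> traces" using trace_translate by simp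
next
  fix D \<sigma> assume "D \<in> traces" "\<sigma> \<in> Aut"
  then show "\<sigma> ` D \<in> traces" by (rule traces_image)
next
  fix x assume "x \<in> carrier G"
  then show "finite {\<sigma> x | \<sigma>. \<sigma> \<in> Aut}" using finite_point_orbit by simp
next
  fix B N
  assume "finite B" "B \<subseteq> carrier G" "N \<subseteq> traces" "{} \<notin> N"
    and inv: "\<forall>E\<in>N. \<forall>\<sigma>\<in>Aut. (\<forall>x\<in>B. \<sigma> x = x) \<longrightarrow> \<sigma> ` E = E"
    and split: "\<forall>E\<in>N. \<exists>Y\<in>N. \<exists>Z\<in>N. Y \<subseteq> E \<and> Z \<subseteq> E \<and> Y \<inter> Z = {}"
  then show "N = {}"
    using A_subset by (intro no_binary_tree_of_traces[of B N, OF ws A_finite]) (simp_all add: univ_eq)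
qed

lemma trace_chain_stationary:
  assumes "\<And>n. H n \<in> traces" "\<And>n. additive_subgroup (H n) G" "\<And>n. H (Suc n) \<subseteq> H n"
  shows "\<exists>m. \<forall>n\<ge>m. H n = H m"
  by (rule scattered_group.chain_stationary[OF scattered_acl]) (rule assms)+

lemma acl_subgroupI:
  assumes "H \<subseteq> \<Gamma>" "\<zero> \<in> H" "\<And>x y. x \<in> H \<Longrightarrow> y \<in> H \<Longrightarrow> x \<oplus> y \<in> H" "\<And>x. x \<in> H \<Longrightarrow> \<ominus> x \<in> H"
  shows "additive_subgroup H G"
proof -
  have "\<ominus>\<^bsub>G\<^esub> x \<in> H" if "x \<in> H" for x using uminus_acl[of x] that assms(1,4) by auto
  then show ?thesis using G.additive_subgroup_iff assms(1-3) by simp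
qed

lemma additive_image_subgroup:
  assumes "f \<zero> = \<zero>"
    and add: "\<And>r s. r \<in> carrier R \<Longrightarrow> s \<in> carrier R \<Longrightarrow> f (r \<oplus> s) = f r \<oplus> f s"
    and uminus: "\<And>r. r \<in> carrier R \<Longrightarrow> f (\<ominus> r) = \<ominus> f r"
  shows "additive_subgroup {x \<in> \<Gamma>. \<exists>r\<in>carrier R. f r = x} G" (is "additive_subgroup ?H G")
proof (rule acl_subgroupI)
  show "\<zero> \<in> ?H" using acl_zero assms(1) by auto
next
  fix x y assume "x \<in> ?H" "y \<in> ?H"
  then obtain r s where "x \<in> \<Gamma>" "y \<in> \<Gamma>" "r \<in> carrier R" "f r = x" "s \<in> carrier R" "f s = y" by blast
  then show "x \<oplus> y \<in> ?H" using acl_add add by (auto intro!: bexI[of _ "r \<oplus> s"])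
next
  fix x assume "x \<in> ?H"
  then obtain r where "x \<in> \<Gamma>" "r \<in> carrier R" "f r = x" by blast
  then show "\<ominus> x \<in> ?H" using acl_uminus uminus by (auto intro!: bexI[of _ "\<ominus> r"])
qed blast

text \<open>
  The chain condition is applied to four kinds of subgroups. The multiples are taken in the
  whole ring: \<open>b \<Gamma>\<close> need not be the trace of a definable set.
\<close>

lemma right_multiples:
  assumes "b \<in> \<Gamma>"
  shows "{x \<in> \<Gamma>. \<exists>r\<in>carrier R. b \<otimes> r = x} \<in> traces"
    and "additive_subgroup {x \<in> \<Gamma>. \<exists>r\<in>carrier R. b \<otimes> r = x} G"
proof -
  have "definable (Suc (Suc 1)) (\<lambda>xs. xs ! 0 \<otimes> xs ! 2 = xs ! 1)" by (rule definable_mult) auto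
  from definable_ex[OF this]
  have "definable (Suc (length [b])) (\<lambda>xs. \<exists>r\<in>univ M. (xs @ [r]) ! 0 \<otimes> (xs @ [r]) ! 2 = (xs @ [r]) ! 1)" by simp
  from tracesI[OF _ this] show "{x \<in> \<Gamma>. \<exists>r\<in>carrier R. b \<otimes> r = x} \<in> traces"
    using assms by (simp add: univ_eq)
  have bc: "b \<in> carrier R" using assms by (rule acl_closed)
  show "additive_subgroup {x \<in> \<Gamma>. \<exists>r\<in>carrier R. b \<otimes> r = x} G"
    by (rule additive_image_subgroup) (use bc in \<open>simp_all add: R.rng_r_null R.rng_r_distr R.rng_r_minus\<close>)
qed

lemma left_multiples:
  assumes "b \<in> \<Gamma>"
  shows "{x \<in> \<Gamma>. \<exists>r\<in>carrier R. r \<otimes> b = x} \<in> traces"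
    and "additive_subgroup {x \<in> \<Gamma>. \<exists>r\<in>carrier R. r \<otimes> b = x} G"
proof -
  have "definable (Suc (Suc 1)) (\<lambda>xs. xs ! 2 \<otimes> xs ! 0 = xs ! 1)" by (rule definable_mult) auto
  from definable_ex[OF this]
  have "definable (Suc (length [b])) (\<lambda>xs. \<exists>r\<in>univ M. (xs @ [r]) ! 2 \<otimes> (xs @ [r]) ! 0 = (xs @ [r]) ! 1)" by simp
  from tracesI[OF _ this] show "{x \<in> \<Gamma>. \<exists>r\<in>carrier R. r \<otimes> b = x} \<in> traces"
    using assms by (simp add: univ_eq)
  have bc: "b \<in> carrier R" using assms by (rule acl_closed)
  show "additive_subgroup {x \<in> \<Gamma>. \<exists>r\<in>carrier R. r \<otimes> b = x} G"
    by (rule additive_image_subgroup) (use bc in \<open>simp_all add: R.rng_l_null R.rng_l_distr R.rng_l_minus\<close>)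
qed

lemma annihilator:
  assumes "b \<in> \<Gamma>"
  shows "{x \<in> \<Gamma>. b \<otimes> x = \<zero>} \<in> traces" and "additive_subgroup {x \<in> \<Gamma>. b \<otimes> x = \<zero>} G"
proof -
  have "definable (Suc (Suc 1)) (\<lambda>xs. xs ! 0 \<otimes> xs ! 2 = xs ! 1)" by (rule definable_mult) auto
  then have "definable (Suc (length [b, \<zero>])) (\<lambda>xs. xs ! 0 \<otimes> xs ! 2 = xs ! 1)" by (simp add: numeral_2_eq_2)
  from tracesI[OF _ this] show "{x \<in> \<Gamma>. b \<otimes> x = \<zero>} \<in> traces" using assms acl_zero by simp
  have "b \<in> carrier R" using assms by (rule acl_closed)
  then show "additive_subgroup {x \<in> \<Gamma>. b \<otimes> x = \<zero>} G"
    by (intro acl_subgroupI)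
      (use acl_add acl_uminus acl_zero acl_closed in \<open>auto simp: R.rng_r_distr R.rng_r_minus R.rng_r_null\<close>)
qed

lemma fixed_points:
  assumes "b \<in> \<Gamma>"
  shows "{x \<in> \<Gamma>. b \<otimes> x = x} \<in> traces" and "additive_subgroup {x \<in> \<Gamma>. b \<otimes> x = x} G"
proof -
  have "definable (Suc (length [b])) (\<lambda>xs. xs ! 0 \<otimes> xs ! 1 = xs ! 1)" by (rule definable_mult) auto
  from tracesI[OF _ this] show "{x \<in> \<Gamma>. b \<otimes> x = x} \<in> traces" using assms by simp
  have "b \<in> carrier R" using assms by (rule acl_closed)
  then show "additive_subgroup {x \<in> \<Gamma>. b \<otimes> x = x} G"
    by (intro acl_subgroupI)
      (use acl_add acl_uminus acl_zero acl_closed in \<open>auto simp: R.rng_r_distr R.rng_r_minus R.rng_r_null\<close>)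
qed

text \<open>
  Inverses for von Neumann regularity are not unique and need not be algebraic. A mutual inverse
  that commutes with \<open>b\<close> is unique, which puts it into the algebraic closure.
\<close>

lemma group_inverse_unique:
  assumes c: "b \<in> carrier R" "c \<in> carrier R" "d \<in> carrier R"
    and bc: "b \<otimes> (c \<otimes> b) = b" "c \<otimes> (b \<otimes> c) = c" "b \<otimes> c = c \<otimes> b"
    and bd: "b \<otimes> (d \<otimes> b) = b" "d \<otimes> (b \<otimes> d) = d" "b \<otimes> d = d \<otimes> b"
  shows "c = d"
proof -
  note m = R.rng_m_assoc R.rng_m_closed
  have 1: "b \<otimes> c = c \<otimes> (b \<otimes> (b \<otimes> d))"
  proof -
    have "c \<otimes> (b \<otimes> (b \<otimes> d)) = c \<otimes> (b \<otimes> (d \<otimes> b))" using bd(3) by simp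
    then show ?thesis using bd(1) bc(3) by simp
  qed
  have 2: "c \<otimes> (b \<otimes> (b \<otimes> d)) = b \<otimes> d"
  proof -
    have "c \<otimes> (b \<otimes> (b \<otimes> d)) = (c \<otimes> b) \<otimes> (b \<otimes> d)" using c by (simp add: m)
    also have "\<dots> = (b \<otimes> c) \<otimes> (b \<otimes> d)" using bc(3) by simp
    also have "\<dots> = (b \<otimes> (c \<otimes> b)) \<otimes> d" using c by (simp add: m)
    finally show ?thesis using bc(1) by simp
  qed
  have e: "b \<otimes> c = b \<otimes> d" using 1 2 by simp
  have "c = c \<otimes> (b \<otimes> d)" using bc(2) e by simp
  also have "\<dots> = (b \<otimes> c) \<otimes> d" using c bc(3) by (simp add: m)
  also have "\<dots> = (d \<otimes> b) \<otimes> d" using e bd(3) by simp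
  also have "\<dots> = d" using c bd(2) by (simp add: m)
  finally show ?thesis .
qed

text \<open>
  The element \<open>e = b x = y b\<close> is a unit element for \<open>b\<close>, and \<open>e x = y e\<close> is the inverse of \<open>b\<close>.
\<close>

lemma group_inverse_algebraic:
  assumes b: "b \<in> \<Gamma>" and x: "x \<in> carrier R" "b = (b \<otimes> b) \<otimes> x" and y: "y \<in> carrier R" "b = y \<otimes> (b \<otimes> b)"
  shows "\<exists>c\<in>\<Gamma>. b \<otimes> c \<otimes> b = b"
proof -
  note m = R.rng_m_assoc R.rng_m_closed
  have bc: "b \<in> carrier R" using b by (rule acl_closed)
  define e where "e = b \<otimes> x"
  have ec: "e \<in> carrier R" unfolding e_def using bc x(1) by (simp add: m)
  have "y \<otimes> b = y \<otimes> ((b \<otimes> b) \<otimes> x)" using x(2) by simp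
  also have "\<dots> = (y \<otimes> (b \<otimes> b)) \<otimes> x" using bc x(1) y(1) by (simp add: m)
  finally have yb: "y \<otimes> b = e" unfolding e_def using y(2) by simp
  have be: "b \<otimes> e = b" unfolding e_def using x bc by (simp add: m)
  have eb: "e \<otimes> b = b" unfolding yb[symmetric] using y bc by (simp add: m)
  define c where "c = e \<otimes> x"
  have cc: "c \<in> carrier R" unfolding c_def using ec x(1) by (simp add: m)
  have ee: "e \<otimes> e = e"
  proof -
    have "e \<otimes> e = e \<otimes> (b \<otimes> x)" by (simp add: e_def)
    also have "\<dots> = (e \<otimes> b) \<otimes> x" using ec bc x(1) by (simp add: m)
    finally show ?thesis using eb by (simp add: e_def)
  qed
  have bce: "b \<otimes> c = e"
  proof -
    have "b \<otimes> c = (b \<otimes> e) \<otimes> x" unfolding c_def using bc ec x(1) by (simp add: m)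
    then show ?thesis using be by (simp add: e_def)
  qed
  have cy: "c = y \<otimes> e"
  proof -
    have "c = (y \<otimes> b) \<otimes> x" using yb by (simp add: c_def)
    also have "\<dots> = y \<otimes> (b \<otimes> x)" using y(1) bc x(1) by (simp add: m)
    finally show ?thesis by (simp add: e_def)
  qed
  have cbe: "c \<otimes> b = e" unfolding cy using y(1) ec bc eb yb by (simp add: m)
  have eqs: "b \<otimes> (c \<otimes> b) = b" "c \<otimes> (b \<otimes> c) = c" "b \<otimes> c = c \<otimes> b"
    unfolding cbe bce using be cy y(1) ec ee by (simp_all add: m)
  obtain t where t: "t \<in> funs L" "fun_arity L t = 2"
    "\<And>x y. x \<in> carrier R \<Longrightarrow> y \<in> carrier R \<Longrightarrow> fun_interp M t [x, y] = x \<otimes> y"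
    using expands unfolding expands_rng_def by blast
  let ?P = "\<lambda>xs. xs ! 0 \<otimes> (xs ! 1 \<otimes> xs ! 0) = xs ! 0 \<and> xs ! 1 \<otimes> (xs ! 0 \<otimes> xs ! 1) = xs ! 1 \<and>
    xs ! 0 \<otimes> xs ! 1 = xs ! 1 \<otimes> xs ! 0"
  let ?m = "\<lambda>s u. Fn t [s, u]"
  let ?\<phi> = "Conj (Equal (?m (Var 0) (?m (Var 1) (Var 0))) (Var 0))
    (Conj (Equal (?m (Var 1) (?m (Var 0) (Var 1))) (Var 1)) (Equal (?m (Var 0) (Var 1)) (?m (Var 1) (Var 0))))"
  have "definable (Suc (length [b])) ?P"
  proof (rule definableI[of ?\<phi>])
    fix xs assume "xs \<in> tuples (Suc (length [b]))"
    then have "xs ! 0 \<in> carrier R" "xs ! 1 \<in> carrier R"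
      using nth_mem[of 0 xs] nth_mem[of 1 xs] unfolding tuples_def univ_eq by auto
    then show "?P xs \<longleftrightarrow> sat M ((!) xs) ?\<phi>" using t(3) R.rng_m_closed by simp
  qed (use t in auto)
  then have "c \<in> \<Gamma>"
  proof (rule unique_solution_algebraic[rotated])
    show "set [b] \<subseteq> \<Gamma>" using b by simp
    show "c \<in> univ M" using cc univ_eq by simp
    fix d assume "d \<in> univ M"
    then have d: "d \<in> carrier R" using univ_eq by simp
    have nth: "([b] @ [d]) ! 0 = b" "([b] @ [d]) ! 1 = d" by simp_all
    show "?P ([b] @ [d]) \<longleftrightarrow> d = c"
      unfolding nth
    proof
      assume "b \<otimes> (d \<otimes> b) = b \<and> d \<otimes> (b \<otimes> d) = d \<and> b \<otimes> d = d \<otimes> b"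
      then show "d = c" by (elim conjE) (rule group_inverse_unique[OF bc d cc _ _ _ eqs])
    next
      assume "d = c"
      show "b \<otimes> (d \<otimes> b) = b \<and> d \<otimes> (b \<otimes> d) = d \<and> b \<otimes> d = d \<otimes> b"
        unfolding \<open>d = c\<close> by (intro conjI eqs)
    qed
  qed
  moreover have "b \<otimes> c \<otimes> b = b" using eqs(1) R.rng_m_assoc[OF bc cc bc] by simp
  ultimately show ?thesis by blast
qed

lemma iter_square_acl: "a \<in> \<Gamma> \<Longrightarrow> R.iter_square n a \<in> \<Gamma>"
  by (induction n) (simp_all add: acl_mult)

text \<open>
  The chains of right and of left multiples of the iterated squares of \<open>a\<close> become stationary, and
  then a square \<open>b\<close> satisfies \<open>b = b b x = y b b\<close>, with \<open>x\<close> and \<open>y\<close> in the whole ring.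
\<close>

lemma pi_regular_acl:
  assumes a: "a \<in> \<Gamma>"
  shows "\<exists>n. \<exists>c\<in>\<Gamma>. R.iter_square n a \<otimes> c \<otimes> R.iter_square n a = R.iter_square n a"
proof -
  note m = R.rng_m_assoc R.rng_m_closed
  let ?b = "\<lambda>n. R.iter_square n a"
  have b: "?b n \<in> \<Gamma>" "?b n \<in> carrier R" for n using iter_square_acl[OF a] acl_closed by auto
  let ?H = "\<lambda>n. {x \<in> \<Gamma>. \<exists>r\<in>carrier R. ?b n \<otimes> r = x}" and ?K = "\<lambda>n. {x \<in> \<Gamma>. \<exists>r\<in>carrier R. r \<otimes> ?b n = x}"
  have "?H (Suc n) \<subseteq> ?H n" for n
  proof
    fix x assume "x \<in> ?H (Suc n)"
    then obtain r where r: "x \<in> \<Gamma>" "r \<in> carrier R" "(?b n \<otimes> ?b n) \<otimes> r = x" by auto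
    then have "?b n \<otimes> (?b n \<otimes> r) = x" using b(2) by (simp add: m)
    moreover have "?b n \<otimes> r \<in> carrier R" using b(2) r(2) by (simp add: m)
    ultimately show "x \<in> ?H n" using r(1) by blast
  qed
  then obtain p where p: "\<forall>n\<ge>p. ?H n = ?H p"
    using trace_chain_stationary[of ?H] right_multiples[OF b(1)] by blast
  have "?K (Suc n) \<subseteq> ?K n" for n
  proof
    fix x assume "x \<in> ?K (Suc n)"
    then obtain r where r: "x \<in> \<Gamma>" "r \<in> carrier R" "r \<otimes> (?b n \<otimes> ?b n) = x" by auto
    then have "(r \<otimes> ?b n) \<otimes> ?b n = x" using b(2) by (simp add: m)
    moreover have "r \<otimes> ?b n \<in> carrier R" using b(2) r(2) by (simp add: m)
    ultimately show "x \<in> ?K n" using r(1) by blast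
  qed
  then obtain q where q: "\<forall>n\<ge>q. ?K n = ?K q"
    using trace_chain_stationary[of ?K] left_multiples[OF b(1)] by blast
  define n where "n = max p q"
  have n: "?H (Suc (Suc n)) = ?H n" "?K (Suc (Suc n)) = ?K n"
    using p[rule_format, of n] p[rule_format, of "Suc (Suc n)"] q[rule_format, of n]
      q[rule_format, of "Suc (Suc n)"] unfolding n_def by simp_all
  let ?c = "?b (Suc n)"
  have "?b n \<otimes> ?b n = ?c" by simp
  then have "?c \<in> ?H n" "?c \<in> ?K n" using b[of n] b(1)[of "Suc n"] by blast+
  then have "?c \<in> ?H (Suc (Suc n))" "?c \<in> ?K (Suc (Suc n))" using n by simp_all
  then obtain x y where xy: "x \<in> carrier R" "?b (Suc (Suc n)) \<otimes> x = ?c" "y \<in> carrier R" "y \<otimes> ?b (Suc (Suc n)) = ?c"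
    by blast
  have "?b (Suc (Suc n)) = ?c \<otimes> ?c" by simp
  then have "?c = (?c \<otimes> ?c) \<otimes> x" "?c = y \<otimes> (?c \<otimes> ?c)" using xy(2,4) by metis+
  from group_inverse_algebraic[OF b(1) xy(1) this(1) xy(3) this(2)] show ?thesis by blast
qed

lemma pi_regular_rng_acl: "pi_regular_rng G"
proof (intro pi_regular_rng.intro rng_acl pi_regular_rng_axioms.intro)
  fix a assume "a \<in> carrier G"
  then have "a \<in> \<Gamma>" by simp
  from pi_regular_acl[OF this] show "\<exists>n. \<exists>c\<in>carrier G.
      rng.iter_square G n a \<otimes>\<^bsub>G\<^esub> c \<otimes>\<^bsub>G\<^esub> rng.iter_square G n a = rng.iter_square G n a"
    by simp
next
  have less: "e \<in> \<Gamma> \<and> f \<in> \<Gamma> \<and> e \<otimes> e = e \<and> f \<otimes> f = f \<and> e \<otimes> f = e \<and> f \<otimes> e = e \<and> e \<noteq> f"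
    if "(e, f) \<in> rng.idem_less G" for e f
    using that unfolding G.idem_less_def G.idem_def G.idem_le_def by simp
  show "\<not> (\<exists>f. \<forall>i::nat. (f (Suc i), f i) \<in> rng.idem_less G)"
  proof
    assume "\<exists>f. \<forall>i::nat. (f (Suc i), f i) \<in> rng.idem_less G"
    then obtain f where f: "\<And>i::nat. f i \<in> \<Gamma> \<and> f i \<otimes> f i = f i \<and> f (Suc i) \<otimes> f i = f (Suc i) \<and>
        f i \<otimes> f (Suc i) = f (Suc i) \<and> f (Suc i) \<noteq> f i"
      using less by blast
    have fG: "f i \<in> \<Gamma>" for i using f by blast
    let ?H = "\<lambda>i. {x \<in> \<Gamma>. f i \<otimes> x = x}"
    have "?H (Suc i) \<subseteq> ?H i" for i
    proof
      fix x assume x: "x \<in> ?H (Suc i)"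
      have "f i \<otimes> (f (Suc i) \<otimes> x) = f (Suc i) \<otimes> x"
        using R.contract[of "f i" "f (Suc i)" "f (Suc i)" x] f[of i] f[of "Suc i"] x acl_closed by simp
      then show "x \<in> ?H i" using x by simp
    qed
    from trace_chain_stationary[of ?H, OF fixed_points(1)[OF fG] fixed_points(2)[OF fG] this]
    obtain n where n: "\<forall>k\<ge>n. ?H k = ?H n" by blast
    have "?H (Suc n) = ?H n" by (rule n[rule_format]) simp
    moreover have "f n \<in> ?H n" using f by simp
    ultimately have "f n \<in> ?H (Suc n)" by blast
    then show False using f[of n] by simp
  qed
  show "\<not> (\<exists>f. \<forall>i::nat. (f i, f (Suc i)) \<in> rng.idem_less G)"
  proof
    assume "\<exists>f. \<forall>i::nat. (f i, f (Suc i)) \<in> rng.idem_less G"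
    then obtain f where f: "\<And>i::nat. f i \<in> \<Gamma> \<and> f i \<otimes> f i = f i \<and> f i \<otimes> f (Suc i) = f i \<and>
        f (Suc i) \<otimes> f i = f i \<and> f i \<noteq> f (Suc i)"
      using less by blast
    have fG: "f i \<in> \<Gamma>" for i using f by blast
    have fc: "f i \<in> carrier R" for i using acl_closed[OF fG] .
    let ?H = "\<lambda>i. {x \<in> \<Gamma>. f i \<otimes> x = \<zero>}"
    have "?H (Suc i) \<subseteq> ?H i" for i
    proof
      fix x assume x: "x \<in> ?H (Suc i)"
      have "f i \<otimes> (f (Suc i) \<otimes> x) = f i \<otimes> x"
        using R.contract[of "f i" "f (Suc i)" "f i" x] f[of i] fc x acl_closed by simp
      then show "x \<in> ?H i" using x R.rng_r_null[OF fc] by simp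
    qed
    from trace_chain_stationary[of ?H, OF annihilator(1)[OF fG] annihilator(2)[OF fG] this]
    obtain n where n: "\<forall>k\<ge>n. ?H k = ?H n" by blast
    have eq: "?H (Suc n) = ?H n" by (rule n[rule_format]) simp
    let ?d = "f (Suc n) \<ominus> f n"
    have "?d \<in> \<Gamma>" using f acl_add acl_uminus by (simp add: a_minus_def)
    moreover have "f n \<otimes> ?d = \<zero>" using f[of n] fc R.rng_r_diff[OF fc fc fc] R.minus_self[OF fc] by simp
    ultimately have "?d \<in> ?H (Suc n)" using eq by simp
    then have "\<zero> = f (Suc n) \<otimes> ?d" by simp
    also have "\<dots> = ?d" using f[of n] f[of "Suc n"] R.rng_r_diff[OF fc fc fc] by simp
    finally have "f (Suc n) = \<zero> \<oplus> f n" using R.minus_add_cancel'[OF fc fc] by metis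
    then show False using f[of n] fc by simp
  qed
qed

end

theorem corollary5p18:
  fixes R :: "('a, 'm) ring_scheme"
    and L :: "('f, 'r) language"
    and M :: "('f, 'r, 'a) fo_structure"
    and A :: "'a set"
    and \<Gamma> :: "('a, 'm) ring_scheme"
  assumes "rng R"
    and "is_structure L M"
    and "expands_rng L M R"
    and "weakly_small L M"
    and "finite A"
    and "A \<subseteq> carrier R"
    and "\<Gamma> = R\<lparr>carrier := acl L M A\<rparr>"
  shows "\<exists>Ds :: ('a set ring \<times> nat) list.
           (\<forall>(D, n)\<in>set Ds. division_ring D \<and> n \<ge> 1) \<and>
           rng_isomorphic (\<Gamma> Quot jacobson_radical \<Gamma>)
             (RDirProd_list (map (\<lambda>(D, n). matrix_ring n D) Ds))"
proof -
  interpret weakly_small_rng R L M A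
    using assms by (intro weakly_small_rng.intro weakly_small_rng_axioms.intro) simp_all
  show ?thesis
    unfolding assms(7) by (rule pi_regular_rng.quotient_matrix_decomposition[OF pi_regular_rng_acl])
qed

end
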